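(* Let $\mathbb{X}$ be a $0$-dimensional subscheme of $\mathbb{P}^n$ with $K$-rational support and homogeneous coordinate ring $R$ (setting and notation as in the context), let $\mathbb{Y}$ be a proper ($0$-dimensional) subscheme of $\mathbb{X}$, and let $R_{\mathbb{Y}}=R/I_{\mathbb{Y}/\mathbb{X}}$ be the homogeneous coordinate ring of $\mathbb{Y}$. Then: (a) We have $\Omega^1_{R_{\mathbb{Y}}/K}\cong\Omega^1_{R/K}/dI_{\mathbb{Y}/\mathbb{X}}$. Moreover, for a system of non-zero homogeneous generators $\{g_1,\dots,g_r\}$ of $I_{\mathbb{Y}/\mathbb{X}}$, we have $$dI_{\mathbb{Y}/\mathbb{X}}=\langle dg_i,\ g_i\,dx_j\mid i=1,\dots,r;\ j=0,\dots,n\rangle.$$ (b) If $\deg(\mathbb{Y})=\deg(\mathbb{X})-1$, then $dI_{\mathbb{Y}/\mathbb{X}}=\langle df^*_{\mathbb{Y}},\ f^*_{\mathbb{Y}}\,dx_0\rangle$, where $f^*_{\mathbb{Y}}$ is a minimal separator of $\mathbb{Y}$ in $\mathbb{X}$. (c) If $\mathrm{char}(K)=0$ or $\mathrm{char}(K)>r_{\mathbb{X}}$, then $(dI_{\mathbb{Y}/\mathbb{X}})_{\alpha_{\mathbb{Y}/\mathbb{X}}}\ne0$.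
   Context: Let $K$ be a perfect field, $n\ge 1$, $P=K[X_0,\dots,X_n]$ with the standard grading, and $\mathbb{X}\subseteq\mathbb{P}^n$ a $0$-dimensional subscheme over $K$ all of whose support points are $K$-rational, with saturated homogeneous vanishing ideal $I_{\mathbb{X}}$. Put $R=P/I_{\mathbb{X}}$ and let $x_i$ be the image of $X_i$ in $R$. Assume no point of the support of $\mathbb{X}$ lies on the hyperplane $X_0=0$; then $x_0$ is a non-zerodivisor of $R$. Let $\mathrm{HF}_{\mathbb{X}}(i)=\dim_K R_i$, $\deg(\mathbb{X})$ its constant value for $i\gg0$, and $r_{\mathbb{X}}$ the least integer with $\mathrm{HF}_{\mathbb{X}}(i)=\deg(\mathbb{X})$ for all $i\ge r_{\mathbb{X}}$. For a subscheme $\mathbb{Y}\subseteq\mathbb{X}$ with saturated vanishing ideal $I_{\mathbb{Y}}\supseteq I_{\mathbb{X}}$, put $I_{\mathbb{Y}/\mathbb{X}}=I_{\mathbb{Y}}/I_{\mathbb{X}}\subseteq R$, and let $\alpha_{\mathbb{Y}/\mathbb{X}}=\min\{k\in\mathbb{N}\mid(I_{\mathbb{Y}/\mathbb{X}})_k\ne0\}$ be its initial degree. If $\deg(\mathbb{Y})=\deg(\mathbb{X})-1$, a minimal separator of $\mathbb{Y}$ in $\mathbb{X}$ is a non-zero homogeneous element $f^*_{\mathbb{Y}}\in I_{\mathbb{Y}/\mathbb{X}}$ of degree $\alpha_{\mathbb{Y}/\mathbb{X}}$. $\Omega^1_{R/K}$ is the module of Kähler differentials, graded with $\deg(dx_i)=1$,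 and $dI_{\mathbb{Y}/\mathbb{X}}$ is the $R$-submodule of $\Omega^1_{R/K}$ generated by $\{df\mid f\in I_{\mathbb{Y}/\mathbb{X}}\}$. Angle brackets denote generated $R$-submodules. *)

theory Defs
  imports "HOL-Algebra.Algebra" "HOL-Library.Poly_Mapping"
begin

section \<open>Modules\<close>

text \<open>The fields \<open>mult\<close> and \<open>one\<close> of the module record play no role and are left \<open>undefined\<close>.\<close>

definition mod_span :: "('a, 'c) ring_scheme \<Rightarrow> ('a, 'b) module \<Rightarrow> 'b set \<Rightarrow> 'b set" where
  "mod_span R M S = \<Inter> {N. submodule N R M \<and> S \<subseteq> N}"

definition mod_quot :: "('a, 'b) module \<Rightarrow> 'b set \<Rightarrow> ('a, 'b set) module" where
  "mod_quot M N =
     \<lparr>carrier = a_rcosets\<^bsub>M\<^esub> N, monoid.mult = undefined, monoid.one = undefined,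
      ring.zero = N, ring.add = set_add M,
      smult = (\<lambda>r U. \<Union>x\<in>U. N +>\<^bsub>M\<^esub> (r \<odot>\<^bsub>M\<^esub> x))\<rparr>"

definition restrict_scalars :: "('a \<Rightarrow> 'b) \<Rightarrow> ('b, 'm) module \<Rightarrow> ('a, 'm) module" where
  "restrict_scalars h M =
     \<lparr>carrier = carrier M, monoid.mult = monoid.mult M, monoid.one = monoid.one M, ring.zero = ring.zero M, ring.add = ring.add M,
      smult = (\<lambda>r x. h r \<odot>\<^bsub>M\<^esub> x)\<rparr>"

text \<open>A grading of a module is given by the family of its homogeneous components.
  The isomorphisms are \<open>R\<close>-linear and homogeneous of degree zero.\<close>

definition graded_module_iso ::
  "('a, 'd) ring_scheme \<Rightarrow> ('a, 'b) module \<Rightarrow> (nat \<Rightarrow> 'b set) \<Rightarrow>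
   ('a, 'c) module \<Rightarrow> (nat \<Rightarrow> 'c set) \<Rightarrow> ('b \<Rightarrow> 'c) set" where
  "graded_module_iso R M Mgr N Ngr =
     {h. h \<in> iso (add_monoid M) (add_monoid N) \<and>
         (\<forall>r\<in>carrier R. \<forall>x\<in>carrier M. h (r \<odot>\<^bsub>M\<^esub> x) = r \<odot>\<^bsub>N\<^esub> h x) \<and>
         (\<forall>k. h ` Mgr k = Ngr k)}"


section \<open>Kaehler differentials\<close>

text \<open>The free \<open>R\<close>-module on the set \<open>carrier R\<close>: finitely supported functions, extended by
  zero outside the carrier.\<close>

definition free_mod :: "'a ring \<Rightarrow> ('a, 'a \<Rightarrow> 'a) module" where
  "free_mod R =
     \<lparr>carrier = {f. (\<forall>x. f x \<in> carrier R) \<and> (\<forall>x. x \<notin> carrier R \<longrightarrow> f x = \<zero>\<^bsub>R\<^esub>) \<and>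
                    finite {x. f x \<noteq> \<zero>\<^bsub>R\<^esub>}},
      monoid.mult = undefined, monoid.one = undefined,
      ring.zero = (\<lambda>x. \<zero>\<^bsub>R\<^esub>),
      ring.add = (\<lambda>f g x. f x \<oplus>\<^bsub>R\<^esub> g x),
      smult = (\<lambda>r f x. r \<otimes>\<^bsub>R\<^esub> f x)\<rparr>"

definition free_gen :: "'a ring \<Rightarrow> 'a \<Rightarrow> 'a \<Rightarrow> 'a" where
  "free_gen R a = (\<lambda>x. if x = a then \<one>\<^bsub>R\<^esub> else \<zero>\<^bsub>R\<^esub>)"

text \<open>The base ring of the \<open>K\<close>-algebra \<open>R\<close> enters only through its image \<open>C\<close> in \<open>R\<close>:
  given the Leibniz rule, \<open>K\<close>-linearity of \<open>d\<close> amounts to additivity and \<open>d c = 0\<close> for all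
  \<open>c \<in> C\<close>.\<close>

definition kaehler_rels :: "'a ring \<Rightarrow> 'a set \<Rightarrow> ('a \<Rightarrow> 'a) set" where
  "kaehler_rels R C =
     (let F = free_mod R; \<delta> = free_gen R in
       {\<delta> (a \<oplus>\<^bsub>R\<^esub> b) \<ominus>\<^bsub>F\<^esub> (\<delta> a \<oplus>\<^bsub>F\<^esub> \<delta> b) | a b. a \<in> carrier R \<and> b \<in> carrier R} \<union>
       {\<delta> (a \<otimes>\<^bsub>R\<^esub> b) \<ominus>\<^bsub>F\<^esub> (a \<odot>\<^bsub>F\<^esub> \<delta> b \<oplus>\<^bsub>F\<^esub> b \<odot>\<^bsub>F\<^esub> \<delta> a) | a b. a \<in> carrier R \<and> b \<in> carrier R} \<union>
       {\<delta> c | c. c \<in> C})"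

definition kaehler :: "'a ring \<Rightarrow> 'a set \<Rightarrow> ('a, ('a \<Rightarrow> 'a) set) module" where
  "kaehler R C = mod_quot (free_mod R) (mod_span R (free_mod R) (kaehler_rels R C))"

definition kaehler_d :: "'a ring \<Rightarrow> 'a set \<Rightarrow> 'a \<Rightarrow> ('a \<Rightarrow> 'a) set" where
  "kaehler_d R C a =
     mod_span R (free_mod R) (kaehler_rels R C) +>\<^bsub>free_mod R\<^esub> free_gen R a"

text \<open>Grading for a graded algebra with components \<open>Rgr k\<close> generated by elements
  \<open>x 0, \<dots>, x n\<close> of degree one: here \<open>d (x j)\<close> has degree one, so the component of degree \<open>k\<close>
  consists of the sums of the \<open>a j \<cdot> d (x j)\<close> with \<open>a j\<close> of degree \<open>k - 1\<close>.\<close>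

definition kaehler_part ::
  "'a ring \<Rightarrow> 'a set \<Rightarrow> (nat \<Rightarrow> 'a set) \<Rightarrow> nat \<Rightarrow> (nat \<Rightarrow> 'a) \<Rightarrow> nat \<Rightarrow> ('a \<Rightarrow> 'a) set set" where
  "kaehler_part R C Rgr n x k =
     (if k = 0 then {\<zero>\<^bsub>kaehler R C\<^esub>}
      else {(\<Oplus>\<^bsub>kaehler R C\<^esub>j\<in>{..n}. a j \<odot>\<^bsub>kaehler R C\<^esub> kaehler_d R C (x j)) | a.
             a \<in> {..n} \<rightarrow> Rgr (k - 1)})"


section \<open>The polynomial ring\<close>

definition perfect_field :: "'k::field itself \<Rightarrow> bool" where
  "perfect_field _ \<longleftrightarrow> CHAR('k) = 0 \<or> (\<forall>x::'k. \<exists>y. y ^ CHAR('k) = x)"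

type_synonym 'k mpoly = "(nat \<Rightarrow>\<^sub>0 nat) \<Rightarrow>\<^sub>0 'k"

text \<open>\<open>K[X\<^sub>0, \<dots>, X\<^sub>n]\<close>: the polynomials in the variables with indices in \<open>{0..n}\<close>.\<close>

definition poly_ring :: "nat \<Rightarrow> 'k::field mpoly ring" where
  "poly_ring n =
     \<lparr>carrier = {p. \<forall>m\<in>Poly_Mapping.keys p. Poly_Mapping.keys m \<subseteq> {..n}},
      monoid.mult = (*), monoid.one = 1, ring.zero = 0, ring.add = (+)\<rparr>"

definition var :: "nat \<Rightarrow> 'k::field mpoly" where
  "var j = Poly_Mapping.single (Poly_Mapping.single j 1) 1"

definition const :: "'k::field \<Rightarrow> 'k mpoly" where
  "const c = Poly_Mapping.single 0 c"

definition mon_deg :: "(nat \<Rightarrow>\<^sub>0 nat) \<Rightarrow> nat" where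
  "mon_deg m = (\<Sum>i\<in>Poly_Mapping.keys m. Poly_Mapping.lookup m i)"

definition forms :: "nat \<Rightarrow> nat \<Rightarrow> 'k::field mpoly set" where
  "forms n k = {p \<in> carrier (poly_ring n). \<forall>m\<in>Poly_Mapping.keys p. mon_deg m = k}"

definition eval_at :: "(nat \<Rightarrow> 'k::field) \<Rightarrow> 'k mpoly \<Rightarrow> 'k" where
  "eval_at a p = (\<Sum>m\<in>Poly_Mapping.keys p.
     Poly_Mapping.lookup p m * (\<Prod>i\<in>Poly_Mapping.keys m. a i ^ Poly_Mapping.lookup m i))"


section \<open>Subschemes of projective space\<close>

definition homog_ideal :: "nat \<Rightarrow> 'k::field mpoly set \<Rightarrow> bool" where
  "homog_ideal n I \<longleftrightarrow>
     ideal I (poly_ring n) \<and> (\<exists>S. S \<subseteq> (\<Union>k. forms n k) \<and> I = Idl\<^bsub>poly_ring n\<^esub> S)"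

text \<open>Saturation with respect to the irrelevant ideal: an element multiplied into \<open>I\<close> by all
  forms of large degree lies in \<open>I\<close>.\<close>

definition saturated :: "nat \<Rightarrow> 'k::field mpoly set \<Rightarrow> bool" where
  "saturated n I \<longleftrightarrow>
     (\<forall>f\<in>carrier (poly_ring n).
        (\<exists>N. \<forall>k\<ge>N. \<forall>h\<in>forms n k. h \<otimes>\<^bsub>poly_ring n\<^esub> f \<in> I) \<longrightarrow> f \<in> I)"

text \<open>Closed subschemes of projective space are represented by their saturated homogeneous
  vanishing ideals. The points of the subscheme are the points of \<open>Proj (P / I)\<close>, i.e. the
  homogeneous primes of \<open>P\<close> that contain \<open>I\<close> but not the irrelevant ideal.\<close>

definition scheme_pts :: "nat \<Rightarrow> 'k::field mpoly set \<Rightarrow> 'k mpoly set set" where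
  "scheme_pts n I =
     {\<pp>. primeideal \<pp> (poly_ring n) \<and> homog_ideal n \<pp> \<and> I \<subseteq> \<pp> \<and> \<not> var ` {..n} \<subseteq> \<pp>}"

text \<open>Dimension zero: there are points, and no proper specialisations between points. In
  particular the empty scheme is excluded.\<close>

definition zero_dim_scheme :: "nat \<Rightarrow> 'k::field mpoly set \<Rightarrow> bool" where
  "zero_dim_scheme n I \<longleftrightarrow>
     homog_ideal n I \<and> saturated n I \<and> scheme_pts n I \<noteq> {} \<and>
     (\<forall>\<pp>\<in>scheme_pts n I. \<forall>\<qq>\<in>scheme_pts n I. \<pp> \<subseteq> \<qq> \<longrightarrow> \<pp> = \<qq>)"

text \<open>The homogeneous vanishing ideal of the point with homogeneous coordinates
  \<open>a 0, \<dots>, a n\<close>. Over a finite field the restriction to homogeneous generators matters.\<close>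

definition point_ideal :: "nat \<Rightarrow> (nat \<Rightarrow> 'k::field) \<Rightarrow> 'k mpoly set" where
  "point_ideal n a = Idl\<^bsub>poly_ring n\<^esub> {f \<in> (\<Union>k. forms n k). eval_at a f = 0}"

definition rational_support :: "nat \<Rightarrow> 'k::field mpoly set \<Rightarrow> bool" where
  "rational_support n I \<longleftrightarrow>
     (\<forall>\<pp>\<in>scheme_pts n I. \<exists>a. (\<exists>j\<le>n. a j \<noteq> 0) \<and> \<pp> = point_ideal n a)"


section \<open>Coordinate rings and Hilbert functions\<close>

definition coord_ring :: "nat \<Rightarrow> 'k::field mpoly set \<Rightarrow> 'k mpoly set ring" where
  "coord_ring n I = poly_ring n Quot I"

definition coord_part :: "nat \<Rightarrow> 'k::field mpoly set \<Rightarrow> nat \<Rightarrow> 'k mpoly set set" where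
  "coord_part n I k = (\<lambda>f. I +>\<^bsub>poly_ring n\<^esub> f) ` forms n k"

definition coord_var :: "nat \<Rightarrow> 'k::field mpoly set \<Rightarrow> nat \<Rightarrow> 'k mpoly set" where
  "coord_var n I j = I +>\<^bsub>poly_ring n\<^esub> var j"

definition coord_const :: "nat \<Rightarrow> 'k::field mpoly set \<Rightarrow> 'k mpoly set set" where
  "coord_const n I = (\<lambda>c. I +>\<^bsub>poly_ring n\<^esub> const c) ` UNIV"

text \<open>Hilbert functions are restricted to non-negative degrees. For non-empty schemes, the only
  ones considered, this does not affect the regularity index.\<close>

definition hilbert_fun :: "nat \<Rightarrow> 'k::field mpoly set \<Rightarrow> nat \<Rightarrow> nat" where
  "hilbert_fun n I k = ring.dim (coord_ring n I) (coord_const n I) (coord_part n I k)"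

definition scheme_deg :: "nat \<Rightarrow> 'k::field mpoly set \<Rightarrow> nat" where
  "scheme_deg n I = (THE d. \<exists>N. \<forall>k\<ge>N. hilbert_fun n I k = d)"

definition reg_index :: "nat \<Rightarrow> 'k::field mpoly set \<Rightarrow> nat" where
  "reg_index n I = (LEAST r. \<forall>k\<ge>r. hilbert_fun n I k = scheme_deg n I)"


section \<open>Subschemes of a subscheme\<close>

text \<open>The ideal \<open>I\<^sub>Y / I\<^sub>X\<close> of \<open>R = P / I\<^sub>X\<close>.\<close>

definition rel_ideal ::
  "nat \<Rightarrow> 'k::field mpoly set \<Rightarrow> 'k mpoly set \<Rightarrow> 'k mpoly set set" where
  "rel_ideal n IX IY = (\<lambda>f. IX +>\<^bsub>poly_ring n\<^esub> f) ` IY"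

definition init_deg :: "nat \<Rightarrow> 'k::field mpoly set \<Rightarrow> 'k mpoly set \<Rightarrow> nat" where
  "init_deg n IX IY =
     (LEAST k. rel_ideal n IX IY \<inter> coord_part n IX k \<noteq> {\<zero>\<^bsub>coord_ring n IX\<^esub>})"

definition minimal_separators ::
  "nat \<Rightarrow> 'k::field mpoly set \<Rightarrow> 'k mpoly set \<Rightarrow> 'k mpoly set set" where
  "minimal_separators n IX IY =
     {f \<in> rel_ideal n IX IY \<inter> coord_part n IX (init_deg n IX IY). f \<noteq> \<zero>\<^bsub>coord_ring n IX\<^esub>}"

definition Omega :: "nat \<Rightarrow> 'k::field mpoly set \<Rightarrow>
    ('k mpoly set, ('k mpoly set \<Rightarrow> 'k mpoly set) set) module" where
  "Omega n I = kaehler (coord_ring n I) (coord_const n I)"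

definition dd :: "nat \<Rightarrow> 'k::field mpoly set \<Rightarrow> 'k mpoly set \<Rightarrow>
    ('k mpoly set \<Rightarrow> 'k mpoly set) set" where
  "dd n I = kaehler_d (coord_ring n I) (coord_const n I)"

definition Omega_part :: "nat \<Rightarrow> 'k::field mpoly set \<Rightarrow> nat \<Rightarrow>
    ('k mpoly set \<Rightarrow> 'k mpoly set) set set" where
  "Omega_part n I =
     kaehler_part (coord_ring n I) (coord_const n I) (coord_part n I) n (coord_var n I)"

definition d_ideal :: "nat \<Rightarrow> 'k::field mpoly set \<Rightarrow> 'k mpoly set \<Rightarrow>
    ('k mpoly set \<Rightarrow> 'k mpoly set) set set" where
  "d_ideal n IX IY = mod_span (coord_ring n IX) (Omega n IX) (dd n IX ` rel_ideal n IX IY)"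

text \<open>The coordinate ring of \<open>Y\<close> as the iterated quotient \<open>R / (I\<^sub>Y / I\<^sub>X)\<close>, the projection
  from \<open>R\<close> onto it, and its module of Kaehler differentials with its grading, viewed as an
  \<open>R\<close>-module through the projection.\<close>

definition sub_ring ::
  "nat \<Rightarrow> 'k::field mpoly set \<Rightarrow> 'k mpoly set \<Rightarrow> 'k mpoly set set ring" where
  "sub_ring n IX IY = coord_ring n IX Quot rel_ideal n IX IY"

definition sub_proj ::
  "nat \<Rightarrow> 'k::field mpoly set \<Rightarrow> 'k mpoly set \<Rightarrow> 'k mpoly set \<Rightarrow> 'k mpoly set set" where
  "sub_proj n IX IY a = rel_ideal n IX IY +>\<^bsub>coord_ring n IX\<^esub> a"

definition sub_Omega :: "nat \<Rightarrow> 'k::field mpoly set \<Rightarrow> 'k mpoly set \<Rightarrow>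
    ('k mpoly set, ('k mpoly set set \<Rightarrow> 'k mpoly set set) set) module" where
  "sub_Omega n IX IY =
     restrict_scalars (sub_proj n IX IY)
       (kaehler (sub_ring n IX IY) (sub_proj n IX IY ` coord_const n IX))"

definition sub_Omega_part :: "nat \<Rightarrow> 'k::field mpoly set \<Rightarrow> 'k mpoly set \<Rightarrow> nat \<Rightarrow>
    ('k mpoly set set \<Rightarrow> 'k mpoly set set) set set" where
  "sub_Omega_part n IX IY =
     kaehler_part (sub_ring n IX IY) (sub_proj n IX IY ` coord_const n IX)
       (\<lambda>k. sub_proj n IX IY ` coord_part n IX k) n (\<lambda>j. sub_proj n IX IY (coord_var n IX j))"

end

theory Submission
  imports Defs
begin

text \<open>
  The universal property of the Kaehler differentials makes \<open>\<Omega> / dI\<close>, which is annihilated by \<open>I\<close>,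
  into an \<open>R / I\<close>-module isomorphic to the differentials of \<open>R / I\<close>; the Leibniz rule yields the
  generators of \<open>dI\<close>.

  A homogeneous ideal contained in no relevant homogeneous prime contains all forms of large
  degree. Applied to \<open>I : f\<close> and to \<open>I + (X\<^sub>0)\<close>, this shows that \<open>X\<^sub>0\<close> is a non-zerodivisor modulo \<open>I\<close>
  and that multiplication by \<open>X\<^sub>0\<close> is bijective in large degrees. Hence if the degrees of \<open>Y\<close> and \<open>X\<close>
  differ by one, all nonzero components of \<open>I\<^sub>Y / I\<^sub>X\<close> are one-dimensional, so a minimal separator \<open>f\<close>
  generates the ideal and satisfies \<open>x\<^sub>j f = c\<^sub>j x\<^sub>0 f\<close>; differentiating this relation expresses
  \<open>f dx\<^sub>j\<close> through \<open>df\<close> and \<open>f dx\<^sub>0\<close>. Beyond the regularity index every form is a multiple of \<open>X\<^sub>0\<close>,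
  so the initial degree \<open>\<alpha>\<close> of \<open>I\<^sub>Y / I\<^sub>X\<close> is at most the regularity index and \<open>\<alpha>\<close> is invertible in the
  field; the linear map induced by the Euler derivation sends \<open>df\<close> to \<open>\<alpha> f\<close>, which is nonzero.
\<close>


section \<open>Linear maps and quotient modules\<close>

text \<open>The two modules compared in (a) have their universal properties over different rings, R
  and R / I. Scalars therefore move in both directions: one module is made an R / I-module to
  receive a derivation, and the other is viewed over R to receive another. The geometric input is
  one fact: a homogeneous prime over I that contains X_0 contains all variables. No change of
  coordinates is made, so the size of the field is irrelevant. For (b), multiplication by X_0^e
  embeds each component of I_Y / I_X into one of large degree, whose dimension is the difference of
  the two degrees. From x_j f = c x_0 f and dc = 0 comes f dx_j = c (x_0 df + f dx_0) - x_j df. For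
  (c), the bound on the initial degree needs X_0 to be cancellable modulo I_Y as well, and the
  initial degree is positive because Y is nonempty.\<close>

definition linear_map ::
  "('a, 'd) ring_scheme \<Rightarrow> ('a, 'b) module \<Rightarrow> ('a, 'c) module \<Rightarrow> ('b \<Rightarrow> 'c) \<Rightarrow> bool" where
  "linear_map R M N h \<longleftrightarrow>
     h \<in> carrier M \<rightarrow> carrier N \<and>
     (\<forall>x\<in>carrier M. \<forall>y\<in>carrier M. h (x \<oplus>\<^bsub>M\<^esub> y) = h x \<oplus>\<^bsub>N\<^esub> h y) \<and>
     (\<forall>r\<in>carrier R. \<forall>x\<in>carrier M. h (r \<odot>\<^bsub>M\<^esub> x) = r \<odot>\<^bsub>N\<^esub> h x)"

lemma linear_mapD:
  assumes "linear_map R M N h"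
  shows "x \<in> carrier M \<Longrightarrow> h x \<in> carrier N"
    and "x \<in> carrier M \<Longrightarrow> y \<in> carrier M \<Longrightarrow> h (x \<oplus>\<^bsub>M\<^esub> y) = h x \<oplus>\<^bsub>N\<^esub> h y"
    and "r \<in> carrier R \<Longrightarrow> x \<in> carrier M \<Longrightarrow> h (r \<odot>\<^bsub>M\<^esub> x) = r \<odot>\<^bsub>N\<^esub> h x"
  using assms by (auto simp: linear_map_def)

lemma linear_map_comp:
  assumes "linear_map R M N f" "linear_map R N L g"
  shows "linear_map R M L (\<lambda>x. g (f x))"
  using assms unfolding linear_map_def by (auto simp: Pi_iff)

lemma linear_map_group_hom:
  assumes "module R M" "module R N" "linear_map R M N h"
  shows "abelian_group_hom M N h"
proof -
  interpret M: module R M by fact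
  interpret N: module R N by fact
  show ?thesis
    by (rule abelian_group_homI)
      (auto simp: M.abelian_group_axioms N.abelian_group_axioms group_hom_def group_hom_axioms_def
        M.a_group N.a_group hom_def linear_mapD[OF assms(3)])
qed

lemma linear_map_minus:
  assumes "module R M" "module R N" "linear_map R M N h"
  shows "h \<zero>\<^bsub>M\<^esub> = \<zero>\<^bsub>N\<^esub>"
    and "x \<in> carrier M \<Longrightarrow> h (\<ominus>\<^bsub>M\<^esub> x) = \<ominus>\<^bsub>N\<^esub> h x"
    and "x \<in> carrier M \<Longrightarrow> y \<in> carrier M \<Longrightarrow> h (x \<ominus>\<^bsub>M\<^esub> y) = h x \<ominus>\<^bsub>N\<^esub> h y"
proof -
  interpret abelian_group_hom M N h by (rule linear_map_group_hom[OF assms])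
  show "h \<zero>\<^bsub>M\<^esub> = \<zero>\<^bsub>N\<^esub>" by simp
  show "x \<in> carrier M \<Longrightarrow> h (\<ominus>\<^bsub>M\<^esub> x) = \<ominus>\<^bsub>N\<^esub> h x" by simp
  show "x \<in> carrier M \<Longrightarrow> y \<in> carrier M \<Longrightarrow> h (x \<ominus>\<^bsub>M\<^esub> y) = h x \<ominus>\<^bsub>N\<^esub> h y"
    by (simp add: a_minus_def)
qed

lemma linear_map_finsum:
  assumes "module R M" "module R N" "linear_map R M N h" "finite A" "f \<in> A \<rightarrow> carrier M"
  shows "h (finsum M f A) = finsum N (\<lambda>i. h (f i)) A"
proof -
  interpret M: module R M by fact
  interpret N: module R N by fact
  show ?thesis
    using assms(4,5)
  proof (induction A)
    case empty
    then show ?case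
      by (simp add: linear_map_minus[OF assms(1-3)])
  next
    case (insert a A)
    then have "h (f i) \<in> carrier N" if "i \<in> insert a A" for i
      using that linear_mapD(1)[OF assms(3)] by (meson PiE)
    then show ?case
      using insert by (simp add: linear_mapD[OF assms(3)] Pi_iff)
  qed
qed

lemma linear_map_kernel:
  assumes "module R M" "module R N" "linear_map R M N h"
  shows "submodule {x \<in> carrier M. h x = \<zero>\<^bsub>N\<^esub>} R M"
proof -
  interpret M: module R M by fact
  interpret N: module R N by fact
  show ?thesis
    by (rule M.submoduleI)
      (auto simp: linear_map_minus[OF assms] linear_mapD[OF assms(3)])
qed

lemma linear_map_vimage:
  assumes "module R M" "module R N" "linear_map R M N h" "submodule L R N"
  shows "submodule {x \<in> carrier M. h x \<in> L} R M"
proof -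
  interpret M: module R M by fact
  interpret N: module R N by fact
  note L = N.submoduleE[OF assms(4)]
  have "\<zero>\<^bsub>N\<^esub> \<in> L"
    using submodule.axioms(1)[OF assms(4)] subgroup.one_closed by fastforce
  then show ?thesis
    by (intro M.submoduleI)
      (auto simp: linear_map_minus[OF assms(1-3)] linear_mapD[OF assms(3)] L)
qed

text \<open>The module record is taken without extension fields, since \<open>mod_span\<close> and
  \<open>mod_quot\<close> are defined only on that type.\<close>

locale plain_module = module R M
  for R :: "('a, 'd) ring_scheme" (structure) and M :: "('a, 'b) module" (structure)

lemma (in module) submodule_zero: "submodule N R M \<Longrightarrow> \<zero>\<^bsub>M\<^esub> \<in> N"
  using submodule.axioms(1) subgroup.one_closed by fastforce

lemma (in module) submodule_minus:
  "submodule N R M \<Longrightarrow> x \<in> N \<Longrightarrow> y \<in> N \<Longrightarrow> x \<ominus>\<^bsub>M\<^esub> y \<in> N"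
  unfolding a_minus_def using submoduleE(3,5) by blast

lemma (in plain_module) mod_span_submodule:
  assumes "S \<subseteq> carrier M"
  shows "submodule (mod_span R M S) R M"
proof (rule submoduleI)
  show "mod_span R M S \<subseteq> carrier M"
    using assms carrier_is_submodule by (auto simp: mod_span_def)
qed (auto simp: mod_span_def submodule_zero submoduleE)

lemma mod_span_superset: "S \<subseteq> mod_span R M S"
  by (auto simp: mod_span_def)

lemma mod_span_least: "submodule N R M \<Longrightarrow> S \<subseteq> N \<Longrightarrow> mod_span R M S \<subseteq> N"
  by (auto simp: mod_span_def)

lemma (in plain_module) mod_span_eqI:
  assumes "S \<subseteq> carrier M" "T \<subseteq> carrier M" "S \<subseteq> mod_span R M T" "T \<subseteq> mod_span R M S"
  shows "mod_span R M S = mod_span R M T"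
  using assms by (intro equalityI mod_span_least mod_span_submodule)

section \<open>Quotient modules as sets of cosets\<close>

lemma mod_quot_simps:
  "ring.zero (mod_quot M N) = N"
  "ring.add (mod_quot M N) = set_add M"
  "carrier (mod_quot M N) = (\<lambda>x. N +>\<^bsub>M\<^esub> x) ` carrier M"
  by (auto simp: mod_quot_def A_RCOSETS_def RCOSETS_def a_r_coset_def)

context plain_module
begin

lemma diff_zero: "x \<in> carrier M \<Longrightarrow> x \<ominus>\<^bsub>M\<^esub> \<zero>\<^bsub>M\<^esub> = x"
  unfolding a_minus_def by (metis M.a_inv_closed M.l_zero M.r_neg M.r_zero M.zero_closed)

lemma diff_add_cancel:
  "x \<in> carrier M \<Longrightarrow> y \<in> carrier M \<Longrightarrow> (x \<ominus>\<^bsub>M\<^esub> y) \<oplus>\<^bsub>M\<^esub> y = x"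
  by (simp add: a_minus_def M.a_assoc M.l_neg)

lemma diff_eq_zero_iff:
  "x \<in> carrier M \<Longrightarrow> y \<in> carrier M \<Longrightarrow> x \<ominus>\<^bsub>M\<^esub> y = \<zero>\<^bsub>M\<^esub> \<longleftrightarrow> x = y"
  by (metis M.l_zero M.r_neg a_minus_def diff_add_cancel)

lemma submodule_subgroup: "submodule N R M \<Longrightarrow> abelian_subgroup N M"
  by (intro abelian_subgroupI3)
    (auto simp: abelian_group_axioms additive_subgroup_def submodule_def)

lemma coset_add:
  assumes "submodule N R M" "x \<in> carrier M" "y \<in> carrier M"
  shows "(N +>\<^bsub>M\<^esub> x) <+>\<^bsub>M\<^esub> (N +>\<^bsub>M\<^esub> y) = N +>\<^bsub>M\<^esub> (x \<oplus>\<^bsub>M\<^esub> y)"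
  using abelian_subgroup.a_rcos_sum[OF submodule_subgroup] assms by blast

lemma coset_eq_iff:
  assumes "submodule N R M" "x \<in> carrier M" "y \<in> carrier M"
  shows "N +>\<^bsub>M\<^esub> x = N +>\<^bsub>M\<^esub> y \<longleftrightarrow> x \<ominus>\<^bsub>M\<^esub> y \<in> N"
proof -
  interpret N: abelian_subgroup N M by (rule submodule_subgroup[OF assms(1)])
  have "x \<in> N +>\<^bsub>M\<^esub> y \<longleftrightarrow> x \<ominus>\<^bsub>M\<^esub> y \<in> N"
    using N.a_rcos_module[OF assms(3,2)] by (simp add: a_minus_def)
  then show ?thesis
    using N.a_repr_independence' N.a_repr_independenceD assms by metis
qed

lemma coset_mem_iff:
  assumes "submodule N R M" "x \<in> carrier M" "y \<in> carrier M"
  shows "x \<in> N +>\<^bsub>M\<^esub> y \<longleftrightarrow> x \<ominus>\<^bsub>M\<^esub> y \<in> N"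
proof -
  interpret N: abelian_subgroup N M by (rule submodule_subgroup[OF assms(1)])
  show ?thesis
    using N.a_rcos_module[OF assms(3,2)] by (simp add: a_minus_def)
qed

lemma coset_self: "submodule N R M \<Longrightarrow> x \<in> carrier M \<Longrightarrow> x \<in> N +>\<^bsub>M\<^esub> x"
  by (simp add: coset_mem_iff submodule_zero a_minus_def M.r_neg)

lemma coset_subset: "submodule N R M \<Longrightarrow> x \<in> carrier M \<Longrightarrow> N +>\<^bsub>M\<^esub> x \<subseteq> carrier M"
  using submoduleE(1) a_r_coset_subset_G by blast

lemma coset_zero_iff:
  assumes "submodule N R M" "x \<in> carrier M"
  shows "N +>\<^bsub>M\<^esub> x = N \<longleftrightarrow> x \<in> N"
proof -
  have "N +>\<^bsub>M\<^esub> \<zero>\<^bsub>M\<^esub> = N"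
    by (simp add: M.a_coset_add_zero assms submoduleE(1))
  then show ?thesis
    using coset_eq_iff[OF assms, of "\<zero>\<^bsub>M\<^esub>"] assms(2) by (simp add: diff_zero)
qed

text \<open>The scalar action of \<open>mod_quot\<close> is a union over all representatives of a
  coset. All cosets in this union coincide, because representatives differ by an element of N and N
  absorbs scalars; the union is over a nonempty set.\<close>

lemma coset_smult:
  assumes N: "submodule N R M" and r: "r \<in> carrier R" and x: "x \<in> carrier M"
  shows "r \<odot>\<^bsub>mod_quot M N\<^esub> (N +>\<^bsub>M\<^esub> x) = N +>\<^bsub>M\<^esub> (r \<odot>\<^bsub>M\<^esub> x)"
proof -
  have "N +>\<^bsub>M\<^esub> (r \<odot>\<^bsub>M\<^esub> y) = N +>\<^bsub>M\<^esub> (r \<odot>\<^bsub>M\<^esub> x)" if "y \<in> N +>\<^bsub>M\<^esub> x" for y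
  proof -
    have y: "y \<in> carrier M" using that coset_subset[OF N x] by blast
    have "y \<ominus>\<^bsub>M\<^esub> x \<in> N" using that coset_mem_iff[OF N y x] by simp
    then have "r \<odot>\<^bsub>M\<^esub> (y \<ominus>\<^bsub>M\<^esub> x) \<in> N" using N r by (simp add: submoduleE(4))
    moreover have "r \<odot>\<^bsub>M\<^esub> (y \<ominus>\<^bsub>M\<^esub> x) = r \<odot>\<^bsub>M\<^esub> y \<ominus>\<^bsub>M\<^esub> r \<odot>\<^bsub>M\<^esub> x"
      using r x y by (simp add: a_minus_def smult_r_distr smult_r_minus)
    ultimately show ?thesis using coset_eq_iff[OF N] r x y by simp
  qed
  then have "(\<Union>y\<in>N +>\<^bsub>M\<^esub> x. N +>\<^bsub>M\<^esub> (r \<odot>\<^bsub>M\<^esub> y)) = (\<Union>y\<in>N +>\<^bsub>M\<^esub> x. N +>\<^bsub>M\<^esub> (r \<odot>\<^bsub>M\<^esub> x))"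
    by (rule SUP_cong[OF refl])
  also have "\<dots> = N +>\<^bsub>M\<^esub> (r \<odot>\<^bsub>M\<^esub> x)"
    using coset_self[OF N x] by (intro cSUP_const) blast
  finally show ?thesis unfolding mod_quot_def by simp
qed

lemma mod_quot_module:
  assumes N: "submodule N R M"
  shows "module R (mod_quot M N)"
proof (rule moduleI)
  show "cring R" by (rule R.is_cring)
  show "abelian_group (mod_quot M N)"
  proof (rule abelian_groupI)
    fix U assume "U \<in> carrier (mod_quot M N)"
    then obtain x where x: "x \<in> carrier M" "U = N +>\<^bsub>M\<^esub> x"
      by (auto simp: mod_quot_simps)
    have "N +>\<^bsub>M\<^esub> (\<ominus>\<^bsub>M\<^esub> x \<oplus>\<^bsub>M\<^esub> x) = N"
      using x N by (simp add: M.l_neg coset_zero_iff submodule_zero)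
    then show "\<exists>Y\<in>carrier (mod_quot M N). Y \<oplus>\<^bsub>mod_quot M N\<^esub> U = \<zero>\<^bsub>mod_quot M N\<^esub>"
      using x N by (auto simp: mod_quot_simps coset_add intro!: bexI[of _ "\<ominus>\<^bsub>M\<^esub> x"])
    have "N = N +>\<^bsub>M\<^esub> \<zero>\<^bsub>M\<^esub>"
      using N coset_zero_iff submodule_zero by auto
    then show "\<zero>\<^bsub>mod_quot M N\<^esub> \<oplus>\<^bsub>mod_quot M N\<^esub> U = U"
      using x N by (metis (full_types) M.l_zero M.zero_closed coset_add mod_quot_simps(1,2))
  next
    have "N = N +>\<^bsub>M\<^esub> \<zero>\<^bsub>M\<^esub>"
      using N coset_zero_iff submodule_zero by auto
    then show "\<zero>\<^bsub>mod_quot M N\<^esub> \<in> carrier (mod_quot M N)"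
      unfolding mod_quot_simps by (rule image_eqI) simp
  qed (use N in \<open>auto simp: mod_quot_simps coset_add M.a_ac\<close>)
qed (use N in \<open>auto simp: mod_quot_simps(2,3) coset_add coset_smult smult_l_distr smult_r_distr smult_assoc1\<close>)

lemma mod_quot_proj:
  assumes N: "submodule N R M"
  shows "linear_map R M (mod_quot M N) (\<lambda>x. N +>\<^bsub>M\<^esub> x)"
  using N by (auto simp: linear_map_def mod_quot_simps(2,3) coset_add coset_smult)

text \<open>The induced map evaluates h at a chosen member of the coset. Any two members differ by
  an element of N, which h kills, so the choice does not matter.\<close>

lemma mod_quot_lift:
  assumes N: "submodule N R M" and L: "module R L" and h: "linear_map R M L h"
    and ker: "\<And>x. x \<in> N \<Longrightarrow> h x = \<zero>\<^bsub>L\<^esub>"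
  shows "\<exists>g. linear_map R (mod_quot M N) L g \<and> (\<forall>x\<in>carrier M. g (N +>\<^bsub>M\<^esub> x) = h x)"
proof -
  interpret L: plain_module R L using L by (simp add: plain_module_def)
  define g where "g U = h (SOME x. x \<in> U)" for U
  have g: "g (N +>\<^bsub>M\<^esub> x) = h x" if x: "x \<in> carrier M" for x
  proof -
    define y where "y = (SOME x'. x' \<in> N +>\<^bsub>M\<^esub> x)"
    have y: "y \<in> N +>\<^bsub>M\<^esub> x" unfolding y_def using coset_self[OF N x] by (rule someI)
    then have yc: "y \<in> carrier M" using coset_subset[OF N x] by blast
    have "h (y \<ominus>\<^bsub>M\<^esub> x) = \<zero>\<^bsub>L\<^esub>" using ker y coset_mem_iff[OF N yc x] by simp
    then have "h y \<ominus>\<^bsub>L\<^esub> h x = \<zero>\<^bsub>L\<^esub>"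
      using linear_map_minus[OF module_axioms L h] x yc by simp
    then show ?thesis
      using x yc linear_mapD(1)[OF h] by (simp add: L.diff_eq_zero_iff g_def y_def[symmetric])
  qed
  have "linear_map R (mod_quot M N) L g"
    unfolding linear_map_def mod_quot_simps
    using g N linear_mapD[OF h] by (auto simp: coset_add coset_smult)
  with g show ?thesis by blast
qed

end

section \<open>The universal property of the Kaehler differentials\<close>

text \<open>Vanishing on C stands in for linearity over the base ring, as in
  \<open>kaehler_rels\<close>: by the Leibniz rule it gives D(c a) = c D(a) for c in C.\<close>

definition derivation ::
  "('a, 'd) ring_scheme \<Rightarrow> 'a set \<Rightarrow> ('a, 'b) module \<Rightarrow> ('a \<Rightarrow> 'b) \<Rightarrow> bool" where
  "derivation R C M D \<longleftrightarrow>
     D \<in> carrier R \<rightarrow> carrier M \<and>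
     (\<forall>a\<in>carrier R. \<forall>b\<in>carrier R. D (a \<oplus>\<^bsub>R\<^esub> b) = D a \<oplus>\<^bsub>M\<^esub> D b) \<and>
     (\<forall>a\<in>carrier R. \<forall>b\<in>carrier R. D (a \<otimes>\<^bsub>R\<^esub> b) = a \<odot>\<^bsub>M\<^esub> D b \<oplus>\<^bsub>M\<^esub> b \<odot>\<^bsub>M\<^esub> D a) \<and>
     (\<forall>c\<in>C. D c = \<zero>\<^bsub>M\<^esub>)"

lemma derivationD:
  assumes "derivation R C M D"
  shows "a \<in> carrier R \<Longrightarrow> D a \<in> carrier M"
    and "a \<in> carrier R \<Longrightarrow> b \<in> carrier R \<Longrightarrow> D (a \<oplus>\<^bsub>R\<^esub> b) = D a \<oplus>\<^bsub>M\<^esub> D b"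
    and "a \<in> carrier R \<Longrightarrow> b \<in> carrier R \<Longrightarrow>
      D (a \<otimes>\<^bsub>R\<^esub> b) = a \<odot>\<^bsub>M\<^esub> D b \<oplus>\<^bsub>M\<^esub> b \<odot>\<^bsub>M\<^esub> D a"
    and "c \<in> C \<Longrightarrow> D c = \<zero>\<^bsub>M\<^esub>"
  using assms by (auto simp: derivation_def)

lemma derivation_linear_map:
  assumes "derivation R C M D" "linear_map R M N h" "module R M" "module R N"
  shows "derivation R C N (\<lambda>a. h (D a))"
proof -
  interpret M: module R M by fact
  show ?thesis
    using assms(1) linear_mapD[OF assms(2)] linear_map_minus(1)[OF assms(3,4,2)]
    by (auto simp: derivation_def Pi_iff)
qed

locale base_algebra = R?: cring R for R :: "'a ring" (structure) +
  fixes C :: "'a set"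
  assumes base_subset: "C \<subseteq> carrier R"
begin

abbreviation "F \<equiv> free_mod R"
abbreviation "\<Omega> \<equiv> kaehler R C"
abbreviation "d \<equiv> kaehler_d R C"
abbreviation "rels \<equiv> kaehler_rels R C"

lemma free_mod_simps:
  "ring.zero F = (\<lambda>x. \<zero>)"
  "f \<oplus>\<^bsub>F\<^esub> g = (\<lambda>x. f x \<oplus> g x)"
  "r \<odot>\<^bsub>F\<^esub> f = (\<lambda>x. r \<otimes> f x)"
  by (simp_all add: free_mod_def)

lemma free_mod_carrier:
  "f \<in> carrier F \<longleftrightarrow> (\<forall>x. f x \<in> carrier R) \<and> (\<forall>x. x \<notin> carrier R \<longrightarrow> f x = \<zero>) \<and>
                    finite {x. f x \<noteq> \<zero>}"
  by (simp add: free_mod_def)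

lemma free_mod_supp_subset:
  assumes "f \<in> carrier F" "\<And>x. g x \<in> carrier R" "\<And>x. f x = \<zero> \<Longrightarrow> g x = \<zero>"
  shows "g \<in> carrier F"
proof -
  have "{x. g x \<noteq> \<zero>} \<subseteq> {x. f x \<noteq> \<zero>}" using assms(3) by blast
  moreover have "finite {x. f x \<noteq> \<zero>}" using assms(1) by (simp add: free_mod_carrier)
  ultimately have "finite {x. g x \<noteq> \<zero>}" by (rule finite_subset)
  then show ?thesis
    using assms by (simp add: free_mod_carrier)
qed

lemma free_mod_add_closed:
  assumes "f \<in> carrier F" "g \<in> carrier F"
  shows "(\<lambda>x. f x \<oplus> g x) \<in> carrier F"
proof -
  have "{x. f x \<oplus> g x \<noteq> \<zero>} \<subseteq> {x. f x \<noteq> \<zero>} \<union> {x. g x \<noteq> \<zero>}"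
    by auto
  moreover have "finite ({x. f x \<noteq> \<zero>} \<union> {x. g x \<noteq> \<zero>})"
    using assms by (simp add: free_mod_carrier)
  ultimately have "finite {x. f x \<oplus> g x \<noteq> \<zero>}" by (rule finite_subset)
  then show ?thesis using assms by (simp add: free_mod_carrier)
qed

lemma free_mod_values: "f \<in> carrier F \<Longrightarrow> f x \<in> carrier R"
  by (simp add: free_mod_carrier)

lemma free_mod_module: "module R F"
proof (rule moduleI)
  show "cring R" by (rule R.is_cring)
  show "abelian_group F"
  proof (rule abelian_groupI)
    fix f assume f: "f \<in> carrier F"
    have "(\<lambda>x. \<ominus> f x) \<in> carrier F"
      by (rule free_mod_supp_subset[OF f]) (simp_all add: free_mod_values[OF f])
    moreover have "(\<lambda>x. \<ominus> f x) \<oplus>\<^bsub>F\<^esub> f = \<zero>\<^bsub>F\<^esub>"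
      by (simp add: free_mod_simps free_mod_values[OF f] R.l_neg)
    ultimately show "\<exists>g\<in>carrier F. g \<oplus>\<^bsub>F\<^esub> f = \<zero>\<^bsub>F\<^esub>" by blast
    show "\<zero>\<^bsub>F\<^esub> \<oplus>\<^bsub>F\<^esub> f = f"
      by (simp add: free_mod_simps free_mod_values[OF f])
  next
    fix f g assume fg: "f \<in> carrier F" "g \<in> carrier F"
    note v = free_mod_values[OF fg(1)] free_mod_values[OF fg(2)]
    show "f \<oplus>\<^bsub>F\<^esub> g \<in> carrier F"
      unfolding free_mod_simps by (rule free_mod_add_closed[OF fg])
    show "f \<oplus>\<^bsub>F\<^esub> g = g \<oplus>\<^bsub>F\<^esub> f"
      unfolding free_mod_simps by (simp add: v R.a_comm)
    fix h assume h: "h \<in> carrier F"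
    show "(f \<oplus>\<^bsub>F\<^esub> g) \<oplus>\<^bsub>F\<^esub> h = f \<oplus>\<^bsub>F\<^esub> (g \<oplus>\<^bsub>F\<^esub> h)"
      unfolding free_mod_simps by (simp add: v free_mod_values[OF h] R.a_assoc)
  next
    show "\<zero>\<^bsub>F\<^esub> \<in> carrier F" by (simp add: free_mod_simps free_mod_carrier)
  qed
next
  fix r s f g assume r: "r \<in> carrier R" and s: "s \<in> carrier R"
    and f: "f \<in> carrier F" and g: "g \<in> carrier F"
  note v = free_mod_values[OF f] free_mod_values[OF g]
  show "(r \<oplus> s) \<odot>\<^bsub>F\<^esub> f = r \<odot>\<^bsub>F\<^esub> f \<oplus>\<^bsub>F\<^esub> s \<odot>\<^bsub>F\<^esub> f"
    by (simp add: free_mod_simps v r s R.l_distr)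
  show "r \<odot>\<^bsub>F\<^esub> (f \<oplus>\<^bsub>F\<^esub> g) = r \<odot>\<^bsub>F\<^esub> f \<oplus>\<^bsub>F\<^esub> r \<odot>\<^bsub>F\<^esub> g"
    by (simp add: free_mod_simps v r R.r_distr)
  show "(r \<otimes> s) \<odot>\<^bsub>F\<^esub> f = r \<odot>\<^bsub>F\<^esub> (s \<odot>\<^bsub>F\<^esub> f)"
    by (simp add: free_mod_simps v r s R.m_assoc)
next
  fix r f assume r: "r \<in> carrier R" and f: "f \<in> carrier F"
  show "r \<odot>\<^bsub>F\<^esub> f \<in> carrier F"
    unfolding free_mod_simps
    by (rule free_mod_supp_subset[OF f]) (simp_all add: free_mod_values[OF f] r)
next
  fix f assume f: "f \<in> carrier F"
  show "\<one> \<odot>\<^bsub>F\<^esub> f = f" by (simp add: free_mod_simps free_mod_values[OF f])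
qed

sublocale F: plain_module R F
  unfolding plain_module_def by (rule free_mod_module)

lemma free_gen_closed: "a \<in> carrier R \<Longrightarrow> free_gen R a \<in> carrier F"
  by (auto simp: free_mod_carrier free_gen_def)

text \<open>Induction on a finite set covering the support: setting one value to zero changes f by a
  multiple of a generator and removes that point from the support.\<close>

lemma free_mod_span:
  assumes N: "submodule N R F" and gen: "\<And>a. a \<in> carrier R \<Longrightarrow> free_gen R a \<in> N"
  shows "N = carrier F"
proof -
  have "f \<in> N" if "finite A" "f \<in> carrier F" "{x. f x \<noteq> \<zero>} \<subseteq> A" for A f
    using that
  proof (induction A arbitrary: f rule: finite_induct)
    case empty
    then have "f = \<zero>\<^bsub>F\<^esub>" by (auto simp: free_mod_simps)
    then show ?case using F.submodule_zero[OF N] by simp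
  next
    case (insert a A)
    show ?case
    proof (cases "a \<in> carrier R")
      case True
      have 1: "f(a := \<zero>) \<in> carrier F"
        by (rule free_mod_supp_subset[OF insert(4)]) (simp_all add: free_mod_values[OF insert(4)])
      have "f(a := \<zero>) \<in> N"
        by (rule insert.IH[OF 1]) (use insert(5) in auto)
      moreover have "f a \<odot>\<^bsub>F\<^esub> free_gen R a \<in> N"
        by (rule F.submoduleE(4)[OF N free_mod_values[OF insert(4)] gen[OF True]])
      moreover have "f = f(a := \<zero>) \<oplus>\<^bsub>F\<^esub> f a \<odot>\<^bsub>F\<^esub> free_gen R a"
        by (auto simp: free_mod_simps free_mod_values[OF insert(4)] free_gen_def fun_eq_iff)
      ultimately show ?thesis using F.submoduleE(5)[OF N] by metis
    next
      case False
      then have "f a = \<zero>" using insert(4) by (simp add: free_mod_carrier)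
      then have "{x. f x \<noteq> \<zero>} \<subseteq> A" using insert(5) by auto
      then show ?thesis using insert by blast
    qed
  qed
  moreover have "finite {x. f x \<noteq> \<zero>}" if "f \<in> carrier F" for f
    using that by (simp add: free_mod_carrier)
  ultimately show ?thesis using F.submoduleE(1)[OF N] by blast
qed

lemma free_mod_lift:
  assumes M: "module R M" and D: "D \<in> carrier R \<rightarrow> carrier M"
  shows "\<exists>g. linear_map R F M g \<and> (\<forall>a\<in>carrier R. g (free_gen R a) = D a)"
proof -
  interpret M: module R M by fact
  define g where "g f = (\<Oplus>\<^bsub>M\<^esub>a\<in>{a. f a \<noteq> \<zero>}. f a \<odot>\<^bsub>M\<^esub> D a)" for f
  \<comment> \<open>The defining sum runs over the support, which changes under addition and
    scaling. Enlarging the index set allows f, h and f + h to be summed over one common set.\<close>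
  have g_eq: "g f = (\<Oplus>\<^bsub>M\<^esub>a\<in>A. f a \<odot>\<^bsub>M\<^esub> D a)"
    if "finite A" "{a. f a \<noteq> \<zero>} \<subseteq> A" "A \<subseteq> carrier R" "f \<in> carrier F" for A f
    unfolding g_def
    by (rule M.add.finprod_mono_neutral_cong_left) (use that D in \<open>auto simp: free_mod_values[OF that(4)] Pi_iff\<close>)
  have supp: "finite {a. f a \<noteq> \<zero>}" "{a. f a \<noteq> \<zero>} \<subseteq> carrier R" if "f \<in> carrier F" for f
    using that by (auto simp: free_mod_carrier)
  have D': "D a \<in> carrier M" if "a \<in> carrier R" for a using D that by auto
  have "linear_map R F M g"
    unfolding linear_map_def
  proof (intro conjI ballI)
    show "g \<in> carrier F \<rightarrow> carrier M"
      unfolding g_def using supp(2) D' free_mod_values by (intro Pi_I M.finsum_closed M.smult_closed) blast+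
  next
    fix f h assume fh: "f \<in> carrier F" "h \<in> carrier F"
    note v = free_mod_values[OF fh(1)] free_mod_values[OF fh(2)]
    let ?A = "{a. f a \<noteq> \<zero>} \<union> {a. h a \<noteq> \<zero>}"
    have A: "finite ?A" "?A \<subseteq> carrier R" using supp fh by blast+
    have S: "{a. (f \<oplus>\<^bsub>F\<^esub> h) a \<noteq> \<zero>} \<subseteq> ?A" using fh by (auto simp: free_mod_simps)
    have "g (f \<oplus>\<^bsub>F\<^esub> h) = (\<Oplus>\<^bsub>M\<^esub>a\<in>?A. (f \<oplus>\<^bsub>F\<^esub> h) a \<odot>\<^bsub>M\<^esub> D a)"
      using fh A S by (intro g_eq) auto
    also have "\<dots> = (\<Oplus>\<^bsub>M\<^esub>a\<in>?A. f a \<odot>\<^bsub>M\<^esub> D a \<oplus>\<^bsub>M\<^esub> h a \<odot>\<^bsub>M\<^esub> D a)"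
      by (rule M.finsum_cong')
        (use A fh D' in \<open>auto simp: free_mod_simps v M.smult_l_distr\<close>)
    also have "\<dots> = (\<Oplus>\<^bsub>M\<^esub>a\<in>?A. f a \<odot>\<^bsub>M\<^esub> D a) \<oplus>\<^bsub>M\<^esub> (\<Oplus>\<^bsub>M\<^esub>a\<in>?A. h a \<odot>\<^bsub>M\<^esub> D a)"
      by (rule M.finsum_addf) (use A fh D' in \<open>auto simp: v\<close>)
    also have "\<dots> = g f \<oplus>\<^bsub>M\<^esub> g h"
      using A fh by (subst (1 2) g_eq[of ?A]) auto
    finally show "g (f \<oplus>\<^bsub>F\<^esub> h) = g f \<oplus>\<^bsub>M\<^esub> g h" .
  next
    fix r f assume rf: "r \<in> carrier R" "f \<in> carrier F"
    note v = free_mod_values[OF rf(2)]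
    let ?A = "{a. f a \<noteq> \<zero>}"
    have A: "finite ?A" "?A \<subseteq> carrier R" using supp rf by blast+
    have S: "{a. (r \<odot>\<^bsub>F\<^esub> f) a \<noteq> \<zero>} \<subseteq> ?A" using rf by (auto simp: free_mod_simps)
    have "g (r \<odot>\<^bsub>F\<^esub> f) = (\<Oplus>\<^bsub>M\<^esub>a\<in>?A. (r \<odot>\<^bsub>F\<^esub> f) a \<odot>\<^bsub>M\<^esub> D a)"
      using rf A S by (intro g_eq) auto
    also have "\<dots> = (\<Oplus>\<^bsub>M\<^esub>a\<in>?A. r \<odot>\<^bsub>M\<^esub> (f a \<odot>\<^bsub>M\<^esub> D a))"
      by (rule M.finsum_cong')
        (use A rf D' in \<open>auto simp: free_mod_simps v M.smult_assoc1\<close>)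
    also have "\<dots> = r \<odot>\<^bsub>M\<^esub> g f"
      unfolding g_def
      by (rule M.finsum_smult_ldistr[symmetric]) (use A rf D' in \<open>auto simp: v\<close>)
    finally show "g (r \<odot>\<^bsub>F\<^esub> f) = r \<odot>\<^bsub>M\<^esub> g f" .
  qed
  moreover have "g (free_gen R a) = D a" if a: "a \<in> carrier R" for a
    by (subst g_eq[of "{a}"])
      (use a D' in \<open>auto simp: free_gen_closed\<close>, auto simp: free_gen_def split: if_splits)
  ultimately show ?thesis by blast
qed

lemma kaehler_relsI:
  "a \<in> carrier R \<Longrightarrow> b \<in> carrier R \<Longrightarrow>
    free_gen R (a \<oplus> b) \<ominus>\<^bsub>F\<^esub> (free_gen R a \<oplus>\<^bsub>F\<^esub> free_gen R b) \<in> rels"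
  "a \<in> carrier R \<Longrightarrow> b \<in> carrier R \<Longrightarrow>
    free_gen R (a \<otimes> b) \<ominus>\<^bsub>F\<^esub> (a \<odot>\<^bsub>F\<^esub> free_gen R b \<oplus>\<^bsub>F\<^esub> b \<odot>\<^bsub>F\<^esub> free_gen R a) \<in> rels"
  "c \<in> C \<Longrightarrow> free_gen R c \<in> rels"
  unfolding kaehler_rels_def Let_def by blast+

lemma kaehler_rels_subsetI:
  assumes "\<And>a b. a \<in> carrier R \<Longrightarrow> b \<in> carrier R \<Longrightarrow>
      free_gen R (a \<oplus> b) \<ominus>\<^bsub>F\<^esub> (free_gen R a \<oplus>\<^bsub>F\<^esub> free_gen R b) \<in> S"
    and "\<And>a b. a \<in> carrier R \<Longrightarrow> b \<in> carrier R \<Longrightarrow>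
      free_gen R (a \<otimes> b) \<ominus>\<^bsub>F\<^esub> (a \<odot>\<^bsub>F\<^esub> free_gen R b \<oplus>\<^bsub>F\<^esub> b \<odot>\<^bsub>F\<^esub> free_gen R a) \<in> S"
    and "\<And>c. c \<in> C \<Longrightarrow> free_gen R c \<in> S"
  shows "rels \<subseteq> S"
  unfolding kaehler_rels_def Let_def using assms by blast

lemma kaehler_rels_closed: "rels \<subseteq> carrier F"
  by (rule kaehler_rels_subsetI)
    (simp_all add: free_gen_closed subsetD[OF base_subset])

lemma rels_submodule: "submodule (mod_span R F rels) R F"
  by (rule F.mod_span_submodule[OF kaehler_rels_closed])

lemma kaehler_module: "module R \<Omega>"
  unfolding kaehler_def by (rule F.mod_quot_module[OF rels_submodule])

sublocale \<Omega>: plain_module R \<Omega>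
  unfolding plain_module_def by (rule kaehler_module)

lemma kaehler_proj: "linear_map R F \<Omega> (\<lambda>f. mod_span R F rels +>\<^bsub>F\<^esub> f)"
  unfolding kaehler_def by (rule F.mod_quot_proj[OF rels_submodule])

lemma kaehler_d_derivation: "derivation R C \<Omega> d"
proof -
  let ?p = "\<lambda>f. mod_span R F rels +>\<^bsub>F\<^esub> f"
  note p = linear_mapD[OF kaehler_proj]
  have eq: "?p f = ?p g" if "f \<ominus>\<^bsub>F\<^esub> g \<in> rels" "f \<in> carrier F" "g \<in> carrier F" for f g
    using subsetD[OF mod_span_superset that(1)] F.coset_eq_iff[OF rels_submodule that(2,3)]
    by simp
  show ?thesis
    unfolding derivation_def kaehler_d_def
  proof (intro conjI ballI)
    show "(\<lambda>a. ?p (free_gen R a)) \<in> carrier R \<rightarrow> carrier \<Omega>"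
      by (intro Pi_I p(1) free_gen_closed)
  next
    fix a b assume ab: "a \<in> carrier R" "b \<in> carrier R"
    have "?p (free_gen R (a \<oplus> b)) = ?p (free_gen R a \<oplus>\<^bsub>F\<^esub> free_gen R b)"
      by (rule eq) (simp_all add: ab kaehler_relsI free_gen_closed)
    then show "?p (free_gen R (a \<oplus> b)) = ?p (free_gen R a) \<oplus>\<^bsub>\<Omega>\<^esub> ?p (free_gen R b)"
      by (simp only: p(2)[OF free_gen_closed free_gen_closed, OF ab])
    have "?p (free_gen R (a \<otimes> b)) = ?p (a \<odot>\<^bsub>F\<^esub> free_gen R b \<oplus>\<^bsub>F\<^esub> b \<odot>\<^bsub>F\<^esub> free_gen R a)"
      by (rule eq) (simp_all add: ab kaehler_relsI free_gen_closed)
    then show "?p (free_gen R (a \<otimes> b)) =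
        a \<odot>\<^bsub>\<Omega>\<^esub> ?p (free_gen R b) \<oplus>\<^bsub>\<Omega>\<^esub> b \<odot>\<^bsub>\<Omega>\<^esub> ?p (free_gen R a)"
      by (simp add: ab free_gen_closed p(2)[of "a \<odot>\<^bsub>F\<^esub> free_gen R b"] p(3))
  next
    fix c assume c: "c \<in> C"
    have "free_gen R c \<in> mod_span R F rels"
      by (rule subsetD[OF mod_span_superset kaehler_relsI(3)[OF c]])
    then show "?p (free_gen R c) = \<zero>\<^bsub>\<Omega>\<^esub>"
      using F.coset_zero_iff[OF rels_submodule free_gen_closed] subsetD[OF base_subset c]
      by (simp add: kaehler_def mod_quot_simps)
  qed
qed

lemmas d_closed [simp] = derivationD(1)[OF kaehler_d_derivation]
lemmas d_add = derivationD(2)[OF kaehler_d_derivation]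
lemmas d_mult = derivationD(3)[OF kaehler_d_derivation]
lemmas d_base = derivationD(4)[OF kaehler_d_derivation]

text \<open>The preimage of N in the free module contains all free generators. This serves as the
  induction principle for Omega: a property defining a submodule need only be checked on the
  elements da.\<close>

lemma kaehler_span:
  assumes N: "submodule N R \<Omega>" and gen: "\<And>a. a \<in> carrier R \<Longrightarrow> d a \<in> N"
  shows "N = carrier \<Omega>"
proof -
  let ?p = "\<lambda>f. mod_span R F rels +>\<^bsub>F\<^esub> f"
  have "free_gen R a \<in> {f \<in> carrier F. ?p f \<in> N}" if "a \<in> carrier R" for a
    using gen[OF that] free_gen_closed[OF that] by (simp add: kaehler_d_def)
  then have eq: "{f \<in> carrier F. ?p f \<in> N} = carrier F"
    by (rule free_mod_span[OF linear_map_vimage[OF free_mod_module kaehler_module kaehler_proj N]])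
  have "carrier \<Omega> \<subseteq> N"
  proof
    fix w assume "w \<in> carrier \<Omega>"
    then obtain f where "f \<in> carrier F" "w = ?p f"
      unfolding kaehler_def mod_quot_simps by (rule imageE)
    then show "w \<in> N" using eq by blast
  qed
  then show ?thesis using \<Omega>.submoduleE(1)[OF N] by (rule equalityI[rotated])
qed

text \<open>Existence half of the universal property: the linear extension of D to the free module
  kills the three families of relations precisely because D is a derivation. Uniqueness is
  \<open>kaehler_linear_map_eqI\<close>.\<close>

lemma kaehler_lift:
  assumes M: "module R M" and D: "derivation R C M D"
  shows "\<exists>g. linear_map R \<Omega> M g \<and> (\<forall>a\<in>carrier R. g (d a) = D a)"
proof -
  interpret M: plain_module R M using M by (simp add: plain_module_def)
  note D' = derivationD[OF D]
  obtain g where g: "linear_map R F M g" "\<And>a. a \<in> carrier R \<Longrightarrow> g (free_gen R a) = D a"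
    using free_mod_lift[OF M, of D] D'(1) by blast
  note g' = linear_mapD[OF g(1)] linear_map_minus[OF free_mod_module M g(1)]
  have "rels \<subseteq> {f \<in> carrier F. g f = \<zero>\<^bsub>M\<^esub>}"
    by (rule kaehler_rels_subsetI)
      (simp_all add: subsetD[OF base_subset] free_gen_closed g' g(2) D' M.diff_eq_zero_iff)
  then have "mod_span R F rels \<subseteq> {f \<in> carrier F. g f = \<zero>\<^bsub>M\<^esub>}"
    by (rule mod_span_least[OF linear_map_kernel[OF free_mod_module M g(1)]])
  then obtain h where "linear_map R \<Omega> M h"
    "\<And>f. f \<in> carrier F \<Longrightarrow> h (mod_span R F rels +>\<^bsub>F\<^esub> f) = g f"
    using F.mod_quot_lift[OF rels_submodule M g(1)] unfolding kaehler_def by blast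
  then show ?thesis
    using g(2) by (auto simp: kaehler_d_def free_gen_closed intro!: exI[of _ h])
qed

end

section \<open>Kaehler differentials of a quotient algebra\<close>

lemma linear_map_equalizer:
  assumes "module R M" "module R N" "linear_map R M N f" "linear_map R M N g"
  shows "submodule {x \<in> carrier M. f x = g x} R M"
proof -
  interpret M: module R M by fact
  interpret N: module R N by fact
  show ?thesis
    by (rule M.submoduleI)
      (auto simp: linear_map_minus[OF assms(1-3)] linear_mapD[OF assms(3)]
        linear_map_minus[OF assms(1,2,4)] linear_mapD[OF assms(4)])
qed

text \<open>The equalizer of f and g is a submodule containing every da, hence all of Omega.\<close>

lemma (in base_algebra) kaehler_linear_map_eqI:
  assumes "module R M" "linear_map R \<Omega> M f" "linear_map R \<Omega> M g"
    and "\<And>a. a \<in> carrier R \<Longrightarrow> f (d a) = g (d a)" and "w \<in> carrier \<Omega>"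
  shows "f w = g w"
proof -
  have "{x \<in> carrier \<Omega>. f x = g x} = carrier \<Omega>"
    by (rule kaehler_span[OF linear_map_equalizer[OF kaehler_module assms(1-3)]])
      (simp add: assms(4))
  then show ?thesis using assms(5) by blast
qed

lemma restrict_scalars_simps [simp]:
  "carrier (restrict_scalars h M) = carrier M"
  "ring.add (restrict_scalars h M) = ring.add M"
  "ring.zero (restrict_scalars h M) = ring.zero M"
  "smult (restrict_scalars h M) = (\<lambda>r x. h r \<odot>\<^bsub>M\<^esub> x)"
  by (simp_all add: restrict_scalars_def)

lemma a_inv_cong:
  "carrier M = carrier N \<Longrightarrow> ring.add M = ring.add N \<Longrightarrow> ring.zero M = ring.zero N \<Longrightarrow> a_inv M = a_inv N"
  by (simp add: a_inv_def m_inv_def fun_eq_iff)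

lemma abelian_group_cong:
  assumes "abelian_group M" "carrier M = carrier N" "ring.add M = ring.add N"
    "ring.zero M = ring.zero N"
  shows "abelian_group N"
proof -
  interpret M: abelian_group M by fact
  show ?thesis
    by (rule abelian_groupI)
      (use M.add.l_inv_ex in \<open>auto simp: assms(2-4)[symmetric] M.a_ac\<close>)
qed

lemma restrict_scalars_module:
  assumes "cring R" "h \<in> ring_hom R S" "module S M"
  shows "module R (restrict_scalars h M)"
proof -
  interpret M: module S M by fact
  note h = ring_hom_closed[OF assms(2)] ring_hom_add[OF assms(2)] ring_hom_mult[OF assms(2)]
    ring_hom_one[OF assms(2)]
  show ?thesis
    by (rule moduleI)
      (simp_all add: assms(1) abelian_group_cong[OF M.abelian_group_axioms] h
        M.smult_l_distr M.smult_r_distr M.smult_assoc1)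
qed

text \<open>When h is surjective, every scalar of S is the image of one of R. This lets
  \<open>kaehler_span\<close> over the quotient ring be applied to a set known only to be closed
  under scalars of R.\<close>

lemma submodule_restrict_scalars:
  assumes "module S M" "submodule N R (restrict_scalars h M)" "carrier S \<subseteq> h ` carrier R"
    "cring R" "h \<in> ring_hom R S"
  shows "submodule N S M"
proof -
  interpret M: module S M by fact
  interpret R: module R "restrict_scalars h M"
    by (rule restrict_scalars_module[OF assms(4,5,1)])
  note N = R.submoduleE[OF assms(2)] R.submodule_zero[OF assms(2)]
  have inv: "a_inv (restrict_scalars h M) = a_inv M"
    by (rule a_inv_cong) simp_all
  show ?thesis
  proof (rule M.submoduleI)
    show "\<ominus>\<^bsub>M\<^esub> a \<in> N" if "a \<in> N" for a using N(3)[OF that] by (simp add: inv)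
    show "s \<odot>\<^bsub>M\<^esub> x \<in> N" if "s \<in> carrier S" "x \<in> N" for s x
      using N(4)[OF _ that(2)] that(1) assms(3) by auto
  qed (use N in simp_all)
qed

section \<open>Comparison of Omega / dI with the differentials of R / I\<close>

locale quotient_algebra = base_algebra R C + I: ideal I R
  for R :: "'a ring" (structure) and C and I :: "'a set"
begin

definition "S = R Quot I"
definition "\<pi> a = I +> a"
definition "dI = mod_span R \<Omega> (d ` I)"
definition "\<Omega>S = kaehler S (\<pi> ` C)"
definition "dS = kaehler_d S (\<pi> ` C)"
definition "\<Omega>SR = restrict_scalars \<pi> \<Omega>S"

lemma proj_hom: "\<pi> \<in> ring_hom R S"
  using I.rcos_ring_hom unfolding S_def \<pi>_def by simp

lemma carrier_S: "carrier S = \<pi> ` carrier R"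
  by (auto simp: S_def \<pi>_def FactRing_def A_RCOSETS_def RCOSETS_def a_r_coset_def)

lemma proj_eq_iff: "a \<in> carrier R \<Longrightarrow> b \<in> carrier R \<Longrightarrow> \<pi> a = \<pi> b \<longleftrightarrow> a \<ominus> b \<in> I"
  unfolding \<pi>_def using R.quotient_eq_iff_same_a_r_cos[OF I.ideal_axioms] by simp

lemma cring_S: "cring S"
  unfolding S_def by (rule I.quotient_is_cring[OF R.is_cring])

sublocale S: base_algebra S "\<pi> ` C"
  using base_subset by (auto simp: base_algebra_def base_algebra_axioms_def cring_S carrier_S)

lemma dI_submodule: "submodule dI R \<Omega>"
  unfolding dI_def by (rule \<Omega>.mod_span_submodule) (auto dest: I.a_Hcarr)

lemma d_mem_dI: "a \<in> I \<Longrightarrow> d a \<in> dI"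
  unfolding dI_def by (rule subsetD[OF mod_span_superset imageI])

text \<open>For w = da this is the Leibniz rule in the form r da = d(r a) - a dr, where both r a and
  r lie in I. The general case follows because the da generate Omega.\<close>

lemma ideal_smult_mem_dI:
  assumes r: "r \<in> I" and w: "w \<in> carrier \<Omega>"
  shows "r \<odot>\<^bsub>\<Omega>\<^esub> w \<in> dI"
proof -
  have rR: "r \<in> carrier R" using r by (rule I.a_Hcarr)
  have lin: "linear_map R \<Omega> \<Omega> (\<lambda>w. r \<odot>\<^bsub>\<Omega>\<^esub> w)"
    by (auto simp: linear_map_def rR \<Omega>.smult_r_distr \<Omega>.smult_assoc1[symmetric] R.m_comm)
  have "d a \<in> {w \<in> carrier \<Omega>. r \<odot>\<^bsub>\<Omega>\<^esub> w \<in> dI}" if a: "a \<in> carrier R" for a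
  proof -
    have "d (r \<otimes> a) \<in> dI" using r a by (intro d_mem_dI I.I_r_closed)
    moreover have "a \<odot>\<^bsub>\<Omega>\<^esub> d r \<in> dI"
      by (rule \<Omega>.submoduleE(4)[OF dI_submodule a d_mem_dI[OF r]])
    moreover have "r \<odot>\<^bsub>\<Omega>\<^esub> d a = d (r \<otimes> a) \<ominus>\<^bsub>\<Omega>\<^esub> a \<odot>\<^bsub>\<Omega>\<^esub> d r"
      using a rR by (simp add: d_mult a_minus_def \<Omega>.M.a_assoc \<Omega>.M.r_neg)
    ultimately show ?thesis using a \<Omega>.submodule_minus[OF dI_submodule] by simp
  qed
  then have "{w \<in> carrier \<Omega>. r \<odot>\<^bsub>\<Omega>\<^esub> w \<in> dI} = carrier \<Omega>"
    by (rule kaehler_span[OF linear_map_vimage[OF kaehler_module kaehler_module lin dI_submodule]])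
  then show ?thesis using w by blast
qed

abbreviation "Q \<equiv> mod_quot \<Omega> dI"

lemma Q_module: "module R Q"
  by (rule \<Omega>.mod_quot_module[OF dI_submodule])

sublocale Q: plain_module R Q
  unfolding plain_module_def by (rule Q_module)

lemma Q_proj: "linear_map R \<Omega> Q (\<lambda>w. dI +>\<^bsub>\<Omega>\<^esub> w)"
  by (rule \<Omega>.mod_quot_proj[OF dI_submodule])

lemma Q_elem: assumes "u \<in> carrier Q" obtains w where "w \<in> carrier \<Omega>" "u = dI +>\<^bsub>\<Omega>\<^esub> w"
  using assms unfolding mod_quot_simps by blast

lemma ideal_smult_Q: "r \<in> I \<Longrightarrow> u \<in> carrier Q \<Longrightarrow> r \<odot>\<^bsub>Q\<^esub> u = \<zero>\<^bsub>Q\<^esub>"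
  by (erule Q_elem)
    (simp add: \<Omega>.coset_smult[OF dI_submodule] I.a_Hcarr mod_quot_simps(1)
      \<Omega>.coset_zero_iff[OF dI_submodule] ideal_smult_mem_dI)

definition "rep s = (SOME a. a \<in> carrier R \<and> \<pi> a = s)"

lemma rep: "s \<in> carrier S \<Longrightarrow> rep s \<in> carrier R \<and> \<pi> (rep s) = s"
  unfolding rep_def by (rule someI_ex) (auto simp: carrier_S)

lemma rep_diff: "a \<in> carrier R \<Longrightarrow> rep (\<pi> a) \<ominus> a \<in> I"
  using proj_eq_iff[of "rep (\<pi> a)" a] rep[of "\<pi> a"] by (auto simp: carrier_S)

text \<open>The quotient \<open>\<Omega> / dI\<close> is annihilated by \<open>I\<close>, hence is a module over \<open>R / I\<close>.\<close>

definition "QS = \<lparr>carrier = carrier Q, monoid.mult = undefined, monoid.one = undefined,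
      ring.zero = \<zero>\<^bsub>Q\<^esub>, ring.add = ring.add Q, smult = (\<lambda>s u. rep s \<odot>\<^bsub>Q\<^esub> u)\<rparr>"

lemma QS_simps [simp]:
  "carrier QS = carrier Q" "ring.zero QS = \<zero>\<^bsub>Q\<^esub>" "ring.add QS = ring.add Q"
  by (simp_all add: QS_def)

text \<open>The action uses a chosen preimage of the scalar; another preimage differs by an element
  of I, which annihilates Omega / dI.\<close>

lemma QS_smult:
  assumes a: "a \<in> carrier R" and u: "u \<in> carrier Q"
  shows "\<pi> a \<odot>\<^bsub>QS\<^esub> u = a \<odot>\<^bsub>Q\<^esub> u"
proof -
  have r: "rep (\<pi> a) \<in> carrier R" using rep a by (auto simp: carrier_S)
  have "rep (\<pi> a) = (rep (\<pi> a) \<ominus> a) \<oplus> a"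
    using r a by (simp add: a_minus_def R.a_assoc R.l_neg)
  then have "rep (\<pi> a) \<odot>\<^bsub>Q\<^esub> u = (rep (\<pi> a) \<ominus> a) \<odot>\<^bsub>Q\<^esub> u \<oplus>\<^bsub>Q\<^esub> a \<odot>\<^bsub>Q\<^esub> u"
    using r a u by (metis Q.smult_l_distr R.minus_closed)
  then show ?thesis
    using ideal_smult_Q[OF rep_diff[OF a] u] a u by (simp add: QS_def)
qed

lemma QS_module: "module S QS"
proof (rule moduleI)
  show "cring S" by (rule cring_S)
  show "abelian_group QS"
    by (rule abelian_group_cong[OF Q.abelian_group_axioms]) simp_all
  note hom = ring_hom_add[OF proj_hom, symmetric] ring_hom_mult[OF proj_hom, symmetric]
    ring_hom_one[OF proj_hom, symmetric]
  fix s t u v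
  assume "u \<in> carrier QS" then have u: "u \<in> carrier Q" by simp
  show "\<one>\<^bsub>S\<^esub> \<odot>\<^bsub>QS\<^esub> u = u" using u by (simp add: hom QS_smult)
  assume "s \<in> carrier S" then obtain a where a: "a \<in> carrier R" "s = \<pi> a" by (auto simp: carrier_S)
  show "s \<odot>\<^bsub>QS\<^esub> u \<in> carrier QS" using a u by (simp add: QS_smult)
  {
    assume "v \<in> carrier QS" then have v: "v \<in> carrier Q" by simp
    show "s \<odot>\<^bsub>QS\<^esub> (u \<oplus>\<^bsub>QS\<^esub> v) = s \<odot>\<^bsub>QS\<^esub> u \<oplus>\<^bsub>QS\<^esub> s \<odot>\<^bsub>QS\<^esub> v"
      using a u v by (simp add: QS_smult Q.smult_r_distr)
  }
  assume "t \<in> carrier S" then obtain b where b: "b \<in> carrier R" "t = \<pi> b" by (auto simp: carrier_S)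
  show "(s \<oplus>\<^bsub>S\<^esub> t) \<odot>\<^bsub>QS\<^esub> u = s \<odot>\<^bsub>QS\<^esub> u \<oplus>\<^bsub>QS\<^esub> t \<odot>\<^bsub>QS\<^esub> u"
    using a b u by (simp add: hom QS_smult Q.smult_l_distr)
  show "(s \<otimes>\<^bsub>S\<^esub> t) \<odot>\<^bsub>QS\<^esub> u = s \<odot>\<^bsub>QS\<^esub> (t \<odot>\<^bsub>QS\<^esub> u)"
    using a b u by (simp add: hom QS_smult Q.smult_assoc1)
qed

definition "DS s = dI +>\<^bsub>\<Omega>\<^esub> d (rep s)"

text \<open>Two preimages of one element differ by some element of I, whose differential lies in dI.
  So the derivation induced on R / I can be computed with any preimage.\<close>

lemma DS_proj: "a \<in> carrier R \<Longrightarrow> DS (\<pi> a) = dI +>\<^bsub>\<Omega>\<^esub> d a"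
proof -
  assume a: "a \<in> carrier R"
  have r: "rep (\<pi> a) \<in> carrier R" using rep a by (auto simp: carrier_S)
  have "rep (\<pi> a) = (rep (\<pi> a) \<ominus> a) \<oplus> a"
    using r a by (simp add: a_minus_def R.a_assoc R.l_neg)
  then have "d (rep (\<pi> a)) = d (rep (\<pi> a) \<ominus> a) \<oplus>\<^bsub>\<Omega>\<^esub> d a"
    using r a by (metis d_add R.minus_closed)
  then have "d (rep (\<pi> a)) \<ominus>\<^bsub>\<Omega>\<^esub> d a = d (rep (\<pi> a) \<ominus> a)"
    using r a by (simp add: a_minus_def \<Omega>.M.a_assoc \<Omega>.M.r_neg)
  then have "d (rep (\<pi> a)) \<ominus>\<^bsub>\<Omega>\<^esub> d a \<in> dI"
    using d_mem_dI[OF rep_diff[OF a]] by simp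
  then show ?thesis
    unfolding DS_def using \<Omega>.coset_eq_iff[OF dI_submodule] r a by simp
qed

lemma DS_derivation: "derivation S (\<pi> ` C) QS DS"
proof -
  note hom = ring_hom_add[OF proj_hom, symmetric] ring_hom_mult[OF proj_hom, symmetric]
  note D = derivationD[OF derivation_linear_map[OF kaehler_d_derivation Q_proj kaehler_module Q_module]]
  show ?thesis
    unfolding derivation_def carrier_S
    using D base_subset by (auto simp: DS_proj hom QS_smult)
qed

lemma \<Omega>SR_module: "module R \<Omega>SR"
  unfolding \<Omega>SR_def
  by (rule restrict_scalars_module[OF R.is_cring proj_hom])
    (simp add: \<Omega>S_def S.kaehler_module)

lemma dS_proj_derivation: "derivation R C \<Omega>SR (\<lambda>a. dS (\<pi> a))"
  using ring_hom_closed[OF proj_hom] S.kaehler_d_derivation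
  unfolding derivation_def
  by (auto simp: \<Omega>SR_def dS_def \<Omega>S_def ring_hom_add[OF proj_hom] ring_hom_mult[OF proj_hom])

text \<open>The map g comes from the universal property over R / I, its inverse f' from the one over
  R: the map da to d(pi a) kills da for a in I because then pi a = pi 0, so it factors through dI.
  That g after f' is the identity follows from uniqueness over R; the other composite has to be
  checked over R / I.\<close>

lemma kaehler_quotient_iso:
  "\<exists>h. h \<in> iso (add_monoid \<Omega>SR) (add_monoid Q) \<and> linear_map R \<Omega>SR Q h \<and>
     (\<forall>a\<in>carrier R. h (dS (\<pi> a)) = dI +>\<^bsub>\<Omega>\<^esub> d a)"
proof -
  obtain g where g: "linear_map S \<Omega>S QS g" and gd: "\<And>s. s \<in> carrier S \<Longrightarrow> g (dS s) = DS s"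
    using S.kaehler_lift[OF QS_module DS_derivation] unfolding \<Omega>S_def dS_def by blast
  have pc: "\<pi> a \<in> carrier S" if "a \<in> carrier R" for a using ring_hom_closed[OF proj_hom that] .
  have gR: "linear_map R \<Omega>SR Q g"
    unfolding linear_map_def
    using linear_mapD[OF g] pc by (auto simp: \<Omega>SR_def QS_smult)
  have gd': "g (dS (\<pi> a)) = dI +>\<^bsub>\<Omega>\<^esub> d a" if "a \<in> carrier R" for a
    using gd[OF pc[OF that]] DS_proj[OF that] by simp
  obtain f where f: "linear_map R \<Omega> \<Omega>SR f" and fd: "\<And>a. a \<in> carrier R \<Longrightarrow> f (d a) = dS (\<pi> a)"
    using kaehler_lift[OF \<Omega>SR_module dS_proj_derivation] by blast
  interpret P: plain_module R \<Omega>SR unfolding plain_module_def by (rule \<Omega>SR_module)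
  have "d ` I \<subseteq> {w \<in> carrier \<Omega>. f w = \<zero>\<^bsub>\<Omega>SR\<^esub>}"
  proof
    fix w assume "w \<in> d ` I"
    then obtain a where a: "a \<in> I" "w = d a" by blast
    have aR: "a \<in> carrier R" using a(1) by (rule I.a_Hcarr)
    have "\<pi> a = \<pi> \<zero>" using proj_eq_iff[OF aR R.zero_closed] a aR by (simp add: a_minus_def)
    then have "f (d a) = f (d \<zero>)" using fd aR by simp
    also have "d \<zero> = \<zero>\<^bsub>\<Omega>\<^esub>"
      using d_add[of \<zero> \<zero>] d_closed[OF R.zero_closed] by (simp add: \<Omega>.M.add.r_cancel_one')
    finally show "w \<in> {w \<in> carrier \<Omega>. f w = \<zero>\<^bsub>\<Omega>SR\<^esub>}"
      using a aR linear_map_minus(1)[OF kaehler_module \<Omega>SR_module f] by simp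
  qed
  then have ker: "dI \<subseteq> {w \<in> carrier \<Omega>. f w = \<zero>\<^bsub>\<Omega>SR\<^esub>}"
    unfolding dI_def by (rule mod_span_least[OF linear_map_kernel[OF kaehler_module \<Omega>SR_module f]])
  have ker': "f w = \<zero>\<^bsub>\<Omega>SR\<^esub>" if "w \<in> dI" for w
    using subsetD[OF ker that] by simp
  obtain f' where f': "linear_map R Q \<Omega>SR f'" "\<And>w. w \<in> carrier \<Omega> \<Longrightarrow> f' (dI +>\<^bsub>\<Omega>\<^esub> w) = f w"
    using \<Omega>.mod_quot_lift[OF dI_submodule \<Omega>SR_module f] ker' by metis
  have gf: "g (f' u) = u" if u: "u \<in> carrier Q" for u
  proof -
    obtain w where w: "w \<in> carrier \<Omega>" "u = dI +>\<^bsub>\<Omega>\<^esub> w" using u by (rule Q_elem)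
    have "g (f w) = dI +>\<^bsub>\<Omega>\<^esub> w"
      by (rule kaehler_linear_map_eqI[OF Q_module linear_map_comp[OF f gR] Q_proj _ w(1)])
        (simp add: fd gd')
    then show ?thesis using w f'(2) by simp
  qed
  \<comment> \<open>The composite of g and f' is known to be linear over R only, while the
    generation statement for the differentials of R / I is about submodules over R / I. Surjectivity
    of the projection bridges the two.\<close>
  have "linear_map R \<Omega>SR \<Omega>SR (\<lambda>y. y)" by (auto simp: linear_map_def)
  then have "submodule {y \<in> carrier \<Omega>SR. f' (g y) = y} R \<Omega>SR"
    by (rule linear_map_equalizer[OF \<Omega>SR_module \<Omega>SR_module linear_map_comp[OF gR f'(1)]])
  then have "submodule {y \<in> carrier \<Omega>SR. f' (g y) = y} S \<Omega>S"
    unfolding \<Omega>SR_def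
    by (rule submodule_restrict_scalars[rotated])
      (simp_all add: carrier_S R.is_cring proj_hom, simp add: \<Omega>S_def S.kaehler_module)
  then have "{y \<in> carrier \<Omega>SR. f' (g y) = y} = carrier \<Omega>S"
    unfolding \<Omega>S_def
  proof (rule S.kaehler_span)
    fix s assume "s \<in> carrier S"
    then obtain a where a: "a \<in> carrier R" "s = \<pi> a" by (auto simp: carrier_S)
    have "f' (g (dS (\<pi> a))) = dS (\<pi> a)" using a by (simp add: gd' f'(2) fd)
    moreover have "dS s \<in> carrier \<Omega>SR"
      using derivationD(1)[OF dS_proj_derivation a(1)] a(2) by simp
    ultimately show "kaehler_d S (\<pi> ` C) s \<in> {y \<in> carrier \<Omega>SR. f' (g y) = y}"
      using a by (simp add: dS_def)
  qed
  then have fg: "f' (g y) = y" if "y \<in> carrier \<Omega>SR" for y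
    using that by (auto simp: \<Omega>SR_def)
  have "bij_betw g (carrier \<Omega>SR) (carrier Q)"
    by (rule bij_betw_byWitness[where f' = f'])
      (use fg gf linear_mapD(1)[OF gR] linear_mapD(1)[OF f'(1)] in auto)
  then have "g \<in> iso (add_monoid \<Omega>SR) (add_monoid Q)"
    using linear_mapD[OF gR] by (auto simp: iso_def hom_def)
  then show ?thesis using gR gd' by blast
qed

end

section \<open>Homogeneous components and graded ideals\<close>

lemma poly_ring_simps [simp]:
  "monoid.mult (poly_ring n) = (*)" "monoid.one (poly_ring n) = 1"
  "ring.zero (poly_ring n) = 0" "ring.add (poly_ring n) = (+)"
  by (simp_all add: poly_ring_def)

lemma poly_ring_carrier:
  "p \<in> carrier (poly_ring n) \<longleftrightarrow> (\<forall>m\<in>Poly_Mapping.keys p. Poly_Mapping.keys m \<subseteq> {..n})"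
  by (simp add: poly_ring_def)

lemma keys_add_nat:
  fixes m m' :: "nat \<Rightarrow>\<^sub>0 nat"
  shows "Poly_Mapping.keys (m + m') = Poly_Mapping.keys m \<union> Poly_Mapping.keys m'"
  by (auto simp: in_keys_iff lookup_add)

lemma mon_deg_superset:
  "finite A \<Longrightarrow> Poly_Mapping.keys m \<subseteq> A \<Longrightarrow> mon_deg m = (\<Sum>i\<in>A. Poly_Mapping.lookup m i)"
  unfolding mon_deg_def by (rule sum.mono_neutral_left) (auto simp: in_keys_iff)

lemma mon_deg_add: "mon_deg (m + m') = mon_deg m + mon_deg m'"
proof -
  let ?A = "Poly_Mapping.keys m \<union> Poly_Mapping.keys m'"
  have "mon_deg (m + m') = (\<Sum>i\<in>?A. Poly_Mapping.lookup (m + m') i)"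
    by (rule mon_deg_superset) (auto simp: keys_add_nat)
  then show ?thesis
    by (simp add: lookup_add sum.distrib mon_deg_superset[of ?A m] mon_deg_superset[of ?A m'])
qed

lemma mon_deg_zero [simp]: "mon_deg 0 = 0"
  by (simp add: mon_deg_def)

lemma mon_deg_single [simp]: "mon_deg (Poly_Mapping.single j e) = e"
  by (simp add: mon_deg_def)

lemma poly_ring_closed [intro]:
  fixes p q :: "'k::field mpoly"
  shows "0 \<in> carrier (poly_ring n)" "1 \<in> carrier (poly_ring n)"
    and "p \<in> carrier (poly_ring n) \<Longrightarrow> q \<in> carrier (poly_ring n) \<Longrightarrow> p + q \<in> carrier (poly_ring n)"
    and "p \<in> carrier (poly_ring n) \<Longrightarrow> q \<in> carrier (poly_ring n) \<Longrightarrow> p * q \<in> carrier (poly_ring n)"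
    and "p \<in> carrier (poly_ring n) \<Longrightarrow> - p \<in> carrier (poly_ring n)"
    and "p \<in> carrier (poly_ring n) \<Longrightarrow> q \<in> carrier (poly_ring n) \<Longrightarrow> p - q \<in> carrier (poly_ring n)"
proof -
  have add: "p + q \<in> carrier (poly_ring n)"
    if "p \<in> carrier (poly_ring n)" "q \<in> carrier (poly_ring n)" for p q :: "'k mpoly"
    using that Poly_Mapping.keys_add[of p q] by (auto simp: poly_ring_carrier)
  show "p * q \<in> carrier (poly_ring n)"
    if p: "p \<in> carrier (poly_ring n)" and q: "q \<in> carrier (poly_ring n)"
    unfolding poly_ring_carrier
  proof
    fix m assume "m \<in> Poly_Mapping.keys (p * q)"
    then obtain a b where "a \<in> Poly_Mapping.keys p" "b \<in> Poly_Mapping.keys q" "m = a + b"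
      using keys_mult[of p q] by blast
    then show "Poly_Mapping.keys m \<subseteq> {..n}"
      using p q by (auto simp: poly_ring_carrier keys_add_nat)
  qed
  have neg: "- p \<in> carrier (poly_ring n)" if "p \<in> carrier (poly_ring n)" for p :: "'k mpoly"
    using that by (simp add: poly_ring_carrier in_keys_iff)
  show "p \<in> carrier (poly_ring n) \<Longrightarrow> q \<in> carrier (poly_ring n) \<Longrightarrow> p + q \<in> carrier (poly_ring n)"
    by (rule add)
  show "p \<in> carrier (poly_ring n) \<Longrightarrow> - p \<in> carrier (poly_ring n)" by (rule neg)
  show "p - q \<in> carrier (poly_ring n)"
    if "p \<in> carrier (poly_ring n)" "q \<in> carrier (poly_ring n)"
    using add[OF that(1) neg[OF that(2)]] by simp
qed (auto simp: poly_ring_carrier)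

lemma poly_ring_cring: "cring (poly_ring n)"
proof (rule cringI)
  show "abelian_group (poly_ring n :: 'k::field mpoly ring)"
    by (rule abelian_groupI)
      (auto intro: bexI[of _ "- x" for x :: "'k mpoly"] simp: algebra_simps poly_ring_closed)
  show "comm_monoid (poly_ring n)"
    by (rule comm_monoidI) (auto simp: algebra_simps)
qed (auto simp: algebra_simps)

lemma poly_ring_a_inv: "p \<in> carrier (poly_ring n) \<Longrightarrow> \<ominus>\<^bsub>poly_ring n\<^esub> p = - p"
proof -
  assume p: "p \<in> carrier (poly_ring n)"
  interpret cring "poly_ring n :: 'a mpoly ring" by (rule poly_ring_cring)
  show ?thesis
    using minus_equality[of "- p" p] p by (auto simp: poly_ring_closed)
qed

lemma poly_ring_minus:
  "p \<in> carrier (poly_ring n) \<Longrightarrow> q \<in> carrier (poly_ring n) \<Longrightarrow> p \<ominus>\<^bsub>poly_ring n\<^esub> q = p - q"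
  by (simp add: a_minus_def poly_ring_a_inv)

text \<open>Closure under negation comes for free as multiplication by -1, and the right-hand
  products by commutativity.\<close>

lemma (in cring) ideal_by_left_multI:
  assumes "T \<subseteq> carrier R" "\<zero> \<in> T" "\<And>a b. a \<in> T \<Longrightarrow> b \<in> T \<Longrightarrow> a \<oplus> b \<in> T"
    and mult: "\<And>r a. r \<in> carrier R \<Longrightarrow> a \<in> T \<Longrightarrow> r \<otimes> a \<in> T"
  shows "ideal T R"
proof -
  have "\<ominus> a \<in> T" if "a \<in> T" for a
    using mult[of "\<ominus> \<one>" a] that assms(1) by (auto simp: l_minus)
  then have "subgroup T (add_monoid R)"
    using assms by (intro add.subgroupI) auto
  then show ?thesis
  proof (intro idealI ring_axioms)
    fix a x assume ax: "a \<in> T" "x \<in> carrier R"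
    show "x \<otimes> a \<in> T" by (rule mult[OF ax(2,1)])
    then show "a \<otimes> x \<in> T" using m_comm[OF subsetD[OF assms(1) ax(1)] ax(2)] by simp
  qed
qed

lemma poly_idealI:
  assumes "I \<subseteq> carrier (poly_ring n)" "0 \<in> I" "\<And>p q. p \<in> I \<Longrightarrow> q \<in> I \<Longrightarrow> p + q \<in> I"
    and "\<And>r p. r \<in> carrier (poly_ring n) \<Longrightarrow> p \<in> I \<Longrightarrow> r * p \<in> I"
  shows "ideal I (poly_ring n)"
  by (rule cring.ideal_by_left_multI[OF poly_ring_cring]) (simp_all add: assms)

lemma poly_idealD:
  assumes "ideal I (poly_ring n)"
  shows "I \<subseteq> carrier (poly_ring n)" "0 \<in> I"
    and "p \<in> I \<Longrightarrow> q \<in> I \<Longrightarrow> p + q \<in> I"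
    and "r \<in> carrier (poly_ring n) \<Longrightarrow> p \<in> I \<Longrightarrow> r * p \<in> I"
    and "r \<in> carrier (poly_ring n) \<Longrightarrow> p \<in> I \<Longrightarrow> p * r \<in> I"
    and "p \<in> I \<Longrightarrow> - p \<in> I"
    and "p \<in> I \<Longrightarrow> q \<in> I \<Longrightarrow> p - q \<in> I"
proof -
  interpret ideal I "poly_ring n" by fact
  show "I \<subseteq> carrier (poly_ring n)" by (rule a_subset)
  show "0 \<in> I" using additive_subgroup.zero_closed[OF is_additive_subgroup] by simp
  have add: "p + q \<in> I" if "p \<in> I" "q \<in> I" for p q
    using additive_subgroup.a_closed[OF is_additive_subgroup that] by simp
  have mult: "r * p \<in> I" if "r \<in> carrier (poly_ring n)" "p \<in> I" for r p
    using I_l_closed[OF that(2,1)] by simp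
  have neg: "- p \<in> I" if "p \<in> I" for p using mult[of "- 1" p] that by (simp add: poly_ring_closed)
  show "p \<in> I \<Longrightarrow> q \<in> I \<Longrightarrow> p + q \<in> I" by (rule add)
  show "r \<in> carrier (poly_ring n) \<Longrightarrow> p \<in> I \<Longrightarrow> r * p \<in> I" by (rule mult)
  show "r \<in> carrier (poly_ring n) \<Longrightarrow> p \<in> I \<Longrightarrow> p * r \<in> I"
    using mult[of r p] by (simp only: mult.commute)
  show "p \<in> I \<Longrightarrow> - p \<in> I" by (rule neg)
  show "p \<in> I \<Longrightarrow> q \<in> I \<Longrightarrow> p - q \<in> I" using add[OF _ neg] by force
qed

lemma poly_ideal_sum:
  assumes "ideal I (poly_ring n)" "\<And>i. i \<in> A \<Longrightarrow> f i \<in> I"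
  shows "sum f A \<in> I"
  using assms(2) by (induction A rule: infinite_finite_induct) (auto simp: poly_idealD(2,3)[OF assms(1)])

section \<open>Forms and their generation by variables\<close>

lemma formsD: "f \<in> forms n k \<Longrightarrow> f \<in> carrier (poly_ring n)"
  by (simp add: forms_def)

lemma forms_zero: "0 \<in> forms n k"
  by (auto simp: forms_def)

lemma forms_add: "f \<in> forms n k \<Longrightarrow> g \<in> forms n k \<Longrightarrow> f + g \<in> forms n k"
  using Poly_Mapping.keys_add[of f g] by (auto simp: forms_def)

lemma forms_neg: "f \<in> forms n k \<Longrightarrow> - f \<in> forms n k"
  by (auto simp: forms_def in_keys_iff)

lemma forms_mult:
  assumes f: "f \<in> forms n i" and g: "g \<in> forms n j"
  shows "f * g \<in> forms n (i + j)"
proof -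
  have "mon_deg m = i + j" if "m \<in> Poly_Mapping.keys (f * g)" for m
  proof -
    obtain a b where "a \<in> Poly_Mapping.keys f" "b \<in> Poly_Mapping.keys g" "m = a + b"
      using \<open>m \<in> _\<close> keys_mult[of f g] by blast
    then show ?thesis using f g by (auto simp: forms_def mon_deg_add)
  qed
  then show ?thesis using assms by (auto simp: forms_def)
qed

lemma forms_const: "const c \<in> forms n 0"
  by (auto simp: forms_def const_def poly_ring_carrier)

lemma forms_one: "1 \<in> forms n 0"
  using forms_const[of 1] by (simp add: const_def)

lemma forms_var: "j \<le> n \<Longrightarrow> var j \<in> forms n 1"
  by (auto simp: forms_def var_def poly_ring_carrier)

lemma forms_const_mult: "f \<in> forms n k \<Longrightarrow> const c * f \<in> forms n k"
  using forms_mult[OF forms_const] by force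

lemma forms_var_power: "j \<le> n \<Longrightarrow> var j ^ e \<in> forms n e"
  by (induction e) (use forms_one forms_mult[OF forms_var] in force)+

lemma const_arith:
  "const 0 = 0" "const 1 = 1" "const (a + b) = const a + const b" "const (a * b) = const a * const b"
  "const (- a) = - const a"
  by (simp_all add: const_def single_add mult_single single_uminus)

lemma forms_zero_degree: "f \<in> forms n 0 \<Longrightarrow> \<exists>c. f = const c"
proof -
  assume f: "f \<in> forms n 0"
  have "m = 0" if "m \<in> Poly_Mapping.keys f" for m
  proof -
    have "mon_deg m = 0" using f that by (simp add: forms_def)
    then show ?thesis by (simp add: mon_deg_def poly_mapping_eq_iff fun_eq_iff in_keys_iff)
  qed
  then have "f = const (Poly_Mapping.lookup f 0)"
    by (intro poly_mapping_eqI) (auto simp: const_def lookup_single when_def in_keys_iff)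
  then show ?thesis by blast
qed

lemma poly_sum_monomials: "p = (\<Sum>m\<in>Poly_Mapping.keys p. Poly_Mapping.single m (Poly_Mapping.lookup p m))"
  by (rule poly_mapping_eqI) (simp add: lookup_sum lookup_single when_def in_keys_iff)

lemma monomial_factor:
  assumes "mon_deg m = Suc k" "Poly_Mapping.keys m \<subseteq> {..n}"
  obtains j m' where "j \<le> n" "m = m' + Poly_Mapping.single j 1" "mon_deg m' = k"
    "Poly_Mapping.keys m' \<subseteq> {..n}"
proof -
  have "Poly_Mapping.keys m \<noteq> {}" using assms(1) by (auto simp: mon_deg_def)
  then obtain j where j: "j \<in> Poly_Mapping.keys m" by blast
  define m' where "m' = m - Poly_Mapping.single j 1"
  have m: "m = m' + Poly_Mapping.single j 1"
    using j by (intro poly_mapping_eqI)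
      (auto simp: m'_def lookup_add lookup_minus lookup_single when_def in_keys_iff)
  moreover have "mon_deg m' = k" using assms(1) m by (simp add: mon_deg_add)
  moreover have "Poly_Mapping.keys m' \<subseteq> {..n}" using assms(2) m by (simp add: keys_add_nat)
  ultimately show ?thesis using that j assms(2) by blast
qed

text \<open>Monomials are built by multiplying a constant by one variable at a time, and a form is a
  sum of monomials of its degree. The rule is tailored to properties compatible with sums and the
  Leibniz rule, such as where differentials of forms lie.\<close>

lemma forms_induct [consumes 1, case_names const add var]:
  fixes f :: "'k::field mpoly"
  assumes "f \<in> forms n k"
    and const: "\<And>c. Q 0 (const c)"
    and add: "\<And>k f g. f \<in> forms n k \<Longrightarrow> g \<in> forms n k \<Longrightarrow> Q k f \<Longrightarrow> Q k g \<Longrightarrow> Q k (f + g)"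
    and var: "\<And>k j f. j \<le> n \<Longrightarrow> f \<in> forms n k \<Longrightarrow> Q k f \<Longrightarrow> Q (Suc k) (f * var j)"
  shows "Q k f"
proof -
  have single: "Q k (Poly_Mapping.single m c) \<and> Poly_Mapping.single m c \<in> forms n k"
    if "mon_deg m = k" "Poly_Mapping.keys m \<subseteq> {..n}" for m k and c :: 'k
    using that
  proof (induction k arbitrary: m)
    case 0
    then have "m = 0" by (simp add: mon_deg_def poly_mapping_eq_iff fun_eq_iff in_keys_iff)
    then show ?case using const[of c] forms_const[of c n] by (simp add: const_def)
  next
    case (Suc k)
    obtain j m' where j: "j \<le> n" "m = m' + Poly_Mapping.single j 1" "mon_deg m' = k"
      "Poly_Mapping.keys m' \<subseteq> {..n}" using monomial_factor[OF Suc.prems] .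
    have "Poly_Mapping.single m c = Poly_Mapping.single m' c * var j"
      by (simp add: j(2) var_def mult_single)
    then show ?case
      using Suc.IH[OF j(3,4)] var[OF j(1), of "Poly_Mapping.single m' c" k]
        forms_mult[OF _ forms_var[OF j(1)], of "Poly_Mapping.single m' c" k] by simp
  qed
  \<comment> \<open>The empty sum needs the property for 0 in every degree. The rule for constants
    gives it in degree 0 only; higher degrees are reached through 0 = 0 X_0.\<close>
  have z: "Q k 0"
  proof (induction k)
    case 0 then show ?case using const[of 0] by (simp add: const_arith)
  next
    case (Suc k) then show ?case using var[of 0 0 k] by (simp add: forms_zero)
  qed
  have "Q k (\<Sum>m\<in>A. Poly_Mapping.single m (Poly_Mapping.lookup f m)) \<and>
    (\<Sum>m\<in>A. Poly_Mapping.single m (Poly_Mapping.lookup f m)) \<in> forms n k"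
    if "finite A" "A \<subseteq> Poly_Mapping.keys f" for A
    using that
  proof (induction A)
    case empty then show ?case by (simp add: z forms_zero)
  next
    case (insert m A)
    then have "mon_deg m = k" "Poly_Mapping.keys m \<subseteq> {..n}"
      using assms(1) by (auto simp: forms_def poly_ring_carrier)
    then show ?case using insert single[of m k] by (simp add: add forms_add)
  qed
  then show ?thesis using poly_sum_monomials[of f] by (metis finite_keys order_refl)
qed

section \<open>Homogeneous components of a polynomial\<close>

lift_definition hcomp :: "nat \<Rightarrow> 'k::field mpoly \<Rightarrow> 'k mpoly"
  is "\<lambda>k p m. p m when mon_deg m = k"
  by (erule finite_subset[rotated]) auto

lemma hcomp_lookup: "Poly_Mapping.lookup (hcomp k p) m = (Poly_Mapping.lookup p m when mon_deg m = k)"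
  by transfer simp

lemma hcomp_add: "hcomp k (p + q) = hcomp k p + hcomp k q"
  by (rule poly_mapping_eqI) (simp add: hcomp_lookup lookup_add when_add_distrib)

lemma hcomp_zero [simp]: "hcomp k 0 = 0"
  by (rule poly_mapping_eqI) (simp add: hcomp_lookup)

lemma hcomp_sum: "hcomp k (sum f A) = (\<Sum>i\<in>A. hcomp k (f i))"
  by (induction A rule: infinite_finite_induct) (simp_all add: hcomp_add)

lemma hcomp_forms: "p \<in> carrier (poly_ring n) \<Longrightarrow> hcomp k p \<in> forms n k"
  by (auto simp: forms_def poly_ring_carrier in_keys_iff hcomp_lookup when_def split: if_splits)

lemma hcomp_form: "f \<in> forms n i \<Longrightarrow> hcomp k f = (if k = i then f else 0)"
  by (rule poly_mapping_eqI) (auto simp: forms_def in_keys_iff hcomp_lookup when_def)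

lemma hcomp_decomposition:
  obtains N where "p = (\<Sum>k\<le>N. hcomp k p)" "\<And>k. k > N \<Longrightarrow> hcomp k p = 0"
proof -
  \<comment> \<open>The inserted 0 keeps \<open>Max\<close> meaningful for the zero
    polynomial.\<close>
  define N where "N = Max (insert 0 (mon_deg ` Poly_Mapping.keys p))"
  have N: "mon_deg m \<le> N" if "m \<in> Poly_Mapping.keys p" for m
    unfolding N_def using that by (intro Max_ge) auto
  have "p = (\<Sum>k\<le>N. hcomp k p)"
  proof (rule poly_mapping_eqI)
    fix m
    show "Poly_Mapping.lookup p m = Poly_Mapping.lookup (\<Sum>k\<le>N. hcomp k p) m"
      using N[of m] by (auto simp: lookup_sum hcomp_lookup when_def in_keys_iff)
  qed
  moreover have "hcomp k p = 0" if "k > N" for k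
    using N that by (intro poly_mapping_eqI) (force simp: hcomp_lookup when_def in_keys_iff)
  ultimately show ?thesis using that by blast
qed

lemma hcomp_form_mult:
  assumes f: "f \<in> forms n i" and p: "p \<in> carrier (poly_ring n)"
  shows "hcomp k (f * p) = (if i \<le> k then f * hcomp (k - i) p else 0)"
proof -
  obtain N where N: "p = (\<Sum>j\<le>N. hcomp j p)" "\<And>k. k > N \<Longrightarrow> hcomp k p = 0"
    using hcomp_decomposition by blast
  have "hcomp k (f * p) = (\<Sum>j\<le>N. hcomp k (f * hcomp j p))"
    by (subst N(1)) (simp add: sum_distrib_left hcomp_sum)
  also have "\<dots> = (\<Sum>j\<le>N. if k = i + j then f * hcomp j p else 0)"
    by (intro sum.cong refl hcomp_form[OF forms_mult[OF f hcomp_forms[OF p]]])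
  also have "\<dots> = (if i \<le> k then f * hcomp (k - i) p else 0)"
  proof (cases "i \<le> k")
    case True
    then have "(\<Sum>j\<le>N. if k = i + j then f * hcomp j p else 0) = (\<Sum>j\<le>N. if j = k - i then f * hcomp j p else 0)"
      by (intro sum.cong) auto
    then show ?thesis using True N(2)[of "k - i"] by auto
  qed (auto intro!: sum.neutral)
  finally show ?thesis .
qed

lemma hcomp_mult:
  assumes p: "p \<in> carrier (poly_ring n)" and q: "q \<in> carrier (poly_ring n)"
  shows "hcomp k (p * q) = (\<Sum>i\<le>k. hcomp i p * hcomp (k - i) q)"
proof -
  obtain N where N: "p = (\<Sum>j\<le>N. hcomp j p)" "\<And>k. k > N \<Longrightarrow> hcomp k p = 0"
    using hcomp_decomposition by blast
  have "hcomp k (p * q) = (\<Sum>j\<le>N. hcomp k (hcomp j p * q))"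
    by (subst N(1)) (simp add: sum_distrib_right hcomp_sum)
  also have "\<dots> = (\<Sum>j\<le>N. if j \<le> k then hcomp j p * hcomp (k - j) q else 0)"
    by (intro sum.cong refl hcomp_form_mult[OF hcomp_forms[OF p] q])
  \<comment> \<open>The degree bound N of p and the target bound k are unrelated; their maximum
    gives a common index set on which the surplus terms vanish.\<close>
  also have "\<dots> = (\<Sum>j\<in>{..max N k}. if j \<le> k then hcomp j p * hcomp (k - j) q else 0)"
    by (rule sum.mono_neutral_left) (auto simp: N(2))
  also have "\<dots> = (\<Sum>i\<le>k. hcomp i p * hcomp (k - i) q)"
    by (rule sum.mono_neutral_cong_right) auto
  finally show ?thesis .
qed

text \<open>Working form of \<open>homog_ideal\<close>. Closure under components can be checked
  directly for colon ideals, sums and unions of chains, where otherwise homogeneous generators would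
  have to be exhibited.\<close>

definition graded_ideal :: "nat \<Rightarrow> 'k::field mpoly set \<Rightarrow> bool" where
  "graded_ideal n I \<longleftrightarrow> ideal I (poly_ring n) \<and> (\<forall>p\<in>I. \<forall>k. hcomp k p \<in> I)"

lemma graded_idealD:
  assumes "graded_ideal n I"
  shows "ideal I (poly_ring n)" "p \<in> I \<Longrightarrow> hcomp k p \<in> I"
  using assms by (auto simp: graded_ideal_def)

text \<open>In one direction, the elements whose components all stay in I form an ideal containing
  the homogeneous generators. In the other, the forms in I generate it, since every element is the
  sum of its components.\<close>

lemma homog_ideal_iff:
  fixes I :: "'k::field mpoly set"
  shows "homog_ideal n I \<longleftrightarrow> graded_ideal n I"
proof
  interpret P: cring "poly_ring n :: 'k mpoly ring" by (rule poly_ring_cring)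
  assume "homog_ideal n I"
  then obtain S where I: "ideal I (poly_ring n)" and S: "S \<subseteq> (\<Union>k. forms n k)"
    and eq: "I = Idl\<^bsub>poly_ring n\<^esub> S"
    by (auto simp: homog_ideal_def)
  have Sc: "S \<subseteq> carrier (poly_ring n)"
    using S formsD by fast
  note I' = poly_idealD[OF I]
  have "hcomp k p \<in> I" if "p \<in> I" for p k
  proof -
    have "ideal {p \<in> I. \<forall>k. hcomp k p \<in> I} (poly_ring n)"
    proof (rule poly_idealI)
      fix r p :: "'k mpoly" assume r: "r \<in> carrier (poly_ring n)" and p: "p \<in> {p \<in> I. \<forall>k. hcomp k p \<in> I}"
      have "hcomp i r * hcomp (k - i) p \<in> I" for i k
        using p r by (intro I'(4)) (auto intro: formsD[OF hcomp_forms])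
      then show "r * p \<in> {p \<in> I. \<forall>k. hcomp k p \<in> I}"
        using r p I'(1,4) by (auto simp: hcomp_mult[of r n p] subset_iff intro!: poly_ideal_sum[OF I])
    qed (use I' in \<open>auto simp: hcomp_add\<close>)
    moreover have "S \<subseteq> {p \<in> I. \<forall>k. hcomp k p \<in> I}"
    proof
      fix s assume s: "s \<in> S"
      then obtain i where "s \<in> forms n i" using S by blast
      moreover have "s \<in> I"
        unfolding eq by (rule subsetD[OF P.genideal_self[OF Sc] s])
      ultimately show "s \<in> {p \<in> I. \<forall>k. hcomp k p \<in> I}"
        using I'(2) by (simp add: hcomp_form[of s n i])
    qed
    ultimately have "I \<subseteq> {p \<in> I. \<forall>k. hcomp k p \<in> I}"
      using P.genideal_minimal[of "{p \<in> I. \<forall>k. hcomp k p \<in> I}" S] by (simp only: eq[symmetric])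
    then show ?thesis using that by blast
  qed
  then show "graded_ideal n I" using I by (simp add: graded_ideal_def)
next
  interpret P: cring "poly_ring n :: 'k mpoly ring" by (rule poly_ring_cring)
  assume gr: "graded_ideal n I"
  note I = graded_idealD(1)[OF gr]
  define S where "S = I \<inter> (\<Union>k. forms n k)"
  have SI: "S \<subseteq> I" by (simp add: S_def)
  have Sc: "S \<subseteq> carrier (poly_ring n)" using SI poly_idealD(1)[OF I] by blast
  have idS: "ideal (Idl\<^bsub>poly_ring n\<^esub> S) (poly_ring n)" by (rule P.genideal_ideal[OF Sc])
  have "p \<in> Idl\<^bsub>poly_ring n\<^esub> S" if "p \<in> I" for p
  proof -
    obtain N where N: "p = (\<Sum>j\<le>N. hcomp j p)" using hcomp_decomposition by blast
    have "hcomp j p \<in> S" for j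
      unfolding S_def using that graded_idealD(2)[OF gr that] subsetD[OF poly_idealD(1)[OF I] that, THEN hcomp_forms] by blast
    then have "hcomp j p \<in> Idl\<^bsub>poly_ring n\<^esub> S" for j
      by (rule subsetD[OF P.genideal_self[OF Sc]])
    then show ?thesis by (subst N) (rule poly_ideal_sum[OF idS])
  qed
  moreover have "Idl\<^bsub>poly_ring n\<^esub> S \<subseteq> I" by (rule P.genideal_minimal[OF I SI])
  ultimately have "I = Idl\<^bsub>poly_ring n\<^esub> S" by blast
  then show "homog_ideal n I" using I by (auto simp: homog_ideal_def S_def)
qed

section \<open>Homogeneous primes and the hyperplane section\<close>

lemma var_power: "var j ^ e = Poly_Mapping.single (Poly_Mapping.single j e) 1"
proof (induction e)
  case (Suc e)
  then show ?case
    by (simp add: var_def mult_single single_add[symmetric])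
qed (simp add: single_zero)

lemma var_closed: "j \<le> n \<Longrightarrow> var j \<in> carrier (poly_ring n)"
  by (rule formsD[OF forms_var])

lemma power_closed: "p \<in> carrier (poly_ring n) \<Longrightarrow> p ^ e \<in> carrier (poly_ring n)"
  by (induction e) auto

lemma large_forms_in_ideal:
  fixes J :: "'k::field mpoly set"
  assumes J: "ideal J (poly_ring n)" and pow: "\<And>j. j \<le> n \<Longrightarrow> \<exists>e. var j ^ e \<in> J"
  shows "\<exists>N. \<forall>k\<ge>N. forms n k \<subseteq> J"
proof -
  obtain e where e: "\<And>j. j \<le> n \<Longrightarrow> var j ^ e j \<in> J" using pow by metis
  define K where "K = Max (e ` {..n})"
  have K: "var j ^ K \<in> J" if j: "j \<le> n" for j
  proof -
    have "e j \<le> K" unfolding K_def using j by (intro Max_ge) auto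
    then have "(var j :: 'k mpoly) ^ K = var j ^ (K - e j) * var j ^ e j" by (simp add: power_add[symmetric])
    then show ?thesis
      using poly_idealD(4)[OF J power_closed[OF var_closed[OF j]] e[OF j]] by simp
  qed
  \<comment> \<open>The bound (n + 1) K is a pigeonhole: if all n + 1 exponents were below K, the
    degree would be smaller.\<close>
  have mono: "Poly_Mapping.single m c \<in> J"
    if m: "mon_deg m \<ge> Suc n * K" "Poly_Mapping.keys m \<subseteq> {..n}" for m c
  proof -
    have "\<exists>j\<le>n. K \<le> Poly_Mapping.lookup m j"
    proof (rule ccontr)
      assume "\<not> ?thesis"
      then have "Poly_Mapping.lookup m j < K" if "j \<le> n" for j
        using that not_le by blast
      then have "(\<Sum>j\<le>n. Poly_Mapping.lookup m j) < (\<Sum>j\<le>n. K)"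
        by (intro sum_strict_mono) auto
      then show False using m mon_deg_superset[OF _ m(2)] by simp
    qed
    then obtain j where j: "j \<le> n" "K \<le> Poly_Mapping.lookup m j" by blast
    define m' where "m' = m - Poly_Mapping.single j K"
    have eq: "m = m' + Poly_Mapping.single j K"
      using j(2) by (intro poly_mapping_eqI)
        (auto simp: m'_def lookup_add lookup_minus lookup_single when_def)
    have "Poly_Mapping.single m c = Poly_Mapping.single m' c * var j ^ K"
      by (simp add: var_power mult_single eq)
    moreover have "Poly_Mapping.single m' c \<in> carrier (poly_ring n)"
      using m(2) by (auto simp: poly_ring_carrier eq keys_add_nat)
    ultimately show ?thesis using poly_idealD(4)[OF J _ K[OF j(1)]] by simp
  qed
  have "f \<in> J" if "k \<ge> Suc n * K" "f \<in> forms n k" for k f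
    by (subst poly_sum_monomials[of f], rule poly_ideal_sum[OF J], rule mono)
      (use that in \<open>auto simp: forms_def poly_ring_carrier\<close>)
  then show ?thesis by blast
qed

text \<open>This is the sum of M and the principal ideal of a, written out so that later arguments
  can read off m and r. It is graded because a is a form: a component of r a is a times a component
  of r.\<close>

lemma graded_ideal_insert:
  fixes M :: "'k::field mpoly set"
  assumes M: "graded_ideal n M" and a: "a \<in> forms n i"
  shows "graded_ideal n {m + r * a | m r. m \<in> M \<and> r \<in> carrier (poly_ring n)}" (is "graded_ideal n ?S")
proof -
  note I = poly_idealD[OF graded_idealD(1)[OF M]]
  have mem: "m + r * a \<in> ?S" if "m \<in> M" "r \<in> carrier (poly_ring n)" for m r using that by blast
  have "ideal ?S (poly_ring n)"
  proof (rule poly_idealI)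
    show "?S \<subseteq> carrier (poly_ring n)"
      using I(1) formsD[OF a] by auto
    show "0 \<in> ?S" using mem[OF I(2), of 0] by auto
  next
    fix p q assume "p \<in> ?S" "q \<in> ?S"
    then obtain m r m' r' where "p = m + r * a" "q = m' + r' * a" "m \<in> M" "m' \<in> M"
      "r \<in> carrier (poly_ring n)" "r' \<in> carrier (poly_ring n)" by blast
    then show "p + q \<in> ?S"
      using mem[of "m + m'" "r + r'"] I(3) by (auto simp: algebra_simps)
  next
    fix s p :: "'k mpoly" assume s: "s \<in> carrier (poly_ring n)" and "p \<in> ?S"
    then obtain m r where p: "p = m + r * a" "m \<in> M" "r \<in> carrier (poly_ring n)" by blast
    then have "s * m + (s * r) * a \<in> ?S" using mem[of "s * m" "s * r"] I(4) s by auto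
    then show "s * p \<in> ?S" by (simp add: p(1) distrib_left mult.assoc)
  qed
  moreover have "hcomp k p \<in> ?S" if pS: "p \<in> ?S" for p k
  proof -
    obtain m r where p: "p = m + r * a" "m \<in> M" and r: "r \<in> carrier (poly_ring n)" using pS by blast
    have m: "hcomp k m \<in> M" using graded_idealD(2)[OF M p(2)] .
    have "hcomp k p = hcomp k m + hcomp k (a * r)"
      by (simp add: p(1) hcomp_add mult.commute)
    then have "hcomp k p = hcomp k m + (if i \<le> k then hcomp (k - i) r else 0) * a"
      by (simp add: hcomp_form_mult[OF a r] mult.commute)
    moreover have "(if i \<le> k then hcomp (k - i) r else 0) \<in> carrier (poly_ring n)"
      using formsD[OF hcomp_forms[OF r]] by auto
    ultimately show ?thesis using mem[OF m] by presburger
  qed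
  ultimately show ?thesis by (simp add: graded_ideal_def)
qed

text \<open>Zorn's lemma yields an ideal maximal among the graded ideals that miss all powers of x.
  This maximality can only be tested by adjoining forms, so primality is first shown for products of
  forms and then extended to arbitrary elements through their components of lowest degree outside
  M.\<close>

lemma graded_prime_avoiding:
  fixes J :: "'k::field mpoly set"
  assumes J: "graded_ideal n J" and x: "x \<in> carrier (poly_ring n)" and pow: "\<And>e. x ^ e \<notin> J"
  shows "\<exists>\<pp>. primeideal \<pp> (poly_ring n) \<and> graded_ideal n \<pp> \<and> J \<subseteq> \<pp> \<and> x \<notin> \<pp>"
proof -
  define A where "A = {I. graded_ideal n I \<and> J \<subseteq> I \<and> (\<forall>e. x ^ e \<notin> I)}"
  have "\<exists>M\<in>A. \<forall>I\<in>A. M \<subseteq> I \<longrightarrow> I = M"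
  proof (rule subset_Zorn_nonempty)
    show "A \<noteq> {}" using assms by (auto simp: A_def)
    fix \<C> assume ne: "\<C> \<noteq> {}" and ch: "subset.chain A \<C>"
    have sub: "\<C> \<subseteq> A" using ch by (auto simp: subset.chain_def)
    have gr: "graded_ideal n I" if "I \<in> \<C>" for I using sub that by (auto simp: A_def)
    note id = poly_idealD[OF graded_idealD(1)[OF gr]]
    have "ideal (\<Union>\<C>) (poly_ring n)"
    proof (rule poly_idealI)
      show "\<Union>\<C> \<subseteq> carrier (poly_ring n)" using id(1) by blast
      show "0 \<in> \<Union>\<C>" using ne id(2) by blast
    next
      fix p q assume "p \<in> \<Union>\<C>" "q \<in> \<Union>\<C>"
      then obtain I I' where I: "I \<in> \<C>" "I' \<in> \<C>" "p \<in> I" "q \<in> I'" by blast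
      then have "I \<subseteq> I' \<or> I' \<subseteq> I" using ch by (auto simp: subset.chain_def)
      then show "p + q \<in> \<Union>\<C>" using I id(3) by blast
    next
      fix r p :: "'k mpoly" assume "r \<in> carrier (poly_ring n)" "p \<in> \<Union>\<C>"
      then show "r * p \<in> \<Union>\<C>" using id(4) by blast
    qed
    moreover have "hcomp k p \<in> \<Union>\<C>" if "p \<in> \<Union>\<C>" for p k
      using that graded_idealD(2)[OF gr] by blast
    moreover have "J \<subseteq> \<Union>\<C>" using ne sub by (fastforce simp: A_def)
    ultimately show "\<Union>\<C> \<in> A"
      using sub by (auto simp: A_def graded_ideal_def[of n "\<Union>\<C>"])
  qed
  then obtain M where MA: "M \<in> A" and maxA: "\<And>I. I \<in> A \<Longrightarrow> M \<subseteq> I \<Longrightarrow> I = M" by blast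
  have M: "graded_ideal n M" "J \<subseteq> M" "\<And>e. x ^ e \<notin> M" using MA by (simp_all add: A_def)
  have max: "I = M" if "graded_ideal n I" "M \<subseteq> I" "\<And>e. x ^ e \<notin> I" for I
    using maxA[OF _ that(2)] that M(2) by (simp add: A_def)
  note I = poly_idealD[OF graded_idealD(1)[OF M(1)]]
  \<comment> \<open>Adjoining a form outside M gives a strictly larger graded ideal, which by
    maximality meets the powers of x.\<close>
  have power_in: "\<exists>e m r. m \<in> M \<and> r \<in> carrier (poly_ring n) \<and> x ^ e = m + r * a"
    if a: "a \<in> forms n i" "a \<notin> M" for a i
  proof (rule ccontr)
    assume no: "\<not> ?thesis"
    let ?S = "{m + r * a | m r. m \<in> M \<and> r \<in> carrier (poly_ring n)}"
    have "?S = M"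
    proof (rule max[OF graded_ideal_insert[OF M(1) a(1)]])
      show "M \<subseteq> ?S"
      proof
        fix m assume "m \<in> M"
        then have "m + 0 * a \<in> ?S" by blast
        then show "m \<in> ?S" by simp
      qed
      show "x ^ e \<notin> ?S" for e using no by blast
    qed
    moreover have "0 + 1 * a \<in> ?S" using I(2) by blast
    ultimately show False using a(2) by simp
  qed
  have prime_forms: "a \<in> M \<or> b \<in> M"
    if a: "a \<in> forms n i" and b: "b \<in> forms n j" and ab: "a * b \<in> M" for a b i j
  proof (rule ccontr)
    assume "\<not> ?thesis"
    then obtain e m r e' m' r' where e: "m \<in> M" "r \<in> carrier (poly_ring n)" "x ^ e = m + r * a"
      "m' \<in> M" "r' \<in> carrier (poly_ring n)" "x ^ e' = m' + r' * b"
      using power_in[OF a] power_in[OF b] by blast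
    have c: "r * a \<in> carrier (poly_ring n)" "m' + r' * b \<in> carrier (poly_ring n)"
      using e formsD[OF a] formsD[OF b] I(1) by auto
    \<comment> \<open>Multiplying the two representations leaves r r' (a b) as the only term without
      a factor m or m', and it lies in M as well.\<close>
    have "x ^ (e + e') = m * (m' + r' * b) + ((r * a) * m' + (r * r') * (a * b))"
      by (simp add: power_add e algebra_simps)
    also have "\<dots> \<in> M"
      using I(5)[OF c(2) e(1)] I(4)[OF c(1) e(4)] I(4)[OF poly_ring_closed(4)[OF e(2,5)] ab]
      by (intro I(3))
    finally show False using M(3) by blast
  qed
  have "primeideal M (poly_ring n)"
  proof (rule primeidealI)
    show "ideal M (poly_ring n)" by (rule graded_idealD(1)[OF M(1)])
    show "cring (poly_ring n :: 'k mpoly ring)" by (rule poly_ring_cring)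
    show "carrier (poly_ring n) \<noteq> M" using M(3)[of 0] by auto
    fix a b assume a: "a \<in> carrier (poly_ring n)" and b: "b \<in> carrier (poly_ring n)"
      and "a \<otimes>\<^bsub>poly_ring n\<^esub> b \<in> M"
    then have ab: "a * b \<in> M" by simp
    show "a \<in> M \<or> b \<in> M"
    proof (rule ccontr)
      assume no: "\<not> ?thesis"
      have ex: "\<exists>k. hcomp k p \<notin> M" if "p \<notin> M" for p
        using hcomp_decomposition[of p] poly_ideal_sum[OF graded_idealD(1)[OF M(1)]] that by metis
      \<comment> \<open>The component of a b in degree i + j is the product of the two chosen
        components plus products in which one factor has degree below i or below j and so lies in
        M.\<close>
      define i where "i = (LEAST k. hcomp k a \<notin> M)"
      define j where "j = (LEAST k. hcomp k b \<notin> M)"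
      have i: "hcomp i a \<notin> M" "\<And>k. k < i \<Longrightarrow> hcomp k a \<in> M"
        using LeastI_ex[OF ex] not_less_Least no unfolding i_def by blast+
      have j: "hcomp j b \<notin> M" "\<And>k. k < j \<Longrightarrow> hcomp k b \<in> M"
        using LeastI_ex[OF ex] not_less_Least no unfolding j_def by blast+
      note ha = formsD[OF hcomp_forms[OF a]] and hb = formsD[OF hcomp_forms[OF b]]
      have "hcomp (i + j) (a * b) =
          hcomp i a * hcomp j b + (\<Sum>k\<in>{..i+j} - {i}. hcomp k a * hcomp (i + j - k) b)"
        by (simp add: hcomp_mult[OF a b] sum.remove[of "{..i+j}" i])
      moreover have "(\<Sum>k\<in>{..i+j} - {i}. hcomp k a * hcomp (i + j - k) b) \<in> M"
      proof (rule poly_ideal_sum[OF graded_idealD(1)[OF M(1)]])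
        fix k assume "k \<in> {..i+j} - {i}"
        then have "k < i \<or> i + j - k < j" by auto
        then show "hcomp k a * hcomp (i + j - k) b \<in> M"
          using i(2) j(2) I(4,5) ha hb by blast
      qed
      ultimately have "hcomp i a * hcomp j b \<in> M"
        using I(7)[OF graded_idealD(2)[OF M(1) ab, of "i + j"]] by fastforce
      then show False
        using prime_forms[OF hcomp_forms[OF a] hcomp_forms[OF b]] i(1) j(1) by blast
    qed
  qed
  moreover have "x \<notin> M" using M(3)[of 1] by simp
  ultimately show ?thesis using M(1,2) by blast
qed

text \<open>If no power of some variable lay in J, a graded prime over J avoiding that variable
  would exist, contrary to the assumption. So every variable is nilpotent modulo J.\<close>

lemma large_forms_of_no_points:
  assumes J: "graded_ideal n J"
    and pts: "\<And>\<pp>. primeideal \<pp> (poly_ring n) \<Longrightarrow> graded_ideal n \<pp> \<Longrightarrow> J \<subseteq> \<pp> \<Longrightarrow> var ` {..n} \<subseteq> \<pp>"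
  shows "\<exists>N. \<forall>k\<ge>N. forms n k \<subseteq> J"
proof (rule large_forms_in_ideal[OF graded_idealD(1)[OF J]])
  fix j assume j: "j \<le> n"
  show "\<exists>e. var j ^ e \<in> J"
  proof (rule ccontr)
    assume "\<not> ?thesis"
    then obtain \<pp> where "primeideal \<pp> (poly_ring n)" "graded_ideal n \<pp>" "J \<subseteq> \<pp>" "var j \<notin> \<pp>"
      using graded_prime_avoiding[OF J var_closed[OF j]] by blast
    then show False using pts j by blast
  qed
qed

text \<open>The support lies in the chart where X_0 is nonzero, hence the name. Nonemptiness of the
  scheme is recorded as \<open>one_notin\<close>, which makes the constants embed into the
  coordinate ring as a field.\<close>

locale affine_scheme =
  fixes n :: nat and I :: "'k::field mpoly set"
  assumes graded: "graded_ideal n I" and saturated: "saturated n I"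
    and off_hyperplane: "\<And>\<pp>. \<pp> \<in> scheme_pts n I \<Longrightarrow> var 0 \<notin> \<pp>"
    and one_notin: "1 \<notin> I"
begin

lemma ideal: "ideal I (poly_ring n)"
  by (rule graded_idealD(1)[OF graded])

lemmas I = poly_idealD[OF ideal]

lemma no_points_on_hyperplane:
  assumes "primeideal \<pp> (poly_ring n)" "graded_ideal n \<pp>" "I \<subseteq> \<pp>" "var 0 \<in> \<pp>"
  shows "var ` {..n} \<subseteq> \<pp>"
  using off_hyperplane[of \<pp>] assms unfolding scheme_pts_def homog_ideal_iff by blast

text \<open>The colon ideal of I by f contains I and X_0, so no point lies over it and it contains
  all forms of large degree. Saturation turns this into membership of f. The element f is a form so
  that the colon ideal is graded.\<close>

lemma var0_nonzerodivisor_form: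
  assumes f: "f \<in> forms n k" and mem: "var 0 * f \<in> I"
  shows "f \<in> I"
proof -
  let ?J = "{h \<in> carrier (poly_ring n). f * h \<in> I}"
  have fc: "f \<in> carrier (poly_ring n)" by (rule formsD[OF f])
  have "ideal ?J (poly_ring n)"
  proof (rule poly_idealI)
    fix r p :: "'k mpoly" assume "r \<in> carrier (poly_ring n)" "p \<in> ?J"
    then show "r * p \<in> ?J" using I(4)[of r "f * p"] by (auto simp: algebra_simps)
  qed (use I in \<open>auto simp: algebra_simps\<close>)
  \<comment> \<open>Since f has degree k, the component of f h in degree k + j is f times the
    component of h in degree j.\<close>
  moreover have "hcomp j h \<in> ?J" if "h \<in> ?J" for h j
    using that graded_idealD(2)[OF graded, of "f * h" "k + j"] hcomp_form_mult[OF f, of h "k + j"]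
    by (auto intro: formsD hcomp_forms)
  ultimately have J: "graded_ideal n ?J" by (simp add: graded_ideal_def)
  have "\<exists>N. \<forall>k\<ge>N. forms n k \<subseteq> ?J"
  proof (rule large_forms_of_no_points[OF J])
    fix \<pp> assume p: "primeideal \<pp> (poly_ring n)" "graded_ideal n \<pp>" "?J \<subseteq> \<pp>"
    have "I \<subseteq> ?J" using I(1) I(4)[OF fc] by blast
    moreover have "var 0 \<in> ?J" using mem var_closed[of 0 n] by (simp add: mult.commute)
    ultimately show "var ` {..n} \<subseteq> \<pp>" using no_points_on_hyperplane p by blast
  qed
  then obtain N where "\<And>k h. k \<ge> N \<Longrightarrow> h \<in> forms n k \<Longrightarrow> h * f \<in> I"
    by (auto simp: mult.commute)
  then show ?thesis using saturated fc unfolding saturated_def by (auto simp del: ex_simps) (metis)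
qed

lemma var0_power_nonzerodivisor_form:
  "f \<in> forms n k \<Longrightarrow> var 0 ^ e * f \<in> I \<Longrightarrow> f \<in> I"
proof (induction e)
  case (Suc e)
  have "var 0 ^ e * f \<in> forms n (e + k)"
    by (rule forms_mult[OF forms_var_power Suc.prems(1)]) simp
  then show ?case
    using Suc var0_nonzerodivisor_form by (simp add: mult.assoc)
qed simp

lemma eventually_divisible_by_var0:
  "\<exists>N. \<forall>k\<ge>N. \<forall>f\<in>forms n (Suc k). \<exists>g\<in>forms n k. f - var 0 * g \<in> I"
proof -
  have v: "var 0 \<in> forms n 1" by (rule forms_var) simp
  let ?J = "{m + r * var 0 | m r. m \<in> I \<and> r \<in> carrier (poly_ring n)}"
  have mem: "m + r * var 0 \<in> ?J" if "m \<in> I" "r \<in> carrier (poly_ring n)" for m r using that by blast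
  have "\<exists>N. \<forall>k\<ge>N. forms n k \<subseteq> ?J"
  proof (rule large_forms_of_no_points[OF graded_ideal_insert[OF graded v]])
    fix \<pp> assume p: "primeideal \<pp> (poly_ring n)" "graded_ideal n \<pp>" "?J \<subseteq> \<pp>"
    have "I \<subseteq> ?J" using mem[of _ 0] by fastforce
    moreover have "var 0 \<in> ?J" using mem[OF I(2), of 1] by auto
    ultimately show "var ` {..n} \<subseteq> \<pp>" using no_points_on_hyperplane p by blast
  qed
  then obtain N where N: "\<And>k. k \<ge> N \<Longrightarrow> forms n k \<subseteq> ?J" by blast
  have "\<exists>g\<in>forms n k. f - var 0 * g \<in> I" if k: "k \<ge> N" and f: "f \<in> forms n (Suc k)" for k f
  proof -
    obtain m r where mr: "f = m + r * var 0" "m \<in> I" "r \<in> carrier (poly_ring n)"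
      using subsetD[OF N[of "Suc k"] f] k by auto
    \<comment> \<open>In f = m + r X_0 the cofactor r need not be a form. Comparing components of
      degree k + 1 replaces it by its component of degree k, and m by an element of I again.\<close>
    have "f = hcomp (Suc k) (m + var 0 * r)"
      using hcomp_form[OF f, of "Suc k"] mr(1) by (simp add: mult.commute)
    then have "f - var 0 * hcomp k r = hcomp (Suc k) m"
      by (simp add: hcomp_add hcomp_form_mult[OF v mr(3)])
    then show ?thesis
      using graded_idealD(2)[OF graded mr(2)] hcomp_forms[OF mr(3)] by metis
  qed
  then show ?thesis by blast
qed

end

section \<open>Linear algebra in the homogeneous components\<close>

context affine_scheme
begin

abbreviation "R \<equiv> coord_ring n I"
definition "cls f = I +>\<^bsub>poly_ring n\<^esub> f"

lemma cring_R: "cring R"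
  unfolding coord_ring_def by (rule ideal.quotient_is_cring[OF ideal poly_ring_cring])

sublocale R: cring R
  by (rule cring_R)

lemma cls_hom: "cls \<in> ring_hom (poly_ring n) R"
  using ideal.rcos_ring_hom[OF ideal] unfolding cls_def[abs_def] coord_ring_def by simp

lemma cls_closed [simp]: "f \<in> carrier (poly_ring n) \<Longrightarrow> cls f \<in> carrier R"
  by (rule ring_hom_closed[OF cls_hom])

lemma cls_add:
  "f \<in> carrier (poly_ring n) \<Longrightarrow> g \<in> carrier (poly_ring n) \<Longrightarrow> cls (f + g) = cls f \<oplus>\<^bsub>R\<^esub> cls g"
  using ring_hom_add[OF cls_hom] by simp

lemma cls_mult:
  "f \<in> carrier (poly_ring n) \<Longrightarrow> g \<in> carrier (poly_ring n) \<Longrightarrow> cls (f * g) = cls f \<otimes>\<^bsub>R\<^esub> cls g"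
  using ring_hom_mult[OF cls_hom] by simp

lemma cls_one: "cls 1 = \<one>\<^bsub>R\<^esub>"
  using ring_hom_one[OF cls_hom] by simp

lemma carrier_R: "carrier R = cls ` carrier (poly_ring n)"
  by (auto simp: coord_ring_def cls_def FactRing_def A_RCOSETS_def RCOSETS_def a_r_coset_def)

lemma cls_eq_iff:
  "f \<in> carrier (poly_ring n) \<Longrightarrow> g \<in> carrier (poly_ring n) \<Longrightarrow> cls f = cls g \<longleftrightarrow> f - g \<in> I"
  using ring.quotient_eq_iff_same_a_r_cos[OF cring.axioms(1)[OF poly_ring_cring] ideal]
  by (simp add: cls_def poly_ring_minus)

lemma cls_zero: "cls 0 = \<zero>\<^bsub>R\<^esub>"
proof -
  have "cls 0 = cls 0 \<oplus>\<^bsub>R\<^esub> cls 0"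
    using cls_add[OF poly_ring_closed(1) poly_ring_closed(1)] by simp
  moreover have "cls 0 \<in> carrier R" by (rule cls_closed[OF poly_ring_closed(1)])
  ultimately show ?thesis using R.add.r_cancel_one'[of "cls 0" "cls 0"] by simp
qed

lemma cls_zero_iff: "f \<in> carrier (poly_ring n) \<Longrightarrow> cls f = \<zero>\<^bsub>R\<^esub> \<longleftrightarrow> f \<in> I"
  using cls_eq_iff[OF _ poly_ring_closed(1), of f] cls_zero by simp

abbreviation "K \<equiv> coord_const n I"

lemma const_closed [simp]: "const c \<in> carrier (poly_ring n)"
  by (rule formsD[OF forms_const])

lemma K_eq: "K = (\<lambda>c. cls (const c)) ` UNIV"
  by (simp add: coord_const_def cls_def)

lemma coord_part_eq: "coord_part n I k = cls ` forms n k"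
  by (simp add: coord_part_def cls_def[abs_def])

lemma const_in_iff: "const c \<in> I \<longleftrightarrow> c = 0"
proof
  assume c: "const c \<in> I"
  show "c = 0"
  proof (rule ccontr)
    assume "c \<noteq> 0"
    then have "const (inverse c) * const c = (1 :: 'k mpoly)"
      by (simp add: const_arith(4)[symmetric] const_arith(2))
    then show False using I(4)[OF const_closed c, of "inverse c"] one_notin by simp
  qed
qed (use I(2) in \<open>simp add: const_arith\<close>)

text \<open>\<open>hilbert_fun\<close> measures dimension over the image of the constants, so vector
  space arguments require this image to be a subfield. Its units are images of nonzero constants,
  and 1 outside I separates them from zero.\<close>

lemma K_subfield: "subfield K R"
proof (rule R.subfieldI)
  have "subring K R"
  proof (rule R.subringI)
    show "K \<subseteq> carrier R" by (auto simp: K_eq)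
    show "\<one>\<^bsub>R\<^esub> \<in> K" using cls_one by (auto simp: K_eq const_arith(2)[symmetric])
    fix h assume "h \<in> K"
    then obtain a where a: "h = cls (const a)" by (auto simp: K_eq)
    have "cls (const (- a)) \<oplus>\<^bsub>R\<^esub> h = \<zero>\<^bsub>R\<^esub>"
      by (simp add: a cls_add[symmetric] const_arith(3)[symmetric] const_arith(1) cls_zero)
    then have "\<ominus>\<^bsub>R\<^esub> h = cls (const (- a))"
      by (rule R.minus_equality) (simp_all add: a)
    then show "\<ominus>\<^bsub>R\<^esub> h \<in> K" by (auto simp: K_eq)
    fix h' assume "h' \<in> K"
    then obtain b where b: "h' = cls (const b)" by (auto simp: K_eq)
    show "h \<otimes>\<^bsub>R\<^esub> h' \<in> K" "h \<oplus>\<^bsub>R\<^esub> h' \<in> K"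
      by (auto simp: a b K_eq cls_add[symmetric] cls_mult[symmetric] const_arith(3,4)[symmetric])
  qed
  then show "subcring K R" by (rule R.subcringI')
  show "Units (R\<lparr>carrier := K\<rparr>) = K - {\<zero>\<^bsub>R\<^esub>}"
  proof (rule equalityI; rule subsetI)
    fix u assume "u \<in> Units (R\<lparr>carrier := K\<rparr>)"
    then obtain v where uv: "u \<in> K" "v \<in> K" "v \<otimes>\<^bsub>R\<^esub> u = \<one>\<^bsub>R\<^esub>" by (auto simp: Units_def)
    have "u \<noteq> \<zero>\<^bsub>R\<^esub>"
    proof
      assume "u = \<zero>\<^bsub>R\<^esub>"
      then have "\<one>\<^bsub>R\<^esub> = \<zero>\<^bsub>R\<^esub>" using uv by (auto simp: K_eq)
      then show False using one_notin cls_zero_iff[of 1] by (auto simp: cls_one)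
    qed
    then show "u \<in> K - {\<zero>\<^bsub>R\<^esub>}" using uv by blast
  next
    fix u assume "u \<in> K - {\<zero>\<^bsub>R\<^esub>}"
    then obtain a where a: "u = cls (const a)" "u \<noteq> \<zero>\<^bsub>R\<^esub>" unfolding K_eq by blast
    have "a \<noteq> 0"
    proof
      assume "a = 0"
      then have "u = cls 0" by (simp only: a(1) const_arith(1))
      then show False using a(2) cls_zero by metis
    qed
    then have inv: "cls (const (inverse a)) \<otimes>\<^bsub>R\<^esub> u = \<one>\<^bsub>R\<^esub>" "u \<otimes>\<^bsub>R\<^esub> cls (const (inverse a)) = \<one>\<^bsub>R\<^esub>"
      unfolding a(1) cls_mult[OF const_closed const_closed, symmetric] const_arith(4)[symmetric]
      by (simp_all add: const_arith(2) cls_one)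
    have "u \<in> K" "cls (const (inverse a)) \<in> K"
      unfolding a(1) K_eq by (rule rangeI)+
    with inv show "u \<in> Units (R\<lparr>carrier := K\<rparr>)"
      unfolding Units_def by (intro CollectI conjI bexI[of _ "cls (const (inverse a))"]) simp_all
  qed
qed

end

section \<open>Linear combinations of polynomials modulo an ideal\<close>

lemma list_subset_image: "set ys \<subseteq> f ` A \<Longrightarrow> \<exists>xs. set xs \<subseteq> A \<and> ys = map f xs"
proof (induction ys)
  case (Cons y ys)
  then obtain x xs where "x \<in> A" "y = f x" "set xs \<subseteq> A" "ys = map f xs" by auto
  then show ?case by (intro exI[of _ "x # xs"]) simp
qed simp

text \<open>The counterpart of \<open>combine\<close> on representatives in P. Lists are used
  because bases and independence over a subfield are formulated for lists.\<close>

definition lincomb :: "'k::field list \<Rightarrow> 'k mpoly list \<Rightarrow> 'k mpoly" where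
  "lincomb cs fs = (\<Sum>(c, f)\<leftarrow>zip cs fs. const c * f)"

lemma lincomb_simps [simp]:
  "lincomb [] fs = 0" "lincomb cs [] = 0"
  "lincomb (c # cs) (f # fs) = const c * f + lincomb cs fs"
  by (simp_all add: lincomb_def)

text \<open>Independence of residue classes, expressed on representatives so that one list of
  polynomials can be tested against both I and J.\<close>

definition indep_mod :: "'k::field mpoly set \<Rightarrow> 'k mpoly list \<Rightarrow> bool" where
  "indep_mod I fs \<longleftrightarrow> (\<forall>cs. length cs = length fs \<longrightarrow> lincomb cs fs \<in> I \<longrightarrow> set cs \<subseteq> {0})"

lemma lincomb_forms: "set fs \<subseteq> forms n k \<Longrightarrow> lincomb cs fs \<in> forms n k"
proof (induction cs fs rule: list_induct2')
  case (4 c cs f fs)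
  then show ?case by (simp add: forms_add forms_const_mult)
qed (simp_all add: forms_zero)

lemma lincomb_append:
  "length cs = length fs \<Longrightarrow> lincomb (cs @ ds) (fs @ gs) = lincomb cs fs + lincomb ds gs"
  by (simp add: lincomb_def)

lemma lincomb_map_mult: "lincomb cs (map ((*) p) fs) = p * lincomb cs fs"
  by (induction cs fs rule: list_induct2') (simp_all add: algebra_simps)

lemma lincomb_mem:
  assumes "ideal J (poly_ring n)" "set fs \<subseteq> J"
  shows "lincomb cs fs \<in> J"
  using assms(2)
proof (induction cs fs rule: list_induct2')
  case (4 c cs f fs)
  then show ?case
    using poly_idealD(3,4)[OF assms(1)] formsD[OF forms_const[of c n]] by simp
qed (simp_all add: poly_idealD(2)[OF assms(1)])

definition monomials :: "nat \<Rightarrow> nat \<Rightarrow> (nat \<Rightarrow>\<^sub>0 nat) set" where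
  "monomials n k = {m. mon_deg m = k \<and> Poly_Mapping.keys m \<subseteq> {..n}}"

lemma finite_monomials: "finite (monomials n k)"
proof (induction k)
  case 0
  have "monomials n 0 \<subseteq> {0}"
    by (auto simp: monomials_def mon_deg_def poly_mapping_eq_iff fun_eq_iff in_keys_iff)
  then show ?case by (rule finite_subset) simp
next
  case (Suc k)
  have "monomials n (Suc k) \<subseteq> (\<lambda>(m, j). m + Poly_Mapping.single j 1) ` (monomials n k \<times> {..n})"
  proof
    fix m assume "m \<in> monomials n (Suc k)"
    then obtain j m' where "j \<le> n" "m = m' + Poly_Mapping.single j 1" "mon_deg m' = k"
      "Poly_Mapping.keys m' \<subseteq> {..n}"
      using monomial_factor[of m k n] by (auto simp: monomials_def)
    then show "m \<in> (\<lambda>(m, j). m + Poly_Mapping.single j 1) ` (monomials n k \<times> {..n})"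
      by (intro image_eqI[of _ _ "(m', j)"]) (auto simp: monomials_def)
  qed
  then show ?case
    by (rule finite_subset) (intro finite_imageI finite_cartesian_product Suc finite_atMost)
qed

context affine_scheme
begin

lemma combine_cls:
  assumes "set fs \<subseteq> carrier (poly_ring n)"
  shows "R.combine (map (\<lambda>c. cls (const c)) cs) (map cls fs) = cls (lincomb cs fs) \<and>
    lincomb cs fs \<in> carrier (poly_ring n)"
  using assms
proof (induction cs fs rule: list_induct2')
  case (4 c cs f fs)
  have "const c * f \<in> carrier (poly_ring n)" using 4 by auto
  then show ?case using 4 by (auto simp: cls_add cls_mult)
qed (auto simp: cls_zero)

lemma scalar_list:
  assumes "set Ks \<subseteq> K" obtains cs where "Ks = map (\<lambda>c. cls (const c)) cs"
proof -
  have "set Ks \<subseteq> (\<lambda>c. cls (const c)) ` UNIV" using assms by (simp only: K_eq)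
  from list_subset_image[OF this] show ?thesis using that by blast
qed

lemma independent_iff:
  assumes fs: "set fs \<subseteq> carrier (poly_ring n)"
  shows "R.independent K (map cls fs) \<longleftrightarrow> indep_mod I fs"
proof
  have z: "cls (const c) = \<zero>\<^bsub>R\<^esub> \<longleftrightarrow> c = 0" for c
    by (simp add: cls_zero_iff const_in_iff)
  have sub: "set (map cls fs) \<subseteq> carrier R" using fs by auto
  {
    assume ind: "R.independent K (map cls fs)"
    show "indep_mod I fs"
      unfolding indep_mod_def
    proof (intro allI impI)
      fix cs assume len: "length cs = length fs" and mem: "lincomb cs fs \<in> I"
      have "R.combine (map (\<lambda>c. cls (const c)) cs) (map cls fs) = \<zero>\<^bsub>R\<^esub>"
        using combine_cls[OF fs, of cs] cls_zero_iff mem by simp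
      moreover have "set (map (\<lambda>c. cls (const c)) cs) \<subseteq> K" by (auto simp: K_eq)
      ultimately have "set (take (length (map cls fs)) (map (\<lambda>c. cls (const c)) cs)) \<subseteq> {\<zero>\<^bsub>R\<^esub>}"
        using R.independent_imp_trivial_combine[OF K_subfield ind] by blast
      then show "set cs \<subseteq> {0}" using len z by auto
    qed
  }
  {
    assume ind: "indep_mod I fs"
    show "R.independent K (map cls fs)"
    proof (rule R.trivial_combine_imp_independent[OF K_subfield sub])
      fix Ks assume Ks: "set Ks \<subseteq> K" and zero: "R.combine Ks (map cls fs) = \<zero>\<^bsub>R\<^esub>"
      obtain cs where cs: "Ks = map (\<lambda>c. cls (const c)) cs" using scalar_list[OF Ks] .
      have mem: "lincomb cs fs \<in> I"
        using combine_cls[OF fs, of cs] cls_zero_iff zero by (simp add: cs)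
      \<comment> \<open>Independence in R quantifies over coefficient lists of any length,
        \<open>indep_mod\<close> only over those of matching length. Truncating or padding with
        zeros leaves the combination unchanged.\<close>
      define ds where "ds = take (length fs) cs @ replicate (length fs - length cs) 0"
      have len: "length ds = length fs" by (auto simp: ds_def)
      have "lincomb ds fs = lincomb cs fs"
      proof -
        have "lincomb (take (length fs) cs @ replicate m 0) fs = lincomb cs fs" for m
          by (induction cs fs rule: list_induct2')
            (auto simp: lincomb_def const_arith zip_replicate1 o_def case_prod_unfold sum_list_0)
        then show ?thesis by (simp add: ds_def)
      qed
      then have "set ds \<subseteq> {0}" using ind mem len by (simp add: indep_mod_def)
      then have "set (take (length fs) cs) \<subseteq> {0}" by (auto simp: ds_def)
      then show "set (take (length (map cls fs)) Ks) \<subseteq> {\<zero>\<^bsub>R\<^esub>}"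
        unfolding cs take_map length_map set_map using z by (auto simp only: image_subset_iff)
    qed
  }
qed

text \<open>The finitely many monomials of degree k span the component, so it is finite-dimensional
  and \<open>hilbert_fun\<close> really is its dimension.\<close>

lemma coord_part_dimension: "R.dimension (hilbert_fun n I k) K (coord_part n I k)"
proof -
  obtain ms where ms: "set ms = monomials n k"
    using finite_list[OF finite_monomials] by blast
  define Us where "Us = map (\<lambda>m. cls (Poly_Mapping.single m (1::'k))) ms"
  have mono: "Poly_Mapping.single m (1::'k) \<in> forms n k" if "m \<in> monomials n k" for m
    using that by (auto simp: monomials_def forms_def poly_ring_carrier)
  have Us: "set Us \<subseteq> carrier R" using formsD[OF mono] by (auto simp: Us_def ms)
  have Us': "set Us \<subseteq> coord_part n I k" using mono by (auto simp: Us_def ms coord_part_eq)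
  note sp = R.Span_subgroup_props[OF K_subfield Us]
  have "R.Span K Us = coord_part n I k"
  proof (rule equalityI)
    show "R.Span K Us \<subseteq> coord_part n I k"
    proof (rule R.Span_min[OF K_subfield Us])
      show "subgroup (coord_part n I k) (add_monoid R)"
      proof (rule R.add.subgroupI)
        show "coord_part n I k \<subseteq> carrier R"
          unfolding coord_part_eq by (rule image_subsetI) (rule cls_closed[OF formsD])
        show "coord_part n I k \<noteq> {}" using forms_zero by (auto simp: coord_part_eq)
        fix a assume "a \<in> coord_part n I k"
        then obtain f where f: "f \<in> forms n k" "a = cls f" by (auto simp: coord_part_eq)
        have "cls (- f) \<oplus>\<^bsub>R\<^esub> a = \<zero>\<^bsub>R\<^esub>"
          using formsD[OF f(1)] formsD[OF forms_neg[OF f(1)]]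
          by (simp add: f(2) cls_add[symmetric] cls_zero)
        then have "\<ominus>\<^bsub>R\<^esub> a = cls (- f)"
          by (rule R.minus_equality)
            (simp_all add: f(2) formsD[OF f(1)] formsD[OF forms_neg[OF f(1)]])
        then show "\<ominus>\<^bsub>R\<^esub> a \<in> coord_part n I k"
          using forms_neg[OF f(1)] by (simp add: coord_part_eq)
        fix b assume "b \<in> coord_part n I k"
        then obtain g where g: "g \<in> forms n k" "b = cls g" by (auto simp: coord_part_eq)
        have "a \<oplus>\<^bsub>R\<^esub> b = cls (f + g)"
          using formsD[OF f(1)] formsD[OF g(1)] by (simp add: f(2) g(2) cls_add)
        then show "a \<oplus>\<^bsub>R\<^esub> b \<in> coord_part n I k"
          using forms_add[OF f(1) g(1)] by (simp add: coord_part_eq)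
      qed
      show "K <#>\<^bsub>R\<^esub> set Us \<subseteq> coord_part n I k"
      proof
        fix u assume "u \<in> K <#>\<^bsub>R\<^esub> set Us"
        then obtain c m where cm: "u = cls (const c) \<otimes>\<^bsub>R\<^esub> cls (Poly_Mapping.single m 1)"
          "m \<in> monomials n k"
          by (auto simp: set_mult_def K_eq Us_def ms)
        have "u = cls (const c * Poly_Mapping.single m 1)"
          using cm formsD[OF mono] by (simp add: cls_mult)
        then show "u \<in> coord_part n I k"
          using forms_const_mult[OF mono[OF cm(2)]] by (auto simp: coord_part_eq)
      qed
    qed
    show "coord_part n I k \<subseteq> R.Span K Us"
    proof
      fix u assume "u \<in> coord_part n I k"
      then obtain f where f: "f \<in> forms n k" "u = cls f" by (auto simp: coord_part_eq)
      have sub: "Poly_Mapping.keys f \<subseteq> monomials n k"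
        using f(1) by (auto simp: forms_def monomials_def poly_ring_carrier)
      have "cls (\<Sum>m\<in>A. Poly_Mapping.single m (Poly_Mapping.lookup f m)) \<in> R.Span K Us \<and>
        (\<Sum>m\<in>A. Poly_Mapping.single m (Poly_Mapping.lookup f m)) \<in> carrier (poly_ring n)"
        if "finite A" "A \<subseteq> monomials n k" for A
        using that
      proof (induction A)
        case empty
        then show ?case using sp(2) by (auto simp: cls_zero)
      next
        case (insert m A)
        let ?c = "Poly_Mapping.lookup f m"
        have eq: "Poly_Mapping.single m ?c = const ?c * Poly_Mapping.single m 1"
          by (simp add: const_def mult_single)
        have m: "m \<in> monomials n k" using insert by blast
        then have "cls (Poly_Mapping.single m 1) \<in> R.Span K Us"
          using R.Span_base_incl[OF K_subfield Us] by (auto simp: Us_def ms)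
        then have "cls (const ?c) \<otimes>\<^bsub>R\<^esub> cls (Poly_Mapping.single m 1) \<in> R.Span K Us"
          by (intro R.Span_smult_closed[OF K_subfield Us]) (auto simp: K_eq)
        then have s: "cls (Poly_Mapping.single m ?c) \<in> R.Span K Us"
          unfolding eq using formsD[OF mono[OF m]] by (simp add: cls_mult)
        have c: "Poly_Mapping.single m ?c \<in> carrier (poly_ring n)"
          unfolding eq by (rule formsD[OF forms_const_mult[OF mono[OF m]]])
        show ?case
          using insert s c sp(3) by (simp add: cls_add poly_ring_closed(3))
      qed
      from this[OF finite_keys sub] show "u \<in> R.Span K Us"
        using poly_sum_monomials[of f] f(2) by simp
    qed
  qed
  then have "R.finite_dimension K (coord_part n I k)"
    using R.Span_finite_dimension[OF K_subfield Us] by simp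
  from R.finite_dimensionE[OF K_subfield this] show ?thesis
    by (simp add: hilbert_fun_def over_def)
qed

lemma indep_mod_length_le:
  assumes "set fs \<subseteq> forms n k" "indep_mod I fs"
  shows "length fs \<le> hilbert_fun n I k"
proof -
  have "set fs \<subseteq> carrier (poly_ring n)" using assms(1) formsD by fast
  then have "R.independent K (map cls fs)" using independent_iff assms(2) by blast
  moreover have "set (map cls fs) \<subseteq> coord_part n I k" using assms(1) by (auto simp: coord_part_eq)
  ultimately show ?thesis
    using R.independent_length_le_dimension[OF K_subfield coord_part_dimension] by fastforce
qed

lemma indep_mod_spans:
  assumes fs: "set fs \<subseteq> forms n k" "indep_mod I fs" and len: "length fs = hilbert_fun n I k"
    and g: "g \<in> forms n k"
  obtains cs where "g - lincomb cs fs \<in> I"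
proof -
  have c: "set fs \<subseteq> carrier (poly_ring n)" using fs(1) formsD by fast
  then have "R.independent K (map cls fs)" using independent_iff fs(2) by blast
  moreover have "set (map cls fs) \<subseteq> coord_part n I k" using fs(1) by (auto simp: coord_part_eq)
  ultimately have "R.Span K (map cls fs) = coord_part n I k"
    using R.independent_length_eq_dimension[OF K_subfield coord_part_dimension[of k]] len
    by (metis length_map)
  then have "cls g \<in> R.Span K (map cls fs)" using g by (auto simp: coord_part_eq)
  moreover have "set (map cls fs) \<subseteq> carrier R" using c by auto
  ultimately obtain Ks where Ks: "set Ks \<subseteq> K" "cls g = R.combine Ks (map cls fs)"
    using R.Span_eq_combine_set[OF K_subfield] by blast
  obtain cs where cs: "Ks = map (\<lambda>c. cls (const c)) cs" using scalar_list[OF Ks(1)] .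
  have "g - lincomb cs fs \<in> I"
    using combine_cls[OF c, of cs] Ks(2) cls_eq_iff[OF formsD[OF g]] by (simp add: cs)
  then show ?thesis by (rule that)
qed

lemma hilbert_basis:
  obtains fs where "set fs \<subseteq> forms n k" "indep_mod I fs" "length fs = hilbert_fun n I k"
proof -
  obtain Us where Us: "set Us \<subseteq> carrier R" "R.independent K Us" "length Us = hilbert_fun n I k"
    "R.Span K Us = coord_part n I k"
    using R.exists_base[OF K_subfield coord_part_dimension] by metis
  have "set Us \<subseteq> cls ` forms n k"
    using R.Span_base_incl[OF K_subfield Us(1)] Us(4) by (simp add: coord_part_eq)
  then obtain fs where fs: "set fs \<subseteq> forms n k" "Us = map cls fs"
    using list_subset_image[of Us cls] by blast
  have "set fs \<subseteq> carrier (poly_ring n)" using fs(1) formsD by fast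
  then show ?thesis using that fs Us independent_iff by simp
qed

end

section \<open>Hilbert functions of a scheme and a subscheme\<close>

lemma indep_mod_mult:
  assumes "indep_mod I fs" "\<And>cs. p * lincomb cs fs \<in> I \<Longrightarrow> lincomb cs fs \<in> I"
  shows "indep_mod I (map ((*) p) fs)"
  unfolding indep_mod_def
proof (intro allI impI)
  fix cs assume "length cs = length (map ((*) p) fs)" "lincomb cs (map ((*) p) fs) \<in> I"
  then show "set cs \<subseteq> {0}"
    using assms(1) assms(2)[of cs] by (simp add: lincomb_map_mult indep_mod_def)
qed

context affine_scheme
begin

text \<open>Cancellation of X_0 is available for forms, which suffices here because a combination of
  forms of one degree is again a form.\<close>

lemma indep_mod_var0_power:
  assumes fs: "set fs \<subseteq> forms n k" "indep_mod I fs"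
  shows "indep_mod I (map ((*) (var 0 ^ e)) fs)"
    and "set (map ((*) (var 0 ^ e)) fs) \<subseteq> forms n (e + k)"
proof -
  show "indep_mod I (map ((*) (var 0 ^ e)) fs)"
    by (rule indep_mod_mult[OF fs(2) var0_power_nonzerodivisor_form[OF lincomb_forms[OF fs(1)]]])
  show "set (map ((*) (var 0 ^ e)) fs) \<subseteq> forms n (e + k)"
    using fs(1) forms_mult[OF forms_var_power[of 0 n e]] by auto
qed

lemma hilbert_fun_Suc: "hilbert_fun n I k \<le> hilbert_fun n I (Suc k)"
proof -
  obtain fs where fs: "set fs \<subseteq> forms n k" "indep_mod I fs" "length fs = hilbert_fun n I k"
    by (rule hilbert_basis)
  show ?thesis
    using indep_mod_length_le[OF _ indep_mod_var0_power(1)[OF fs(1,2), of 1], of "Suc k"]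
      indep_mod_var0_power(2)[OF fs(1,2), of 1] fs(3) by simp
qed

text \<open>In large degree each member of a basis in degree k + 1 is X_0 times a form of degree k
  modulo I. These quotients stay independent: X_0 times a relation among them is a relation among
  the basis.\<close>

lemma hilbert_fun_eventually_decreasing: "\<exists>N. \<forall>k\<ge>N. hilbert_fun n I (Suc k) \<le> hilbert_fun n I k"
proof -
  obtain N where N: "\<And>k f. k \<ge> N \<Longrightarrow> f \<in> forms n (Suc k) \<Longrightarrow> \<exists>g\<in>forms n k. f - var 0 * g \<in> I"
    using eventually_divisible_by_var0 by blast
  have "hilbert_fun n I (Suc k) \<le> hilbert_fun n I k" if k: "k \<ge> N" for k
  proof -
    obtain fs where fs: "set fs \<subseteq> forms n (Suc k)" "indep_mod I fs"
      "length fs = hilbert_fun n I (Suc k)"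
      by (rule hilbert_basis)
    have "\<exists>g. g \<in> forms n k \<and> f - var 0 * g \<in> I" if "f \<in> set fs" for f
      using N[OF k] that fs(1) by blast
    then obtain q where q: "\<And>f. f \<in> set fs \<Longrightarrow> q f \<in> forms n k \<and> f - var 0 * q f \<in> I" by metis
    \<comment> \<open>Stated for lists hs with members among those of fs, so that the induction can
      run through the tails.\<close>
    have eq: "lincomb cs hs - var 0 * lincomb cs (map q hs) \<in> I" if "set hs \<subseteq> set fs" for cs hs
      using that
    proof (induction cs hs rule: list_induct2')
      case (4 c cs h hs)
      have "const c * (h - var 0 * q h) \<in> I" using q[of h] 4 by (intro I(4)) auto
      moreover have "lincomb cs hs - var 0 * lincomb cs (map q hs) \<in> I" using 4 by simp
      ultimately have "const c * (h - var 0 * q h) + (lincomb cs hs - var 0 * lincomb cs (map q hs)) \<in> I"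
        by (rule I(3))
      then show ?case by (simp add: algebra_simps)
    qed (simp_all add: I(2))
    have qs: "set (map q fs) \<subseteq> forms n k" using q by auto
    have "indep_mod I (map q fs)"
      unfolding indep_mod_def
    proof (intro allI impI)
      fix cs assume len: "length cs = length (map q fs)" and mem: "lincomb cs (map q fs) \<in> I"
      have "var 0 * lincomb cs (map q fs) \<in> I" by (rule I(4)[OF var_closed[OF le0] mem])
      from I(3)[OF eq[OF order_refl, of cs] this] have "lincomb cs fs \<in> I" by simp
      then show "set cs \<subseteq> {0}" using fs(2) len by (simp add: indep_mod_def)
    qed
    then show ?thesis using indep_mod_length_le[OF qs] fs(3) by simp
  qed
  then show ?thesis by blast
qed

text \<open>Monotone everywhere and eventually nonincreasing means eventually constant. Only with
  this does the definite description in \<open>scheme_deg\<close> denote the expected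
  number.\<close>

lemma hilbert_fun_eventually: "\<exists>N. \<forall>k\<ge>N. hilbert_fun n I k = scheme_deg n I"
proof -
  obtain N where N: "\<And>k. k \<ge> N \<Longrightarrow> hilbert_fun n I (Suc k) \<le> hilbert_fun n I k"
    using hilbert_fun_eventually_decreasing by blast
  have const: "hilbert_fun n I k = hilbert_fun n I N" if "k \<ge> N" for k
    using that
  proof (induction k rule: dec_induct)
    case (step k)
    then show ?case using N[of k] hilbert_fun_Suc[of k] by simp
  qed simp
  have "scheme_deg n I = hilbert_fun n I N"
    unfolding scheme_deg_def
  proof (rule the_equality)
    show "\<exists>M. \<forall>k\<ge>M. hilbert_fun n I k = hilbert_fun n I N" using const by blast
    fix d assume "\<exists>M. \<forall>k\<ge>M. hilbert_fun n I k = d"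
    then obtain M where "\<And>k. k \<ge> M \<Longrightarrow> hilbert_fun n I k = d" by blast
    from this[OF max.cobounded1[of M N]] const[OF max.cobounded2[of N M]] show "d = hilbert_fun n I N" by simp
  qed
  then show ?thesis using const by metis
qed

lemma hilbert_fun_reg_index: "k \<ge> reg_index n I \<Longrightarrow> hilbert_fun n I k = scheme_deg n I"
proof -
  have "\<forall>k\<ge>reg_index n I. hilbert_fun n I k = scheme_deg n I"
    unfolding reg_index_def by (rule LeastI_ex[OF hilbert_fun_eventually])
  then show "k \<ge> reg_index n I \<Longrightarrow> hilbert_fun n I k = scheme_deg n I" by simp
qed

text \<open>The components in degrees k and k + 1 have the same dimension, so X_0 times a basis of
  the first is a basis of the second.\<close>

lemma divisible_by_var0_above_reg_index:
  assumes k: "k \<ge> reg_index n I" and f: "f \<in> forms n (Suc k)"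
  obtains g where "g \<in> forms n k" "f - var 0 * g \<in> I"
proof -
  obtain fs where fs: "set fs \<subseteq> forms n k" "indep_mod I fs" "length fs = hilbert_fun n I k"
    by (rule hilbert_basis)
  let ?gs = "map ((*) (var 0 ^ 1)) fs"
  have "length ?gs = hilbert_fun n I (Suc k)"
    using fs(3) hilbert_fun_reg_index[of k] hilbert_fun_reg_index[of "Suc k"] k by simp
  then obtain cs where "f - lincomb cs ?gs \<in> I"
    using indep_mod_spans[OF _ indep_mod_var0_power(1)[OF fs(1,2), of 1] _ f]
      indep_mod_var0_power(2)[OF fs(1,2), of 1] by auto
  then have "f - var 0 * lincomb cs fs \<in> I" by (simp add: lincomb_map_mult)
  then show ?thesis using that lincomb_forms[OF fs(1)] by blast
qed

end

section \<open>Initial degree and components of I_Y / I_X\<close>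

locale affine_subscheme = affine_scheme n I + Y: affine_scheme n J
  for n and I J :: "'k::field mpoly set" +
  assumes subscheme: "I \<subset> J"
begin

lemma I_subset: "I \<subseteq> J"
  using subscheme by blast

lemma rel_ideal_eq: "rel_ideal n I J = cls ` J"
  by (simp add: rel_ideal_def cls_def[abs_def])

lemma cls_mem_rel_ideal: "f \<in> carrier (poly_ring n) \<Longrightarrow> cls f \<in> rel_ideal n I J \<longleftrightarrow> f \<in> J"
proof
  assume f: "f \<in> carrier (poly_ring n)" and "cls f \<in> rel_ideal n I J"
  then obtain g where g: "g \<in> J" "cls f = cls g" by (auto simp: rel_ideal_eq)
  then have "f - g \<in> J" using cls_eq_iff[OF f, of g] Y.I(1) I_subset by blast
  then have "(f - g) + g \<in> J" using g(1) by (intro Y.I(3))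
  then show "f \<in> J" by simp
qed (auto simp: rel_ideal_eq)

text \<open>The intersection always contains zero, so being different from {0} amounts to having a
  nonzero element. This reduces \<open>init_deg\<close> to forms in J outside I.\<close>

lemma rel_part_nontrivial_iff:
  "rel_ideal n I J \<inter> coord_part n I k \<noteq> {\<zero>\<^bsub>R\<^esub>} \<longleftrightarrow> (\<exists>f\<in>forms n k. f \<in> J \<and> f \<notin> I)"
proof -
  have "\<zero>\<^bsub>R\<^esub> \<in> rel_ideal n I J \<inter> coord_part n I k"
    using imageI[OF Y.I(2), of cls] imageI[OF forms_zero, of cls]
    by (simp add: rel_ideal_eq coord_part_eq cls_zero)
  then have "rel_ideal n I J \<inter> coord_part n I k \<noteq> {\<zero>\<^bsub>R\<^esub>} \<longleftrightarrow>
      (\<exists>u\<in>coord_part n I k. u \<in> rel_ideal n I J \<and> u \<noteq> \<zero>\<^bsub>R\<^esub>)" by blast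
  also have "\<dots> \<longleftrightarrow> (\<exists>f\<in>forms n k. f \<in> J \<and> f \<notin> I)"
    by (simp add: coord_part_eq cls_mem_rel_ideal[OF formsD] cls_zero_iff[OF formsD] cong: bex_cong)
  finally show ?thesis .
qed

lemma init_deg_eq: "init_deg n I J = (LEAST k. \<exists>f\<in>forms n k. f \<in> J \<and> f \<notin> I)"
  by (simp add: init_deg_def rel_part_nontrivial_iff)

text \<open>An element of J outside I has a component outside I, and this component still lies in J.
  Hence the set behind \<open>LEAST\<close> is nonempty.\<close>

lemma init_deg_witness: "\<exists>f\<in>forms n (init_deg n I J). f \<in> J \<and> f \<notin> I"
proof -
  obtain p where p: "p \<in> J" "p \<notin> I" using subscheme by blast
  obtain N where N: "p = (\<Sum>k\<le>N. hcomp k p)" using hcomp_decomposition by blast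
  have "\<exists>k. hcomp k p \<notin> I"
  proof (rule ccontr)
    assume "\<not> ?thesis"
    then have "(\<Sum>k\<le>N. hcomp k p) \<in> I" by (intro poly_ideal_sum[OF ideal]) blast
    then show False using N p(2) by simp
  qed
  then have "\<exists>k. \<exists>f\<in>forms n k. f \<in> J \<and> f \<notin> I"
    using hcomp_forms[OF subsetD[OF Y.I(1) p(1)]] graded_idealD(2)[OF Y.graded p(1)] by blast
  then show ?thesis unfolding init_deg_eq by (rule LeastI_ex)
qed

lemma init_deg_le: "f \<in> forms n k \<Longrightarrow> f \<in> J \<Longrightarrow> f \<notin> I \<Longrightarrow> init_deg n I J \<le> k"
  unfolding init_deg_eq by (rule Least_le) blast

text \<open>A form of degree 0 is a constant, and J contains no nonzero constant. Positivity keeps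
  the Euler factor from being zero for trivial reasons.\<close>

lemma init_deg_pos: "init_deg n I J > 0"
proof (rule ccontr)
  assume "\<not> ?thesis"
  then obtain f where f: "f \<in> forms n 0" "f \<in> J" "f \<notin> I" using init_deg_witness by auto
  then obtain c where c: "f = const c" using forms_zero_degree by blast
  then have "c = 0" using f(2) Y.const_in_iff by simp
  then show False using c f(3) I(2) by (simp add: const_arith)
qed

text \<open>Otherwise a form of initial degree would be X_0 g modulo I. Cancelling X_0 modulo J puts
  g into J, and g stays outside I, so g would witness a smaller degree.\<close>

lemma init_deg_le_reg_index: "init_deg n I J \<le> reg_index n I"
proof (rule ccontr)
  assume "\<not> ?thesis"
  then obtain k where k: "init_deg n I J = Suc k" "k \<ge> reg_index n I"
    by (metis Suc_le_D not_less_eq_eq Suc_le_mono)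
  then obtain f where f: "f \<in> forms n (Suc k)" "f \<in> J" "f \<notin> I" using init_deg_witness by auto
  obtain g where g: "g \<in> forms n k" "f - var 0 * g \<in> I"
    using divisible_by_var0_above_reg_index[OF k(2) f(1)] .
  have "f - (f - var 0 * g) \<in> J" by (rule Y.I(7)[OF f(2) subsetD[OF I_subset g(2)]])
  then have "var 0 * g \<in> J" by (simp only: diff_diff_eq2 add_diff_cancel_left')
  then have "g \<in> J" by (rule Y.var0_nonzerodivisor_form[OF g(1)])
  moreover have "g \<notin> I"
  proof
    assume "g \<in> I"
    then have "(f - var 0 * g) + var 0 * g \<in> I"
      using g(2) I(4)[OF var_closed[OF le0]] by (intro I(3))
    then show False using f(3) by simp
  qed
  ultimately show False using init_deg_le[OF g(1)] k(1) by simp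
qed

text \<open>A basis modulo J, extended by forms from J that are independent modulo I, is independent
  modulo I. The difference of the Hilbert functions thus bounds the dimension of the component of J
  / I.\<close>

lemma indep_mod_length_le_diff:
  assumes gs: "set gs \<subseteq> forms n k" "set gs \<subseteq> J" "indep_mod I gs"
  shows "hilbert_fun n J k + length gs \<le> hilbert_fun n I k"
proof -
  obtain fs where fs: "set fs \<subseteq> forms n k" "indep_mod J fs" "length fs = hilbert_fun n J k"
    by (rule Y.hilbert_basis)
  have "indep_mod I (fs @ gs)"
    unfolding indep_mod_def
  proof (intro allI impI)
    fix cs assume len: "length cs = length (fs @ gs)" and mem: "lincomb cs (fs @ gs) \<in> I"
    define as bs where "as = take (length fs) cs" and "bs = drop (length fs) cs"
    have cs: "cs = as @ bs" and la: "length as = length fs" and lb: "length bs = length gs"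
      using len by (simp_all add: as_def bs_def)
    have eq: "lincomb cs (fs @ gs) = lincomb as fs + lincomb bs gs"
      unfolding cs by (rule lincomb_append[OF la])
    \<comment> \<open>Modulo J only the combination of fs survives, which forces its coefficients to
      vanish; the remaining relation among gs is then read modulo I.\<close>
    have "(lincomb as fs + lincomb bs gs) - lincomb bs gs \<in> J"
      using mem I_subset lincomb_mem[OF Y.ideal gs(2)] unfolding eq by (intro Y.I(7)) auto
    then have as0: "set as \<subseteq> {0}" using fs(2) la by (simp add: indep_mod_def)
    have "lincomb as hs = 0" for hs
      using as0 by (induction as hs rule: list_induct2') (auto simp: const_arith)
    then have "lincomb bs gs \<in> I" using mem eq by simp
    then have "set bs \<subseteq> {0}" using gs(3) lb by (simp add: indep_mod_def)
    then show "set cs \<subseteq> {0}" using as0 by (simp add: cs)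
  qed
  then show ?thesis using indep_mod_length_le[of "fs @ gs" k] fs gs(1) by simp
qed

text \<open>Multiplying by a power of the non-zerodivisor \<open>X\<^sub>0\<close> transports independent forms of
  \<open>J / I\<close> into large degrees, where the component of \<open>J / I\<close> is one-dimensional.\<close>

lemma forms_proportional:
  assumes deg: "scheme_deg n J + 1 = scheme_deg n I"
    and u: "u \<in> forms n k" "u \<in> J" "u \<notin> I" and v: "v \<in> forms n k" "v \<in> J"
  shows "\<exists>c. v - const c * u \<in> I"
proof -
  obtain N where N: "\<And>k. k \<ge> N \<Longrightarrow> hilbert_fun n I k = scheme_deg n I"
    using hilbert_fun_eventually by blast
  obtain M where M: "\<And>k. k \<ge> M \<Longrightarrow> hilbert_fun n J k = scheme_deg n J"
    using Y.hilbert_fun_eventually by blast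
  have "\<not> indep_mod I [u, v]"
  proof
    assume ind: "indep_mod I [u, v]"
    \<comment> \<open>In degree e + k both Hilbert functions have reached their final values. These
      differ by one, whereas two independent products would force a gap of two.\<close>
    define e where "e = max M N"
    let ?gs = "map ((*) (var 0 ^ e)) [u, v]"
    have uv: "set [u, v] \<subseteq> forms n k" using u v by simp
    have "set ?gs \<subseteq> J" using Y.I(4)[OF power_closed[OF var_closed[OF le0]]] u(2) v(2) by simp
    then have "hilbert_fun n J (e + k) + length ?gs \<le> hilbert_fun n I (e + k)"
      by (rule indep_mod_length_le_diff[OF indep_mod_var0_power(2)[OF uv ind] _
          indep_mod_var0_power(1)[OF uv ind]])
    then show False using N[of "e + k"] M[of "e + k"] deg by (simp add: e_def)
  qed
  then obtain cs where "length cs = length [u, v]" "lincomb cs [u, v] \<in> I" "\<not> set cs \<subseteq> {0}"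
    unfolding indep_mod_def by blast
  then obtain a b where ab: "const a * u + const b * v \<in> I" "a \<noteq> 0 \<or> b \<noteq> 0"
    by (cases cs; cases "tl cs") auto
  \<comment> \<open>With b = 0 the relation would be a nonzero multiple of u in I, although u lies
    outside I. So the relation can be solved for v.\<close>
  have b: "b \<noteq> 0"
  proof
    assume "b = 0"
    then have au: "const a * u \<in> I" and "a \<noteq> 0" using ab by (auto simp: const_arith)
    have "const (inverse a) * (const a * u) \<in> I" by (rule I(4)[OF const_closed au])
    then have "const (inverse a * a) * u \<in> I" by (simp only: const_arith(4) mult.assoc)
    then show False
      using \<open>a \<noteq> 0\<close> u(3) by (simp add: const_arith(2)) 
  qed
  have "const (inverse b) * (const a * u + const b * v) \<in> I" by (rule I(4)[OF const_closed ab(1)])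
  moreover have "const (inverse b) * (const a * u + const b * v) =
      v - const (- (inverse b * a)) * u"
    using b by (simp add: distrib_left mult.assoc[symmetric] const_arith(4)[symmetric] const_arith(2,5))
  ultimately show ?thesis by (intro exI[of _ "- (inverse b * a)"]) simp
qed

lemma separator_multiples:
  assumes deg: "scheme_deg n J + 1 = scheme_deg n I"
    and f: "f \<in> forms n (init_deg n I J)" "f \<in> J" "f \<notin> I" and g: "g \<in> J"
  shows "\<exists>r\<in>carrier (poly_ring n). g - r * f \<in> I"
proof -
  let ?a = "init_deg n I J"
  have hom: "\<exists>r\<in>carrier (poly_ring n). h - r * f \<in> I" if h: "h \<in> forms n k" "h \<in> J" for h k
  proof (cases "h \<in> I")
    case True
    then show ?thesis by (intro bexI[of _ 0]) auto
  next
    case False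
    then have k: "?a \<le> k" using init_deg_le h by blast
    \<comment> \<open>Multiplying f by this power of X_0 gives an element of J in degree k that
      stays outside I, so every form of J in degree k is a constant multiple of it modulo I.\<close>
    define u where "u = var 0 ^ (k - ?a) * f"
    have "u \<in> forms n k"
      using forms_mult[OF forms_var_power[of 0 n "k - ?a"] f(1)] k by (simp add: u_def)
    moreover have "u \<in> J"
      unfolding u_def by (intro Y.I(4) power_closed var_closed f(2)) simp
    moreover have "u \<notin> I"
      using var0_power_nonzerodivisor_form[OF f(1)] f(3) by (auto simp: u_def)
    ultimately obtain c where c: "h - const c * u \<in> I"
      using forms_proportional[OF deg _ _ _ h] by blast
    have "const c * var 0 ^ (k - ?a) \<in> carrier (poly_ring n)"
      by (intro poly_ring_closed const_closed power_closed var_closed) simp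
    moreover have "h - (const c * var 0 ^ (k - ?a)) * f \<in> I"
      using c by (simp add: u_def mult.assoc)
    ultimately show ?thesis by blast
  qed
  have "\<exists>r\<in>carrier (poly_ring n). (\<Sum>k\<le>N. hcomp k g) - r * f \<in> I" for N
  proof (induction N)
    case 0
    show ?case
      using hom[OF hcomp_forms[OF subsetD[OF Y.I(1) g]] graded_idealD(2)[OF Y.graded g], of 0] by simp
  next
    case (Suc N)
    then obtain r where r: "r \<in> carrier (poly_ring n)" "(\<Sum>k\<le>N. hcomp k g) - r * f \<in> I" by blast
    obtain s where s: "s \<in> carrier (poly_ring n)" "hcomp (Suc N) g - s * f \<in> I"
      using hom[OF hcomp_forms[OF subsetD[OF Y.I(1) g]] graded_idealD(2)[OF Y.graded g]] by blast
    have "((\<Sum>k\<le>N. hcomp k g) - r * f) + (hcomp (Suc N) g - s * f) \<in> I"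
      by (rule I(3)[OF r(2) s(2)])
    then show ?case
      using poly_ring_closed(3)[OF r(1) s(1)] by (intro bexI[of _ "r + s"]) (auto simp: algebra_simps)
  qed
  then show ?thesis using hcomp_decomposition[of g] by metis
qed

lemma separator_var_multiple:
  assumes deg: "scheme_deg n J + 1 = scheme_deg n I"
    and f: "f \<in> forms n k" "f \<in> J" "f \<notin> I" and j: "j \<le> n"
  shows "\<exists>c. var j * f - const c * (var 0 * f) \<in> I"
proof (rule forms_proportional[OF deg])
  show "var 0 * f \<in> forms n (1 + k)" "var j * f \<in> forms n (1 + k)"
    using forms_mult[OF forms_var f(1)] j by auto
  show "var 0 * f \<in> J" "var j * f \<in> J" using Y.I(4)[OF var_closed f(2)] j by auto
  show "var 0 * f \<notin> I" using var0_nonzerodivisor_form[OF f(1)] f(3) by blast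
qed

end

section \<open>The differential of the ideal of a subscheme\<close>

lemma finsum_restrict_scalars: "finsum (restrict_scalars h M) = finsum M"
  by (simp add: finsum_def finprod_def fun_eq_iff)

text \<open>Components on both sides are described by coefficients of the differentials of the x_j,
  so compatibility of h with sums of b_j dx_j, together with surjectivity of the projection on
  coefficients, matches the gradings.\<close>

lemma (in quotient_algebra) kaehler_quotient_graded_iso:
  assumes gr: "\<And>k. Rgr k \<subseteq> carrier R" and x: "\<And>j. j \<le> n \<Longrightarrow> x j \<in> carrier R"
  shows "\<exists>h. h \<in> graded_module_iso R
     \<Omega>SR (kaehler_part S (\<pi> ` C) (\<lambda>k. \<pi> ` Rgr k) n (\<lambda>j. \<pi> (x j)))
     Q (\<lambda>k. (\<lambda>w. dI +>\<^bsub>\<Omega>\<^esub> w) ` kaehler_part R C Rgr n x k)"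
proof -
  obtain h where iso: "h \<in> iso (add_monoid \<Omega>SR) (add_monoid Q)" and lin: "linear_map R \<Omega>SR Q h"
    and hd: "\<And>a. a \<in> carrier R \<Longrightarrow> h (dS (\<pi> a)) = dI +>\<^bsub>\<Omega>\<^esub> d a"
    using kaehler_quotient_iso by blast
  have dx: "dS (\<pi> a) \<in> carrier \<Omega>SR" if "a \<in> carrier R" for a
    by (rule derivationD(1)[OF dS_proj_derivation that])
  interpret P: plain_module R \<Omega>SR unfolding plain_module_def by (rule \<Omega>SR_module)
  have key: "h (\<Oplus>\<^bsub>\<Omega>S\<^esub>j\<in>{..n}. \<pi> (b j) \<odot>\<^bsub>\<Omega>S\<^esub> dS (\<pi> (x j))) =
      dI +>\<^bsub>\<Omega>\<^esub> (\<Oplus>\<^bsub>\<Omega>\<^esub>j\<in>{..n}. b j \<odot>\<^bsub>\<Omega>\<^esub> d (x j))"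
    if b: "b \<in> {..n} \<rightarrow> carrier R" for b
  proof -
    have bj: "b j \<in> carrier R" if "j \<le> n" for j using b that by auto
    have "h (\<Oplus>\<^bsub>\<Omega>S\<^esub>j\<in>{..n}. \<pi> (b j) \<odot>\<^bsub>\<Omega>S\<^esub> dS (\<pi> (x j))) =
        h (\<Oplus>\<^bsub>\<Omega>SR\<^esub>j\<in>{..n}. b j \<odot>\<^bsub>\<Omega>SR\<^esub> dS (\<pi> (x j)))"
      by (simp add: \<Omega>SR_def finsum_restrict_scalars)
    also have "\<dots> = (\<Oplus>\<^bsub>Q\<^esub>j\<in>{..n}. h (b j \<odot>\<^bsub>\<Omega>SR\<^esub> dS (\<pi> (x j))))"
      by (rule linear_map_finsum[OF \<Omega>SR_module Q_module lin]) (auto intro!: P.smult_closed bj dx x)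
    also have "\<dots> = (\<Oplus>\<^bsub>Q\<^esub>j\<in>{..n}. dI +>\<^bsub>\<Omega>\<^esub> (b j \<odot>\<^bsub>\<Omega>\<^esub> d (x j)))"
      by (rule Q.finsum_cong')
        (auto simp: linear_mapD(3)[OF lin bj dx[OF x]] hd[OF x]
          linear_mapD(3)[OF Q_proj bj d_closed[OF x]] intro!: linear_mapD(1)[OF Q_proj] Q.smult_closed \<Omega>.smult_closed d_closed bj x)
    also have "\<dots> = dI +>\<^bsub>\<Omega>\<^esub> (\<Oplus>\<^bsub>\<Omega>\<^esub>j\<in>{..n}. b j \<odot>\<^bsub>\<Omega>\<^esub> d (x j))"
      by (rule linear_map_finsum[OF kaehler_module Q_module Q_proj, symmetric])
        (auto intro!: \<Omega>.smult_closed d_closed bj x)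
    finally show ?thesis .
  qed
  have graded: "h ` kaehler_part S (\<pi> ` C) (\<lambda>k. \<pi> ` Rgr k) n (\<lambda>j. \<pi> (x j)) k =
      (\<lambda>w. dI +>\<^bsub>\<Omega>\<^esub> w) ` kaehler_part R C Rgr n x k" for k
  proof (cases "k = 0")
    case True
    have "h \<zero>\<^bsub>\<Omega>S\<^esub> = dI +>\<^bsub>\<Omega>\<^esub> \<zero>\<^bsub>\<Omega>\<^esub>"
      using linear_map_minus(1)[OF \<Omega>SR_module Q_module lin]
        linear_map_minus(1)[OF kaehler_module Q_module Q_proj] by (simp add: \<Omega>SR_def)
    then show ?thesis using True by (simp add: kaehler_part_def \<Omega>S_def)
  next
    case False
    let ?s = "\<lambda>a. \<Oplus>\<^bsub>\<Omega>S\<^esub>j\<in>{..n}. a j \<odot>\<^bsub>\<Omega>S\<^esub> dS (\<pi> (x j))"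
    let ?t = "\<lambda>b. \<Oplus>\<^bsub>\<Omega>\<^esub>j\<in>{..n}. b j \<odot>\<^bsub>\<Omega>\<^esub> d (x j)"
    have part: "kaehler_part S (\<pi> ` C) (\<lambda>k. \<pi> ` Rgr k) n (\<lambda>j. \<pi> (x j)) k =
        ?s ` ({..n} \<rightarrow> \<pi> ` Rgr (k - 1))"
      "kaehler_part R C Rgr n x k = ?t ` ({..n} \<rightarrow> Rgr (k - 1))"
      using False unfolding kaehler_part_def \<Omega>S_def dS_def by auto
    have key': "h (?s (\<lambda>j. \<pi> (b j))) = dI +>\<^bsub>\<Omega>\<^esub> ?t b" if "b \<in> {..n} \<rightarrow> Rgr (k - 1)" for b
      using key[of b] that gr by (auto simp: Pi_iff subset_iff)
    show ?thesis
      unfolding part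
    proof (intro equalityI subsetI)
      fix u assume "u \<in> h ` ?s ` ({..n} \<rightarrow> \<pi> ` Rgr (k - 1))"
      then obtain a where a: "a \<in> {..n} \<rightarrow> \<pi> ` Rgr (k - 1)" "u = h (?s a)" by blast
      \<comment> \<open>The bound on j stands inside the existential so that preimages can be chosen
        by one total function.\<close>
      have "\<exists>r. j \<le> n \<longrightarrow> r \<in> Rgr (k - 1) \<and> a j = \<pi> r" for j using a(1) by auto
      then obtain b where b: "\<And>j. j \<le> n \<Longrightarrow> b j \<in> Rgr (k - 1) \<and> a j = \<pi> (b j)" by metis
      have bpi: "b \<in> {..n} \<rightarrow> Rgr (k - 1)" using b by auto
      have "?s a = ?s (\<lambda>j. \<pi> (b j))"
        by (rule S.\<Omega>.M.finsum_cong'[folded \<Omega>S_def])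
          (use b gr in \<open>auto simp: \<Omega>SR_def[symmetric] intro!: P.smult_closed[unfolded \<Omega>SR_def restrict_scalars_simps] dx[unfolded \<Omega>SR_def restrict_scalars_simps] x\<close>)
      then show "u \<in> (\<lambda>w. dI +>\<^bsub>\<Omega>\<^esub> w) ` ?t ` ({..n} \<rightarrow> Rgr (k - 1))"
        using a(2) key'[OF bpi] bpi by auto
    next
      fix u assume "u \<in> (\<lambda>w. dI +>\<^bsub>\<Omega>\<^esub> w) ` ?t ` ({..n} \<rightarrow> Rgr (k - 1))"
      then obtain b where b: "b \<in> {..n} \<rightarrow> Rgr (k - 1)" "u = dI +>\<^bsub>\<Omega>\<^esub> ?t b" by blast
      have "(\<lambda>j. \<pi> (b j)) \<in> {..n} \<rightarrow> \<pi> ` Rgr (k - 1)" using b(1) by auto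
      then show "u \<in> h ` ?s ` ({..n} \<rightarrow> \<pi> ` Rgr (k - 1))"
        unfolding b(2) key'[OF b(1), symmetric] by (intro imageI)
    qed
  qed
  show ?thesis
    unfolding graded_module_iso_def
    by (intro exI[of _ h] CollectI conjI ballI allI iso linear_mapD(3)[OF lin] graded)
qed

text \<open>Assumption \<open>gen\<close> expresses, as a test on submodules, that the d(x_j)
  generate Omega; it is what extends g d(x_j) in N to g w in N for all w.\<close>

lemma (in quotient_algebra) dI_generators:
  assumes G: "G \<subseteq> carrier R" "I = Idl G" and x: "\<And>j. j \<le> n \<Longrightarrow> x j \<in> carrier R"
    and gen: "\<And>N. submodule N R \<Omega> \<Longrightarrow> (\<And>j. j \<le> n \<Longrightarrow> d (x j) \<in> N) \<Longrightarrow> N = carrier \<Omega>"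
  shows "dI = mod_span R \<Omega> ({d g | g. g \<in> G} \<union> {g \<odot>\<^bsub>\<Omega>\<^esub> d (x j) | g j. g \<in> G \<and> j \<le> n})"
    (is "_ = mod_span R \<Omega> ?B")
proof -
  have GI: "G \<subseteq> I" unfolding G(2) by (rule R.genideal_self[OF G(1)])
  have B: "?B \<subseteq> carrier \<Omega>" using G(1) x by auto
  define N where "N = mod_span R \<Omega> ?B"
  have N: "submodule N R \<Omega>" unfolding N_def by (rule \<Omega>.mod_span_submodule[OF B])
  note N' = \<Omega>.submoduleE[OF N] \<Omega>.submodule_zero[OF N]
  have BN: "?B \<subseteq> N" unfolding N_def by (rule mod_span_superset)
  have "?B \<subseteq> dI"
  proof
    fix w assume "w \<in> ?B"
    then consider g where "g \<in> G" "w = d g" | g j where "g \<in> G" "j \<le> n" "w = g \<odot>\<^bsub>\<Omega>\<^esub> d (x j)"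
      by blast
    then show "w \<in> dI"
    proof cases
      case 1
      then show ?thesis using d_mem_dI subsetD[OF GI] by simp
    next
      case 2
      then show ?thesis using ideal_smult_mem_dI[OF subsetD[OF GI] d_closed[OF x]] by simp
    qed
  qed
  then have 1: "N \<subseteq> dI" unfolding N_def by (rule mod_span_least[OF dI_submodule])
  \<comment> \<open>Since d(r a) = r da + a dr with r arbitrary, closure of T under multiplication
    needs a w in N for all w, not only da in N.\<close>
  define T where "T = {r \<in> carrier R. d r \<in> N \<and> (\<forall>w\<in>carrier \<Omega>. r \<odot>\<^bsub>\<Omega>\<^esub> w \<in> N)}"
  have d0: "d \<zero> = \<zero>\<^bsub>\<Omega>\<^esub>"
    using d_add[of \<zero> \<zero>] d_closed[OF R.zero_closed] by (simp add: \<Omega>.M.add.r_cancel_one')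
  have "ideal T R"
  proof (rule R.ideal_by_left_multI)
    show "T \<subseteq> carrier R" by (auto simp: T_def)
    show "\<zero> \<in> T" by (simp add: T_def d0 N')
    show "a \<oplus> b \<in> T" if "a \<in> T" "b \<in> T" for a b
      using that by (simp add: T_def d_add \<Omega>.smult_l_distr N'(5))
    show "r \<otimes> a \<in> T" if "r \<in> carrier R" "a \<in> T" for r a
      using that by (simp add: T_def d_mult \<Omega>.smult_assoc1 N'(4,5))
  qed
  moreover have "G \<subseteq> T"
  proof
    fix g assume g: "g \<in> G"
    then have gR: "g \<in> carrier R" using G(1) by blast
    have lin: "linear_map R \<Omega> \<Omega> (\<lambda>w. g \<odot>\<^bsub>\<Omega>\<^esub> w)"
      by (auto simp: linear_map_def gR \<Omega>.smult_r_distr \<Omega>.smult_assoc1[symmetric] R.m_comm)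
    have "{w \<in> carrier \<Omega>. g \<odot>\<^bsub>\<Omega>\<^esub> w \<in> N} = carrier \<Omega>"
    proof (rule gen[OF linear_map_vimage[OF kaehler_module kaehler_module lin N]])
      fix j assume j: "j \<le> n"
      have "g \<odot>\<^bsub>\<Omega>\<^esub> d (x j) \<in> N" by (rule subsetD[OF BN]) (use g j in blast)
      then show "d (x j) \<in> {w \<in> carrier \<Omega>. g \<odot>\<^bsub>\<Omega>\<^esub> w \<in> N}" using x[OF j] by simp
    qed
    moreover have "d g \<in> N" by (rule subsetD[OF BN]) (use g in blast)
    ultimately show "g \<in> T" using gR by (auto simp: T_def)
  qed
  ultimately have "I \<subseteq> T" unfolding G(2) by (rule R.genideal_minimal)
  then have "d ` I \<subseteq> N" by (auto simp: T_def)
  then have "dI \<subseteq> N" unfolding dI_def by (rule mod_span_least[OF N])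
  with 1 show ?thesis unfolding N_def by blast
qed

section \<open>Generators and grading of the differentials of the coordinate ring\<close>

context affine_scheme
begin

sublocale Om: base_algebra R K
  by (rule base_algebra.intro[OF cring_R]) (auto simp: base_algebra_axioms_def K_eq)

lemma coord_var_eq: "coord_var n I j = cls (var j)"
  by (simp add: coord_var_def cls_def)

text \<open>By the Leibniz rule the differential of a form is a combination of the dx_j, and every
  polynomial is a sum of forms.\<close>

lemma kaehler_span_vars:
  assumes N: "submodule N R Om.\<Omega>" and gen: "\<And>j. j \<le> n \<Longrightarrow> Om.d (cls (var j)) \<in> N"
  shows "N = carrier Om.\<Omega>"
proof (rule Om.kaehler_span[OF N])
  note N' = Om.\<Omega>.submoduleE[OF N] Om.\<Omega>.submodule_zero[OF N]
  have form: "Om.d (cls f) \<in> N" if "f \<in> forms n k" for f k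
    using that
  proof (induction rule: forms_induct)
    case (const c)
    have "cls (const c) \<in> K" by (simp add: K_eq)
    then show ?case using N' by (simp add: Om.d_base)
  next
    case (add k f g)
    then show ?case using N'(5) by (simp add: cls_add formsD Om.d_add)
  next
    case (var k j f)
    then show ?case
      using N'(4,5) gen[OF var(1)]
      by (simp add: cls_mult[OF formsD[OF var(2)] var_closed[OF var(1)]] Om.d_mult
          cls_closed[OF formsD[OF var(2)]] cls_closed[OF var_closed[OF var(1)]])
  qed
  fix a assume "a \<in> carrier R"
  then obtain p where p: "p \<in> carrier (poly_ring n)" "a = cls p" by (auto simp: carrier_R)
  obtain M where M: "p = (\<Sum>k\<le>M. hcomp k p)" using hcomp_decomposition by blast
  have "Om.d (cls (\<Sum>k\<le>M. hcomp k p)) \<in> N \<and> (\<Sum>k\<le>M. hcomp k p) \<in> carrier (poly_ring n)" for M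
  proof (induction M)
    case 0
    then show ?case using form hcomp_forms[OF p(1)] formsD by simp blast
  next
    case (Suc M)
    have c: "hcomp (Suc M) p \<in> carrier (poly_ring n)" by (rule formsD[OF hcomp_forms[OF p(1)]])
    then show ?case
      using Suc form[OF hcomp_forms[OF p(1)], of "Suc M"] N'(5)
      by (simp add: cls_add Om.d_add poly_ring_closed(3))
  qed
  then have "Om.d (cls (\<Sum>k\<le>M. hcomp k p)) \<in> N" by blast
  then show "Om.d a \<in> N" unfolding p(2) by (subst M)
qed

abbreviation "\<Omega>part \<equiv> kaehler_part R K (coord_part n I) n (coord_var n I)"

lemma dvar_closed: "j \<le> n \<Longrightarrow> Om.d (coord_var n I j) \<in> carrier Om.\<Omega>"
  by (simp add: coord_var_eq var_closed)

lemma coord_part_closed: "coord_part n I k \<subseteq> carrier R"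
  unfolding coord_part_eq by (rule image_subsetI) (rule cls_closed[OF formsD])

lemma coord_part_add: "a \<in> coord_part n I k \<Longrightarrow> b \<in> coord_part n I k \<Longrightarrow> a \<oplus>\<^bsub>R\<^esub> b \<in> coord_part n I k"
  unfolding coord_part_eq
  by (elim imageE) (simp add: cls_add[OF formsD formsD, symmetric] forms_add)

lemma coord_part_mult: "a \<in> coord_part n I i \<Longrightarrow> b \<in> coord_part n I k \<Longrightarrow> a \<otimes>\<^bsub>R\<^esub> b \<in> coord_part n I (i + k)"
  unfolding coord_part_eq
  by (elim imageE) (simp add: cls_mult[OF formsD formsD, symmetric] forms_mult)

lemma coord_part_zero: "\<zero>\<^bsub>R\<^esub> \<in> coord_part n I k"
  unfolding coord_part_eq using imageI[OF forms_zero, of cls] by (simp add: cls_zero)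

lemma \<Omega>part_Suc:
  "\<Omega>part (Suc k) = {(\<Oplus>\<^bsub>Om.\<Omega>\<^esub>j\<in>{..n}. a j \<odot>\<^bsub>Om.\<Omega>\<^esub> Om.d (coord_var n I j)) | a.
     a \<in> {..n} \<rightarrow> coord_part n I k}"
  by (simp add: kaehler_part_def)

lemma \<Omega>part_add:
  assumes "u \<in> \<Omega>part k" "v \<in> \<Omega>part k"
  shows "u \<oplus>\<^bsub>Om.\<Omega>\<^esub> v \<in> \<Omega>part k"
proof (cases k)
  case 0
  then show ?thesis using assms by (simp add: kaehler_part_def)
next
  case (Suc i)
  obtain a b where a: "a \<in> {..n} \<rightarrow> coord_part n I i"
    "u = (\<Oplus>\<^bsub>Om.\<Omega>\<^esub>j\<in>{..n}. a j \<odot>\<^bsub>Om.\<Omega>\<^esub> Om.d (coord_var n I j))"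
    and b: "b \<in> {..n} \<rightarrow> coord_part n I i"
    "v = (\<Oplus>\<^bsub>Om.\<Omega>\<^esub>j\<in>{..n}. b j \<odot>\<^bsub>Om.\<Omega>\<^esub> Om.d (coord_var n I j))"
    using assms unfolding Suc \<Omega>part_Suc by blast
  have ab: "a j \<in> carrier R" "b j \<in> carrier R" if "j \<le> n" for j
    using a(1) b(1) that coord_part_closed[of i] by auto
  have "u \<oplus>\<^bsub>Om.\<Omega>\<^esub> v = (\<Oplus>\<^bsub>Om.\<Omega>\<^esub>j\<in>{..n}. a j \<odot>\<^bsub>Om.\<Omega>\<^esub> Om.d (coord_var n I j) \<oplus>\<^bsub>Om.\<Omega>\<^esub> b j \<odot>\<^bsub>Om.\<Omega>\<^esub> Om.d (coord_var n I j))"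
    unfolding a(2) b(2)
    by (rule Om.\<Omega>.M.finsum_addf[symmetric]) (auto intro!: Om.\<Omega>.smult_closed ab dvar_closed)
  also have "\<dots> = (\<Oplus>\<^bsub>Om.\<Omega>\<^esub>j\<in>{..n}. (a j \<oplus>\<^bsub>R\<^esub> b j) \<odot>\<^bsub>Om.\<Omega>\<^esub> Om.d (coord_var n I j))"
    by (rule Om.\<Omega>.M.finsum_cong')
      (auto simp: Om.\<Omega>.smult_l_distr ab dvar_closed)
  finally show ?thesis
    using a(1) b(1) unfolding Suc \<Omega>part_Suc
    by (auto intro!: exI[of _ "\<lambda>j. a j \<oplus>\<^bsub>R\<^esub> b j"] coord_part_add)
qed

lemma \<Omega>part_zero: "\<zero>\<^bsub>Om.\<Omega>\<^esub> \<in> \<Omega>part k"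
proof (cases k)
  case (Suc i)
  have "(\<Oplus>\<^bsub>Om.\<Omega>\<^esub>j\<in>{..n}. \<zero>\<^bsub>R\<^esub> \<odot>\<^bsub>Om.\<Omega>\<^esub> Om.d (coord_var n I j)) = (\<Oplus>\<^bsub>Om.\<Omega>\<^esub>j\<in>{..n}. \<zero>\<^bsub>Om.\<Omega>\<^esub>)"
    by (rule Om.\<Omega>.M.finsum_cong') (auto simp: dvar_closed)
  then have "\<zero>\<^bsub>Om.\<Omega>\<^esub> = (\<Oplus>\<^bsub>Om.\<Omega>\<^esub>j\<in>{..n}. \<zero>\<^bsub>R\<^esub> \<odot>\<^bsub>Om.\<Omega>\<^esub> Om.d (coord_var n I j))"
    by simp
  then show ?thesis
    unfolding Suc \<Omega>part_Suc
    by (intro CollectI exI[of _ "\<lambda>_. \<zero>\<^bsub>R\<^esub>"]) (simp add: coord_part_zero)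
qed (simp add: kaehler_part_def)

lemma \<Omega>part_smult:
  assumes r: "r \<in> coord_part n I i" and w: "w \<in> \<Omega>part k"
  shows "r \<odot>\<^bsub>Om.\<Omega>\<^esub> w \<in> \<Omega>part (i + k)"
proof (cases k)
  case 0
  have "r \<in> carrier R" using r coord_part_closed by blast
  then have "r \<odot>\<^bsub>Om.\<Omega>\<^esub> w = \<zero>\<^bsub>Om.\<Omega>\<^esub>"
    using w 0 by (simp add: kaehler_part_def)
  then show ?thesis using \<Omega>part_zero by simp
next
  case (Suc l)
  obtain a where a: "a \<in> {..n} \<rightarrow> coord_part n I l"
    "w = (\<Oplus>\<^bsub>Om.\<Omega>\<^esub>j\<in>{..n}. a j \<odot>\<^bsub>Om.\<Omega>\<^esub> Om.d (coord_var n I j))"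
    using w unfolding Suc \<Omega>part_Suc by blast
  have aj: "a j \<in> carrier R" if "j \<le> n" for j
    using a(1) that coord_part_closed[of l] by auto
  have rR: "r \<in> carrier R" using r coord_part_closed by blast
  have "r \<odot>\<^bsub>Om.\<Omega>\<^esub> w = (\<Oplus>\<^bsub>Om.\<Omega>\<^esub>j\<in>{..n}. r \<odot>\<^bsub>Om.\<Omega>\<^esub> (a j \<odot>\<^bsub>Om.\<Omega>\<^esub> Om.d (coord_var n I j)))"
    unfolding a(2)
    by (rule Om.\<Omega>.finsum_smult_ldistr) (auto intro!: Om.\<Omega>.smult_closed aj dvar_closed rR)
  also have "\<dots> = (\<Oplus>\<^bsub>Om.\<Omega>\<^esub>j\<in>{..n}. (r \<otimes>\<^bsub>R\<^esub> a j) \<odot>\<^bsub>Om.\<Omega>\<^esub> Om.d (coord_var n I j))"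
    by (rule Om.\<Omega>.M.finsum_cong')
      (auto simp: Om.\<Omega>.smult_assoc1 aj rR dvar_closed)
  finally show ?thesis
    using a(1) coord_part_mult[OF r] unfolding Suc add_Suc_right \<Omega>part_Suc
    by (auto intro!: exI[of _ "\<lambda>j. r \<otimes>\<^bsub>R\<^esub> a j"])
qed

lemma \<Omega>part_dvar:
  assumes i: "i \<le> n"
  shows "Om.d (coord_var n I i) \<in> \<Omega>part 1"
proof -
  have "(\<Oplus>\<^bsub>Om.\<Omega>\<^esub>j\<in>{..n}. (if i = j then \<one>\<^bsub>R\<^esub> else \<zero>\<^bsub>R\<^esub>) \<odot>\<^bsub>Om.\<Omega>\<^esub> Om.d (coord_var n I j)) =
      (\<Oplus>\<^bsub>Om.\<Omega>\<^esub>j\<in>{..n}. if i = j then Om.d (coord_var n I j) else \<zero>\<^bsub>Om.\<Omega>\<^esub>)"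
    by (rule Om.\<Omega>.M.finsum_cong') (auto simp: dvar_closed)
  also have "\<dots> = Om.d (coord_var n I i)"
    by (rule Om.\<Omega>.M.add.finprod_singleton) (auto simp: i dvar_closed)
  finally have "Om.d (coord_var n I i) =
    (\<Oplus>\<^bsub>Om.\<Omega>\<^esub>j\<in>{..n}. (if i = j then \<one>\<^bsub>R\<^esub> else \<zero>\<^bsub>R\<^esub>) \<odot>\<^bsub>Om.\<Omega>\<^esub> Om.d (coord_var n I j))" by simp
  moreover have "\<one>\<^bsub>R\<^esub> \<in> coord_part n I 0"
    unfolding coord_part_eq cls_one[symmetric] by (rule imageI[OF forms_one])
  ultimately show ?thesis
    unfolding One_nat_def \<Omega>part_Suc
    by (intro CollectI exI[of _ "\<lambda>j. if i = j then \<one>\<^bsub>R\<^esub> else \<zero>\<^bsub>R\<^esub>"]) (auto simp: coord_part_zero)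
qed

text \<open>Differentiation preserves degree because dx_j was given degree one; constants go to the
  zero component in degree 0. This places df in the initial degree.\<close>

lemma d_form_in_\<Omega>part: "f \<in> forms n k \<Longrightarrow> Om.d (cls f) \<in> \<Omega>part k"
proof (induction rule: forms_induct)
  case (const c)
  have "cls (const c) \<in> K" by (simp add: K_eq)
  then show ?case by (simp add: Om.d_base kaehler_part_def)
next
  case (add k f g)
  then show ?case using \<Omega>part_add by (simp add: cls_add formsD Om.d_add)
next
  case (var k j f)
  have v: "cls (var j) \<in> coord_part n I 1" and f: "cls f \<in> coord_part n I k"
    using forms_var[OF var(1)] var(2) by (auto simp: coord_part_eq)
  have "cls f \<odot>\<^bsub>Om.\<Omega>\<^esub> Om.d (cls (var j)) \<in> \<Omega>part (k + 1)"
    using \<Omega>part_smult[OF f \<Omega>part_dvar[OF var(1)]] by (simp add: coord_var_eq)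
  moreover have "cls (var j) \<odot>\<^bsub>Om.\<Omega>\<^esub> Om.d (cls f) \<in> \<Omega>part (1 + k)"
    by (rule \<Omega>part_smult[OF v var(3)])
  ultimately show ?case
    using \<Omega>part_add
    by (simp add: cls_mult[OF formsD[OF var(2)] var_closed[OF var(1)]] Om.d_mult
          cls_closed[OF formsD[OF var(2)]] cls_closed[OF var_closed[OF var(1)]])
qed

end

text \<open>The Euler operator, the sum of X_i times the partial derivative by X_i, in the form in
  which it multiplies each monomial by its degree taken in the field.\<close>

definition euler :: "'k::field mpoly \<Rightarrow> 'k mpoly" where
  "euler p = Poly_Mapping.mapp (\<lambda>m c. of_nat (mon_deg m) * c) p"

lemma euler_lookup: "Poly_Mapping.lookup (euler p) m = of_nat (mon_deg m) * Poly_Mapping.lookup p m"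
  by (simp add: euler_def lookup_mapp when_def in_keys_iff)

lemma euler_add: "euler (p + q) = euler p + euler q"
  by (rule poly_mapping_eqI) (simp add: euler_lookup lookup_add algebra_simps)

lemma euler_diff: "euler (p - q) = euler p - euler q"
  by (rule poly_mapping_eqI) (simp add: euler_lookup lookup_minus algebra_simps)

lemma euler_zero: "euler 0 = 0"
  by (rule poly_mapping_eqI) (simp add: euler_lookup)

lemma euler_sum: "euler (sum f A) = (\<Sum>i\<in>A. euler (f i))"
  by (induction A rule: infinite_finite_induct) (simp_all add: euler_add euler_zero)

lemma const_mult_lookup: "Poly_Mapping.lookup (const c * p) m = c * Poly_Mapping.lookup p m"
  unfolding const_def mult_map_scale_conv_mult[symmetric]
  by (simp add: Poly_Mapping.map.rep_eq when_def)

lemma euler_form: "f \<in> forms n k \<Longrightarrow> euler f = const (of_nat k) * f"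
  by (rule poly_mapping_eqI) (auto simp: euler_lookup const_mult_lookup forms_def in_keys_iff)

text \<open>For forms the rule just says that degrees add. Both sides are biadditive, so decomposing
  p and q into components gives the general case.\<close>

lemma euler_mult:
  assumes p: "p \<in> carrier (poly_ring n)" and q: "q \<in> carrier (poly_ring n)"
  shows "euler (p * q) = p * euler q + q * euler p"
proof -
  have form: "euler (f * g) = f * euler g + g * euler f" if "f \<in> forms n i" "g \<in> forms n j" for f g i j
    by (simp add: euler_form[OF forms_mult[OF that]] euler_form[OF that(1)] euler_form[OF that(2)]
        const_arith algebra_simps)
  obtain M where M: "p = (\<Sum>k\<le>M. hcomp k p)" using hcomp_decomposition by blast
  obtain N where N: "q = (\<Sum>k\<le>N. hcomp k q)" using hcomp_decomposition by blast
  have "euler ((\<Sum>k\<le>M. hcomp k p) * (\<Sum>k\<le>N. hcomp k q)) =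
      (\<Sum>k\<le>M. hcomp k p) * euler (\<Sum>k\<le>N. hcomp k q) + (\<Sum>k\<le>N. hcomp k q) * euler (\<Sum>k\<le>M. hcomp k p)"
    by (simp add: sum_product euler_sum form[OF hcomp_forms[OF p] hcomp_forms[OF q]] sum.distrib)
      (rule sum.swap)
  then show ?thesis using M N by simp
qed

text \<open>R as a module over itself, the target to which \<open>kaehler_lift\<close> is applied
  for the Euler derivation.\<close>

lemma (in cring) self_module:
  "module R \<lparr>carrier = carrier R, monoid.mult = undefined, monoid.one = undefined,
      ring.zero = \<zero>, ring.add = add R, smult = (\<otimes>)\<rparr>" (is "module R ?M")
proof (rule moduleI)
  show "abelian_group ?M"
    by (rule abelian_group_cong[OF abelian_group_axioms]) simp_all
qed (simp_all add: is_cring l_distr r_distr m_assoc)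

context affine_scheme
begin

lemma euler_closed: "p \<in> carrier (poly_ring n) \<Longrightarrow> euler p \<in> carrier (poly_ring n)"
  by (auto simp: poly_ring_carrier in_keys_iff euler_lookup)

text \<open>The components of p lie in I by gradedness and are only rescaled. This is what lets the
  Euler operator descend to the coordinate ring.\<close>

lemma euler_ideal: "p \<in> I \<Longrightarrow> euler p \<in> I"
proof -
  assume p: "p \<in> I"
  obtain N where N: "p = (\<Sum>k\<le>N. hcomp k p)" using hcomp_decomposition by blast
  have "euler (hcomp k p) \<in> I" for k
    unfolding euler_form[OF hcomp_forms[OF subsetD[OF I(1) p]]]
    by (rule I(4)[OF const_closed graded_idealD(2)[OF graded p]])
  then have "(\<Sum>k\<le>N. euler (hcomp k p)) \<in> I" by (rule poly_ideal_sum[OF ideal])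
  then show ?thesis by (metis N euler_sum)
qed

text \<open>By Euler's formula the derivation of \<open>R\<close> that multiplies forms by their degree induces
  a linear map sending \<open>df\<close> to \<open>k f\<close>, for a form \<open>f\<close> of degree \<open>k\<close>.\<close>

lemma d_form_nonzero:
  assumes f: "f \<in> forms n k" "f \<notin> I" and k: "of_nat k \<noteq> (0 :: 'k)"
  shows "Om.d (cls f) \<noteq> \<zero>\<^bsub>Om.\<Omega>\<^esub>"
proof
  assume zero: "Om.d (cls f) = \<zero>\<^bsub>Om.\<Omega>\<^esub>"
  let ?M = "\<lparr>carrier = carrier R, monoid.mult = undefined, monoid.one = undefined,
      ring.zero = \<zero>\<^bsub>R\<^esub>, ring.add = add R, smult = (\<otimes>\<^bsub>R\<^esub>)\<rparr>"
  \<comment> \<open>Defined on residue classes through a chosen representative; the choice is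
    immaterial because the Euler operator preserves I.\<close>
  define E where "E u = cls (euler (SOME p. p \<in> carrier (poly_ring n) \<and> cls p = u))" for u
  have E: "E (cls p) = cls (euler p)" if p: "p \<in> carrier (poly_ring n)" for p
  proof -
    define q where "q = (SOME q. q \<in> carrier (poly_ring n) \<and> cls q = cls p)"
    have "q \<in> carrier (poly_ring n) \<and> cls q = cls p"
      unfolding q_def by (rule someI[of _ p]) (simp add: p)
    then have q: "q \<in> carrier (poly_ring n)" "cls q = cls p" by blast+
    have "euler q - euler p \<in> I"
      using cls_eq_iff[OF q(1) p] q(2) euler_ideal[of "q - p"] by (simp add: euler_diff)
    then have "cls (euler q) = cls (euler p)"
      using cls_eq_iff[OF euler_closed[OF q(1)] euler_closed[OF p]] by simp
    then show ?thesis by (simp add: E_def q_def[symmetric])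
  qed
  have "derivation R K ?M E"
    unfolding derivation_def
  proof (intro conjI ballI Pi_I)
    fix u assume "u \<in> carrier R"
    then obtain p where p: "p \<in> carrier (poly_ring n)" "u = cls p" by (auto simp: carrier_R)
    show "E u \<in> carrier ?M" using p E by (simp add: euler_closed)
    fix v assume "v \<in> carrier R"
    then obtain q where q: "q \<in> carrier (poly_ring n)" "v = cls q" by (auto simp: carrier_R)
    show "E (u \<oplus>\<^bsub>R\<^esub> v) = E u \<oplus>\<^bsub>?M\<^esub> E v"
      using p q E[OF poly_ring_closed(3)[OF p(1) q(1)]] E[OF p(1)] E[OF q(1)]
      by (simp add: cls_add euler_add euler_closed)
    show "E (u \<otimes>\<^bsub>R\<^esub> v) = u \<odot>\<^bsub>?M\<^esub> E v \<oplus>\<^bsub>?M\<^esub> v \<odot>\<^bsub>?M\<^esub> E u"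
      using p q E[OF poly_ring_closed(4)[OF p(1) q(1)]] E[OF p(1)] E[OF q(1)]
      by (simp add: cls_mult cls_add euler_mult[OF p(1) q(1)] euler_closed poly_ring_closed(4))
  next
    fix c assume "c \<in> K"
    then obtain a where a: "c = cls (const a)" by (auto simp: K_eq)
    show "E c = \<zero>\<^bsub>?M\<^esub>"
      using euler_form[OF forms_const[of a n]] by (simp add: a E const_arith cls_zero)
  qed
  then obtain g where g: "linear_map R Om.\<Omega> ?M g" "\<And>a. a \<in> carrier R \<Longrightarrow> g (Om.d a) = E a"
    using Om.kaehler_lift[OF R.self_module] by metis
  have fc: "f \<in> carrier (poly_ring n)" by (rule formsD[OF f(1)])
  have "E (cls f) = \<zero>\<^bsub>R\<^esub>"
    using g(2)[OF cls_closed[OF fc]] zero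
      linear_map_minus(1)[OF Om.kaehler_module R.self_module g(1)] by simp
  then have "cls (const (of_nat k) * f) = \<zero>\<^bsub>R\<^esub>"
    using E[OF fc] euler_form[OF f(1)] by simp
  then have "const (of_nat k) * f \<in> I"
    using cls_zero_iff fc by (simp add: poly_ring_closed(4))
  then have "const (inverse (of_nat k)) * (const (of_nat k) * f) \<in> I" by (rule I(4)[OF const_closed])
  then have "const (inverse (of_nat k) * of_nat k) * f \<in> I" by (simp only: const_arith(4) mult.assoc)
  then show False using k f(2) by (simp add: const_arith(2))
qed

end

section \<open>The submodule generated by the differentials of I_Y / I_X\<close>

context affine_subscheme
begin

lemma rel_ideal_ideal: "ideal (rel_ideal n I J) R"
proof (rule R.ideal_by_left_multI)
  show "rel_ideal n I J \<subseteq> carrier R" using Y.I(1) by (auto simp: rel_ideal_eq)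
  show "\<zero>\<^bsub>R\<^esub> \<in> rel_ideal n I J"
    unfolding rel_ideal_eq cls_zero[symmetric] by (rule imageI[OF Y.I(2)])
  show "a \<oplus>\<^bsub>R\<^esub> b \<in> rel_ideal n I J" if ab: "a \<in> rel_ideal n I J" "b \<in> rel_ideal n I J" for a b
  proof -
    obtain f g where fg: "a = cls f" "b = cls g" "f \<in> J" "g \<in> J" using ab by (auto simp: rel_ideal_eq)
    then have "a \<oplus>\<^bsub>R\<^esub> b = cls (f + g)" using Y.I(1) by (simp add: cls_add subset_iff)
    then show ?thesis using Y.I(3)[OF fg(3,4)] by (simp add: rel_ideal_eq)
  qed
  show "r \<otimes>\<^bsub>R\<^esub> a \<in> rel_ideal n I J" if r: "r \<in> carrier R" and a: "a \<in> rel_ideal n I J" for r a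
  proof -
    obtain f g where fg: "r = cls f" "a = cls g" "f \<in> carrier (poly_ring n)" "g \<in> J"
      using r a by (auto simp: rel_ideal_eq carrier_R)
    then have "r \<otimes>\<^bsub>R\<^esub> a = cls (f * g)" using Y.I(1) by (simp add: cls_mult subset_iff)
    then show ?thesis using Y.I(4)[OF fg(3,4)] by (simp add: rel_ideal_eq)
  qed
qed

sublocale A: quotient_algebra R K "rel_ideal n I J"
  by (intro quotient_algebra.intro Om.base_algebra_axioms rel_ideal_ideal)

lemma d_ideal_eq: "d_ideal n I J = A.dI"
  by (simp add: d_ideal_def A.dI_def Omega_def dd_def)

lemma differential_iso:
  "\<exists>h. h \<in> graded_module_iso (coord_ring n I)
     (sub_Omega n I J) (sub_Omega_part n I J)
     (mod_quot (Omega n I) (d_ideal n I J))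
     (\<lambda>k. (\<lambda>w. d_ideal n I J +>\<^bsub>Omega n I\<^esub> w) ` Omega_part n I k)"
proof -
  have proj: "sub_proj n I J = A.\<pi>"
    by (simp add: sub_proj_def A.\<pi>_def fun_eq_iff)
  have S: "sub_ring n I J = A.S" by (simp add: sub_ring_def A.S_def)
  have 1: "sub_Omega n I J = A.\<Omega>SR"
    by (simp add: sub_Omega_def A.\<Omega>SR_def A.\<Omega>S_def proj S)
  have 2: "sub_Omega_part n I J =
      kaehler_part A.S (A.\<pi> ` K) (\<lambda>k. A.\<pi> ` coord_part n I k) n (\<lambda>j. A.\<pi> (coord_var n I j))"
    by (simp add: sub_Omega_part_def proj S)
  have v: "coord_var n I j \<in> carrier R" if "j \<le> n" for j
    by (simp add: coord_var_eq var_closed that)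
  show ?thesis
    unfolding 1 2 d_ideal_eq Omega_def Omega_part_def
    by (rule A.kaehler_quotient_graded_iso[OF coord_part_closed v])
qed

lemma d_ideal_generators:
  assumes "G \<subseteq> carrier R" "Idl\<^bsub>R\<^esub> G = rel_ideal n I J"
  shows "d_ideal n I J = mod_span (coord_ring n I) (Omega n I)
    ({dd n I g | g. g \<in> G} \<union>
     {g \<odot>\<^bsub>Omega n I\<^esub> dd n I (coord_var n I j) | g j. g \<in> G \<and> j \<le> n})"
  unfolding d_ideal_eq Omega_def dd_def
proof (rule A.dI_generators[OF assms(1) assms(2)[symmetric]])
  show "coord_var n I j \<in> carrier R" if "j \<le> n" for j
    by (simp add: coord_var_eq var_closed that)
  show "N = carrier Om.\<Omega>" if "submodule N R Om.\<Omega>" "\<And>j. j \<le> n \<Longrightarrow> Om.d (coord_var n I j) \<in> N" for N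
    using kaehler_span_vars[OF that(1)] that(2) by (simp add: coord_var_eq)
qed

lemma d_ideal_separator:
  assumes deg: "scheme_deg n J + 1 = scheme_deg n I" and s: "s \<in> minimal_separators n I J"
  shows "d_ideal n I J = mod_span (coord_ring n I) (Omega n I)
    {dd n I s, s \<odot>\<^bsub>Omega n I\<^esub> dd n I (coord_var n I 0)}"
proof -
  obtain f where f: "f \<in> forms n (init_deg n I J)" and sf: "s = cls f"
    and "cls f \<in> rel_ideal n I J" "cls f \<noteq> \<zero>\<^bsub>R\<^esub>"
    using s by (auto simp: minimal_separators_def coord_part_eq)
  then have fJ: "f \<in> J" and fI: "f \<notin> I"
    using cls_mem_rel_ideal[OF formsD[OF f]] cls_zero_iff[OF formsD[OF f]] by blast+
  have fc: "f \<in> carrier (poly_ring n)" by (rule formsD[OF f])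
  have sR: "s \<in> carrier R" using fc by (simp add: sf)
  have "Idl\<^bsub>R\<^esub> {s} = rel_ideal n I J"
  proof (rule equalityI)
    show "Idl\<^bsub>R\<^esub> {s} \<subseteq> rel_ideal n I J"
      by (rule R.genideal_minimal[OF rel_ideal_ideal]) (simp add: sf rel_ideal_eq fJ)
    show "rel_ideal n I J \<subseteq> Idl\<^bsub>R\<^esub> {s}"
    proof
      fix a assume "a \<in> rel_ideal n I J"
      then obtain g where g: "g \<in> J" "a = cls g" by (auto simp: rel_ideal_eq)
      obtain r where r: "r \<in> carrier (poly_ring n)" "g - r * f \<in> I"
        using separator_multiples[OF deg f fJ fI g(1)] by blast
      have "cls g = cls (r * f)"
        using cls_eq_iff[OF subsetD[OF Y.I(1) g(1)] poly_ring_closed(4)[OF r(1) fc]] r(2) by blast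
      then have "a = cls r \<otimes>\<^bsub>R\<^esub> s" using r fc by (simp add: g(2) sf cls_mult)
      moreover have "s \<in> Idl\<^bsub>R\<^esub> {s}" using R.genideal_self'[OF sR] .
      ultimately show "a \<in> Idl\<^bsub>R\<^esub> {s}"
        using ideal.I_l_closed[OF R.genideal_ideal[of "{s}"]] sR cls_closed[OF r(1)] by simp
    qed
  qed
  then have eq: "d_ideal n I J = mod_span R Om.\<Omega>
      ({Om.d g | g. g \<in> {s}} \<union> {g \<odot>\<^bsub>Om.\<Omega>\<^esub> Om.d (coord_var n I j) | g j. g \<in> {s} \<and> j \<le> n})"
    using d_ideal_generators[of "{s}"] sR by (simp add: Omega_def dd_def)
  let ?B = "{Om.d s, s \<odot>\<^bsub>Om.\<Omega>\<^esub> Om.d (coord_var n I 0)}"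
  have B: "?B \<subseteq> carrier Om.\<Omega>" using sR dvar_closed by simp
  note N = Om.\<Omega>.submoduleE[OF Om.\<Omega>.mod_span_submodule[OF B]]
  note BN = subsetD[OF mod_span_superset[of ?B R Om.\<Omega>]]
  have var: "s \<odot>\<^bsub>Om.\<Omega>\<^esub> Om.d (coord_var n I j) \<in> mod_span R Om.\<Omega> ?B" if j: "j \<le> n" for j
  proof -
    obtain c where c: "var j * f - const c * (var 0 * f) \<in> I"
      using separator_var_multiple[OF deg f fJ fI j] by blast
    let ?x = "cls (var j)" and ?y = "cls (var 0)" and ?c = "cls (const c)"
    have v: "(var j :: 'k mpoly) \<in> carrier (poly_ring n)" "(var 0 :: 'k mpoly) \<in> carrier (poly_ring n)"
      using var_closed j by auto
    then have xyR: "?x \<in> carrier R" "?y \<in> carrier R" "?c \<in> carrier R" by simp_all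
    have cK: "?c \<in> K" by (simp add: K_eq)
    have "cls (var j * f) = cls (const c * (var 0 * f))"
      using cls_eq_iff[of "var j * f" "const c * (var 0 * f)"] c v fc
      by (simp add: poly_ring_closed(4))
    then have "?x \<otimes>\<^bsub>R\<^esub> s = ?c \<otimes>\<^bsub>R\<^esub> (?y \<otimes>\<^bsub>R\<^esub> s)"
      using v fc poly_ring_closed(4)[OF v(2) fc] by (simp add: cls_mult sf)
    then have "Om.d (?x \<otimes>\<^bsub>R\<^esub> s) = Om.d (?c \<otimes>\<^bsub>R\<^esub> (?y \<otimes>\<^bsub>R\<^esub> s))" by simp
    \<comment> \<open>Because dc = 0, differentiating x_j s = c x_0 s leaves s dx_j as the only term
      not visibly in the span of ds and s dx_0; subtracting x_j ds isolates it.\<close>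
    then have leib: "?x \<odot>\<^bsub>Om.\<Omega>\<^esub> Om.d s \<oplus>\<^bsub>Om.\<Omega>\<^esub> s \<odot>\<^bsub>Om.\<Omega>\<^esub> Om.d ?x =
        ?c \<odot>\<^bsub>Om.\<Omega>\<^esub> (?y \<odot>\<^bsub>Om.\<Omega>\<^esub> Om.d s \<oplus>\<^bsub>Om.\<Omega>\<^esub> s \<odot>\<^bsub>Om.\<Omega>\<^esub> Om.d ?y)"
      using xyR sR by (simp add: Om.d_mult Om.d_base[OF cK])
    have "?c \<odot>\<^bsub>Om.\<Omega>\<^esub> (?y \<odot>\<^bsub>Om.\<Omega>\<^esub> Om.d s \<oplus>\<^bsub>Om.\<Omega>\<^esub> s \<odot>\<^bsub>Om.\<Omega>\<^esub> Om.d ?y) \<in> mod_span R Om.\<Omega> ?B"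
      by (intro N(4,5) xyR BN) (simp_all add: coord_var_eq)
    moreover have "?x \<odot>\<^bsub>Om.\<Omega>\<^esub> Om.d s \<in> mod_span R Om.\<Omega> ?B"
      by (intro N(4) xyR BN) simp
    ultimately have "(?x \<odot>\<^bsub>Om.\<Omega>\<^esub> Om.d s \<oplus>\<^bsub>Om.\<Omega>\<^esub> s \<odot>\<^bsub>Om.\<Omega>\<^esub> Om.d ?x) \<ominus>\<^bsub>Om.\<Omega>\<^esub> ?x \<odot>\<^bsub>Om.\<Omega>\<^esub> Om.d s
        \<in> mod_span R Om.\<Omega> ?B"
      unfolding leib by (rule Om.\<Omega>.submodule_minus[OF Om.\<Omega>.mod_span_submodule[OF B]])
    moreover have "(?x \<odot>\<^bsub>Om.\<Omega>\<^esub> Om.d s \<oplus>\<^bsub>Om.\<Omega>\<^esub> s \<odot>\<^bsub>Om.\<Omega>\<^esub> Om.d ?x) \<ominus>\<^bsub>Om.\<Omega>\<^esub> ?x \<odot>\<^bsub>Om.\<Omega>\<^esub> Om.d s =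
        s \<odot>\<^bsub>Om.\<Omega>\<^esub> Om.d ?x"
      using xyR sR
      by (simp add: a_minus_def Om.\<Omega>.M.a_comm[of "?x \<odot>\<^bsub>Om.\<Omega>\<^esub> Om.d s"] Om.\<Omega>.M.a_assoc Om.\<Omega>.M.r_neg)
    ultimately show ?thesis by (simp add: coord_var_eq)
  qed
  show ?thesis
    unfolding eq unfolding Omega_def dd_def
  proof (rule Om.\<Omega>.mod_span_eqI[OF _ B])
    let ?A = "{Om.d g | g. g \<in> {s}} \<union> {g \<odot>\<^bsub>Om.\<Omega>\<^esub> Om.d (coord_var n I j) | g j. g \<in> {s} \<and> j \<le> n}"
    show "?A \<subseteq> carrier Om.\<Omega>" using sR dvar_closed by auto
    show "?A \<subseteq> mod_span R Om.\<Omega> ?B" using var BN[of "Om.d s"] by auto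
    have "?B \<subseteq> ?A" by auto
    then show "?B \<subseteq> mod_span R Om.\<Omega> ?A" by (rule order_trans[OF _ mod_span_superset])
  qed
qed

lemma d_ideal_initial_degree:
  assumes char: "CHAR('k) = 0 \<or> CHAR('k) > reg_index n I"
  shows "d_ideal n I J \<inter> Omega_part n I (init_deg n I J) \<noteq> {\<zero>\<^bsub>Omega n I\<^esub>}"
proof -
  let ?a = "init_deg n I J"
  obtain f where f: "f \<in> forms n ?a" "f \<in> J" "f \<notin> I" using init_deg_witness by blast
  \<comment> \<open>In positive characteristic p the initial degree satisfies 0 < alpha \<le> r_X <
    p, so p does not divide it.\<close>
  have "of_nat ?a \<noteq> (0 :: 'k)"
    using char init_deg_pos init_deg_le_reg_index
    by (auto simp: of_nat_eq_0_iff_char_dvd dest: dvd_imp_le)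
  then have "Om.d (cls f) \<noteq> \<zero>\<^bsub>Om.\<Omega>\<^esub>" by (rule d_form_nonzero[OF f(1,3)])
  moreover have "Om.d (cls f) \<in> A.dI"
    by (rule A.d_mem_dI) (simp add: rel_ideal_eq f(2))
  moreover have "Om.d (cls f) \<in> \<Omega>part ?a" by (rule d_form_in_\<Omega>part[OF f(1)])
  ultimately show ?thesis unfolding d_ideal_eq Omega_def Omega_part_def by blast
qed

end

text \<open>A zero-dimensional scheme has a point; were 1 in I, the prime of that point would
  contain X_0, so the point would lie on the hyperplane.\<close>

lemma affine_schemeI:
  assumes "zero_dim_scheme n I" "\<forall>\<pp>\<in>scheme_pts n I. var 0 \<notin> \<pp>"
  shows "affine_scheme n I"
proof
  show gr: "graded_ideal n I" "saturated n I"
    using assms(1) by (auto simp: zero_dim_scheme_def homog_ideal_iff)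
  show "var 0 \<notin> \<pp>" if "\<pp> \<in> scheme_pts n I" for \<pp> using assms(2) that by blast
  obtain \<pp> where p: "\<pp> \<in> scheme_pts n I" using assms(1) by (auto simp: zero_dim_scheme_def)
  show "1 \<notin> I"
  proof
    assume "1 \<in> I"
    then have "1 \<in> \<pp>" using p by (auto simp: scheme_pts_def)
    moreover have "ideal \<pp> (poly_ring n)"
      using p by (auto simp: scheme_pts_def homog_ideal_def)
    ultimately have "var 0 * 1 \<in> \<pp>" using poly_idealD(4) var_closed[of 0 n] by blast
    then show False using assms(2) p by simp
  qed
qed

theorem proposition8p3:
  fixes n :: nat and IX IY :: "'k::field mpoly set"
  assumes "perfect_field TYPE('k)"
    and "n \<ge> 1"
    and "zero_dim_scheme n IX"
    and "rational_support n IX"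
    and "\<forall>\<pp>\<in>scheme_pts n IX. var 0 \<notin> \<pp>"
    and "zero_dim_scheme n IY"
    and "IX \<subset> IY"
  shows
    "(\<exists>h. h \<in> graded_module_iso (coord_ring n IX)
             (sub_Omega n IX IY) (sub_Omega_part n IX IY)
             (mod_quot (Omega n IX) (d_ideal n IX IY))
             (\<lambda>k. (\<lambda>w. d_ideal n IX IY +>\<^bsub>Omega n IX\<^esub> w) ` Omega_part n IX k))
     \<and> (\<forall>G. finite G
           \<and> G \<subseteq> (\<Union>k. coord_part n IX k) - {\<zero>\<^bsub>coord_ring n IX\<^esub>}
           \<and> Idl\<^bsub>coord_ring n IX\<^esub> G = rel_ideal n IX IY
         \<longrightarrow> d_ideal n IX IY =
             mod_span (coord_ring n IX) (Omega n IX)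
               ({dd n IX g | g. g \<in> G} \<union>
                {g \<odot>\<^bsub>Omega n IX\<^esub> dd n IX (coord_var n IX j) | g j. g \<in> G \<and> j \<le> n}))
     \<and> (scheme_deg n IY + 1 = scheme_deg n IX
         \<longrightarrow> (\<forall>f \<in> minimal_separators n IX IY.
               d_ideal n IX IY =
               mod_span (coord_ring n IX) (Omega n IX)
                 {dd n IX f, f \<odot>\<^bsub>Omega n IX\<^esub> dd n IX (coord_var n IX 0)}))
     \<and> (CHAR('k) = 0 \<or> CHAR('k) > reg_index n IX
         \<longrightarrow> d_ideal n IX IY \<inter> Omega_part n IX (init_deg n IX IY) \<noteq> {\<zero>\<^bsub>Omega n IX\<^esub>})"
proof -
  \<comment> \<open>A prime over the larger ideal also lies over the smaller one, so Y inherits the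
    condition on the hyperplane from X.\<close>
  have "scheme_pts n IY \<subseteq> scheme_pts n IX" using assms(7) by (auto simp: scheme_pts_def)
  then have off: "\<forall>\<pp>\<in>scheme_pts n IY. var 0 \<notin> \<pp>" using assms(5) by blast
  interpret affine_subscheme n IX IY
    by (intro affine_subscheme.intro affine_subscheme_axioms.intro affine_schemeI assms off)
  show ?thesis
  proof (intro conjI allI impI ballI)
    fix G assume G: "finite G \<and> G \<subseteq> (\<Union>k. coord_part n IX k) - {\<zero>\<^bsub>coord_ring n IX\<^esub>}
           \<and> Idl\<^bsub>coord_ring n IX\<^esub> G = rel_ideal n IX IY"
    then have "G \<subseteq> carrier R" using coord_part_closed by blast
    then show "d_ideal n IX IY = mod_span (coord_ring n IX) (Omega n IX)
               ({dd n IX g | g. g \<in> G} \<union>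
                {g \<odot>\<^bsub>Omega n IX\<^esub> dd n IX (coord_var n IX j) | g j. g \<in> G \<and> j \<le> n})"
      by (rule d_ideal_generators) (use G in blast)
  qed (rule differential_iso d_ideal_separator d_ideal_initial_degree; assumption)+
qed

end
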